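(* Let $\omega_1,\omega_2\in\mathbb C$ and $p\in\mathbb Z_{\ge0}$. In the tensor product representation $\pi=\pi_{\mathcal H^{\omega_1}\bar\otimes\mathcal H^{\omega_2}}$ of $\mathcal F_R(\mathrm{SL}(2))$, the element $\Xi$ has eigenvectors $v(y;p)\in(\mathcal H^{\omega_1}\bar\otimes\mathcal H^{\omega_2})_{\omega_1+\omega_2+2p}$, $y\in\{0,1,\dots,p\}$, with the eigenvalue $q^{\omega_1+\omega_2+2y-1}+q^{1-\omega_1-\omega_2-2y}$. The eigenvector $v(y;p)$ is given in terms of $q$-Racah polynomials by $$v(y;p)=\sum_{k=0}^pv_k(e_{p-k}\otimes e_k),$$ $$v_k(\lambda)=(-1)^kq^{2k(\omega_1+\omega_2)+k(3p-1)}\frac{(q^{-2\lambda},q^{-2(\omega_1+p-1)},q^{-2p};q^2)_k}{(q^2,q^{2\omega_2},q^{2(\omega_1+\omega_2+p-\lambda-1)};q^2)_k}$$ $$\times R_k\!\left(\mu(p-y);q^{-2(\lambda+1)},q^{2(\omega_2-1)},q^{-2(p+1)},q^{-2(\omega_1+\omega_2+p-1)};q^2\right).$$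
   Context: Fix $0<q<1$ and put $q^x=e^{x\log q}$. $M$ is the field of meromorphic functions on $\mathfrak h^*=\mathbb C$; $T_af(\lambda)=f(\lambda+a)$. Put $$F(\lambda)=\frac{q^{2(\lambda+1)}-q^{-2}}{q^{2(\lambda+1)}-1},\quad G(\lambda)=\frac{(q^{2(\lambda+1)}-q^2)(q^{2(\lambda+1)}-q^{-2})}{(q^{2(\lambda+1)}-1)^2},$$ $$H(\lambda,\mu)=\frac{(q-q^{-1})(q^{2(\lambda+\mu+2)}-1)}{(q^{2(\lambda+1)}-1)(q^{2(\mu+1)}-1)},\quad I(\lambda,\mu)=\frac{(q-q^{-1})(q^{2(\mu+1)}-q^{2(\lambda+1)})}{(q^{2(\lambda+1)}-1)(q^{2(\mu+1)}-1)}.$$ $\mathcal F_R(\mathrm M(2))$ is the unital associative complex algebra generated by $\alpha,\beta,\gamma,\delta$ and two copies of $M$, whose elements are written $f(\lambda)=\mu_l(f)$ and $f(\mu)=\mu_r(f)$, with relations $f(\lambda)g(\mu)=g(\mu)f(\lambda)$; $f(\lambda)\alpha=\alpha f(\lambda+1)$, $f(\mu)\alpha=\alpha f(\mu+1)$, $f(\lambda)\beta=\beta f(\lambda+1)$, $f(\mu)\beta=\beta f(\mu-1)$, $f(\lambda)\gamma=\gamma f(\lambda-1)$, $f(\mu)\gamma=\gamma f(\mu+1)$, $f(\lambda)\delta=\delta f(\lambda-1)$, $f(\mu)\delta=\delta f(\mu-1)$; $\alpha\beta=qF(\mu-1)\beta\alpha$, $\alpha\gamma=qF(\lambda)\gamma\alpha$,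 $\beta\delta=qF(\lambda)\delta\beta$, $\gamma\delta=qF(\mu-1)\delta\gamma$; $\alpha\delta-\delta\alpha=H(\lambda,\mu)\gamma\beta$, $G(\mu)\alpha\delta-G(\lambda)\delta\alpha=H(\lambda,\mu)\beta\gamma$, $\beta\gamma-G(\mu)\gamma\beta=I(\lambda,\mu)\delta\alpha$, $\beta\gamma-G(\lambda)\gamma\beta=I(\lambda,\mu)\alpha\delta$. It is bigraded by $\alpha\in\mathcal F_{11}$, $\beta\in\mathcal F_{1,-1}$, $\gamma\in\mathcal F_{-1,1}$, $\delta\in\mathcal F_{-1,-1}$, $f(\lambda),f(\mu)\in\mathcal F_{00}$. $A=\mathcal F_R(\mathrm{SL}(2))$ is its quotient by $c=1$, where $c=\alpha\delta-qF(\lambda)\gamma\beta$ is central. The element $$\Xi=q^{\lambda-\mu+1}+q^{\mu-\lambda-1}-q^{-(\lambda+\mu+2)}(1-q^{2(\lambda+2)})(1-q^{2\mu})\gamma\beta$$ is central in $A$. The coproduct $\Delta:A\to A\widetilde\otimes A=\bigoplus_{a,b,c}A_{ac}\otimes A_{cb}/(f(\mu)x\otimes y=x\otimes f(\lambda)y)$ is the algebra homomorphism (factorwise multiplication) with $\Delta(\alpha)=\alpha\otimes\alpha+\beta\otimes\gamma$, $\Delta(\beta)=\alpha\otimes\beta+\beta\otimes\delta$, $\Delta(\gamma)=\gamma\otimes\alpha+\delta\otimes\gamma$, $\Delta(\delta)=\gamma\otimes\beta+\delta\otimes\delta$, $\Delta(f(\lambda))=f(\lambda)\otimes1$, $\Delta(f(\mu))=1\otimes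 f(\mu)$. An $\mathfrak h$-space is an $M$-vector space $V=\bigoplus_{a\in\mathbb C}V_a$ graded by $M$-subspaces. $(D_{\mathfrak h,V})_{ab}$ is the space of $\mathbb C$-linear operators $U$ on $V$ with $U(gv)=T_{-b}(g)U(v)$, $U(V_c)\subseteq V_{c+b-a}$; $D_{\mathfrak h,V}=\bigoplus_{a,b}(D_{\mathfrak h,V})_{ab}$ has moment maps $\mu_l(f)v=T_{-a}(f)v$, $\mu_r(f)v=fv$ for $v\in V_a$. A dynamical representation of $A$ on $V$ is an algebra homomorphism $A\to D_{\mathfrak h,V}$ preserving bigrading and moment maps. $\mathcal H^\omega$ ($\omega\in\mathbb C$) has $M$-basis $\{e_k\}_{k\ge0}$, $e_k$ of weight $\omega+2k$, and dynamical representation $\pi^\omega(\alpha)ge_k=A_k(T_{-1}g)e_k$, $\pi^\omega(\beta)ge_k=B_k(T_1g)e_{k-1}$, $\pi^\omega(\gamma)ge_k=-q^{-1}(T_{-1}g)e_{k+1}$, $\pi^\omega(\delta)ge_k=D_k(T_1g)e_k$, $\pi^\omega(\mu_l(f))ge_k=(T_{-\omega-2k}f)ge_k$, $\pi^\omega(\mu_r(f))ge_k=fge_k$ for $g\in M$, with $A_k(\lambda)=q^{-k}\frac{1-q^{2(\lambda-\omega-k+1)}}{1-q^{2(\lambda-\omega-2k+1)}}$, $B_k(\lambda)=\frac{(1-q^{2k})(1-q^{2(\omega+k-1)})}{(1-q^{2(\lambda+1)})(1-q^{2(\omega+2k-\lambda-3)})}$, $B_0=0$, $D_k(\lambda)=q^k\frac{1-q^{2(\lambda+1-k)}}{1-q^{2(\lambda+1)}}$.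 $V\bar\otimes W$ is the tensor product over $\mathbb C$ modulo $fv\otimes w=v\otimes(T_{-b}f)w$ for $w\in W_b$, with $V_a\bar\otimes W_b\subseteq(V\bar\otimes W)_{a+b}$ and scalars $f(v\otimes w)=v\otimes fw$. The tensor product of dynamical representations is $\pi_{V\bar\otimes W}(x)(v\otimes w)=\sum_i\pi_V(x_i')v\otimes\pi_W(x_i'')w$ where $\Delta(x)=\sum_ix_i'\otimes x_i''$. Notation: $(a;q)_k=\prod_{i=0}^{k-1}(1-aq^i)$, $(a_1,\dots,a_r;q)_k=\prod_i(a_i;q)_k$. The $q$-Racah polynomials are $$R_n(\mu(x);a,b,c,d;q)=\sum_{i=0}^n\frac{(q^{-n},abq^{n+1},q^{-x},cdq^{x+1};q)_i}{(q,aq,bdq,cq;q)_i}q^i,\qquad\mu(x)=q^{-x}+cdq^{x+1},$$ where one of $aq$, $bdq$, $cq$ equals $q^{-N}$ with $N\in\mathbb Z_{\ge0}$, $n\le N$ (used above in base $q^2$, with $N=p$).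
   Formalization: Eigenvectors are shown to exist for all ω1, ω2; the explicit q-Racah formula for v(y;p) is asserted only when its denominators (q^{2ω2};q^2)_p and (q^{-2(ω1+p-1)};q^2)_p are nonzero, since otherwise (e.g. ω2=0, p≥1) the formula as written divides by zero. *)

theory Defs
  imports "HOL-Complex_Analysis.Complex_Analysis" "HOL-Algebra.Module"
    "HOL-Library.Multiset" "HOL-Library.Poly_Mapping"
begin

section \<open>The field of meromorphic functions on the complex plane\<close>

text \<open>
  Every meromorphic function has exactly one \<open>nicely_meromorphic_on\<close> representative:
  removable singularities are removed and the value at a pole is set to \<open>0\<close>.
\<close>

typedef mero = "{f. f nicely_meromorphic_on (UNIV :: complex set)}"
  by (rule exI[of _ "\<lambda>_. 0"]) auto

definition mero_of :: "(complex \<Rightarrow> complex) \<Rightarrow> mero" where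
  "mero_of f = Abs_mero (remove_sings f)"

lemma Rep_mero_meromorphic: "Rep_mero f meromorphic_on UNIV"
  using Rep_mero[of f] by (simp add: nicely_meromorphic_on_def)

lemma Rep_mero_of:
  assumes "f meromorphic_on UNIV"
  shows "Rep_mero (mero_of f) = remove_sings f"
  unfolding mero_of_def using remove_sings_nicely_meromorphic[OF assms]
  by (simp add: Abs_mero_inverse)

lemma eventually_Rep_mero_of:
  assumes "f meromorphic_on UNIV"
  shows "eventually (\<lambda>z. Rep_mero (mero_of f) z = f z) (cosparse UNIV)"
  using eventually_remove_sings_eq[OF assms] by (simp add: Rep_mero_of[OF assms])

lemma remove_sings_Rep_mero: "remove_sings (Rep_mero f) = Rep_mero f"
proof
  fix z
  have "is_pole (Rep_mero f) z \<and> Rep_mero f z = 0 \<or> Rep_mero f \<midarrow>z\<rightarrow> Rep_mero f z"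
    using Rep_mero[of f] by (auto simp: nicely_meromorphic_on_def)
  then show "remove_sings (Rep_mero f) z = Rep_mero f z"
    by (auto intro: remove_sings_eqI)
qed

lemma mero_eqI:
  assumes "eventually (\<lambda>z. Rep_mero f z = Rep_mero g z) (cosparse UNIV)"
  shows "f = g"
proof -
  have "remove_sings (Rep_mero f) z = remove_sings (Rep_mero g) z" for z
    by (rule remove_sings_cong) (use eventually_cosparse_imp_eventually_at[OF assms] in auto)
  then have "Rep_mero f = Rep_mero g"
    by (auto simp: remove_sings_Rep_mero)
  then show ?thesis by (simp add: Rep_mero_inject)
qed

instantiation mero :: field
begin

definition zero_mero :: mero where "0 = mero_of (\<lambda>_. 0)"
definition one_mero :: mero where "1 = mero_of (\<lambda>_. 1)"
definition plus_mero :: "mero \<Rightarrow> mero \<Rightarrow> mero" where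
  "f + g = mero_of (\<lambda>z. Rep_mero f z + Rep_mero g z)"
definition minus_mero :: "mero \<Rightarrow> mero \<Rightarrow> mero" where
  "f - g = mero_of (\<lambda>z. Rep_mero f z - Rep_mero g z)"
definition uminus_mero :: "mero \<Rightarrow> mero" where
  "- f = mero_of (\<lambda>z. - Rep_mero f z)"
definition times_mero :: "mero \<Rightarrow> mero \<Rightarrow> mero" where
  "f * g = mero_of (\<lambda>z. Rep_mero f z * Rep_mero g z)"
definition inverse_mero :: "mero \<Rightarrow> mero" where
  "inverse f = mero_of (\<lambda>z. inverse (Rep_mero f z))"
definition divide_mero :: "mero \<Rightarrow> mero \<Rightarrow> mero" where
  "f div g = mero_of (\<lambda>z. Rep_mero f z / Rep_mero g z)"

lemmas mero_arith_defs = zero_mero_def one_mero_def plus_mero_def minus_mero_def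
  uminus_mero_def times_mero_def inverse_mero_def divide_mero_def

lemma eventually_Rep_mero:
  shows "eventually (\<lambda>z. Rep_mero 0 z = 0) (cosparse UNIV)"
    and "eventually (\<lambda>z. Rep_mero 1 z = 1) (cosparse UNIV)"
    and "eventually (\<lambda>z. Rep_mero (f + g) z = Rep_mero f z + Rep_mero g z) (cosparse UNIV)"
    and "eventually (\<lambda>z. Rep_mero (f - g) z = Rep_mero f z - Rep_mero g z) (cosparse UNIV)"
    and "eventually (\<lambda>z. Rep_mero (- f) z = - Rep_mero f z) (cosparse UNIV)"
    and "eventually (\<lambda>z. Rep_mero (f * g) z = Rep_mero f z * Rep_mero g z) (cosparse UNIV)"
    and "eventually (\<lambda>z. Rep_mero (inverse f) z = inverse (Rep_mero f z)) (cosparse UNIV)"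
    and "eventually (\<lambda>z. Rep_mero (f div g) z = Rep_mero f z / Rep_mero g z) (cosparse UNIV)"
  unfolding mero_arith_defs
  by (intro eventually_Rep_mero_of meromorphic_intros Rep_mero_meromorphic)+

lemma eventually_mero_nonzero:
  assumes "f \<noteq> 0"
  shows "eventually (\<lambda>z. Rep_mero f z \<noteq> 0) (cosparse UNIV)"
proof -
  have "\<not> frequently (\<lambda>w. Rep_mero f w = 0) (at z)" for z
  proof
    assume "frequently (\<lambda>w. Rep_mero f w = 0) (at z)"
    then have "Rep_mero f w = 0" for w
      using frequently_eq_meromorphic_imp_constant[of "Rep_mero f" 0 z UNIV w] Rep_mero[of f]
      by auto
    then have "f = 0"
      by (intro mero_eqI eventually_mono[OF eventually_Rep_mero(1)]) auto
    with assms show False by simp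
  qed
  then have "eventually (\<lambda>w. Rep_mero f w \<noteq> 0) (at z)" for z
    by (simp add: frequently_def)
  then show ?thesis
    by (simp add: eventually_cosparse_open_eq)
qed

instance
proof
  fix a b c :: mero
  note ev = eventually_Rep_mero
  show "a * b * c = a * (b * c)"
    by (rule mero_eqI)
      (use ev(6)[of "a * b" c] ev(6)[of a b] ev(6)[of a "b * c"] ev(6)[of b c] in eventually_elim, auto)
  show "a * b = b * a"
    by (rule mero_eqI) (use ev(6)[of a b] ev(6)[of b a] in eventually_elim, auto)
  show "1 * a = a"
    by (rule mero_eqI) (use ev(6)[of 1 a] ev(2) in eventually_elim, auto)
  show "a + b + c = a + (b + c)"
    by (rule mero_eqI)
      (use ev(3)[of "a + b" c] ev(3)[of a b] ev(3)[of a "b + c"] ev(3)[of b c] in eventually_elim, auto)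
  show "a + b = b + a"
    by (rule mero_eqI) (use ev(3)[of a b] ev(3)[of b a] in eventually_elim, auto)
  show "0 + a = a"
    by (rule mero_eqI) (use ev(3)[of 0 a] ev(1) in eventually_elim, auto)
  show "- a + a = 0"
    by (rule mero_eqI) (use ev(3)[of "- a" a] ev(5)[of a] ev(1) in eventually_elim, auto)
  show "a - b = a + - b"
    by (rule mero_eqI) (use ev(4)[of a b] ev(3)[of a "- b"] ev(5)[of b] in eventually_elim, auto)
  show "(a + b) * c = a * c + b * c"
    by (rule mero_eqI)
      (use ev(6)[of "a + b" c] ev(3)[of a b] ev(3)[of "a * c" "b * c"] ev(6)[of a c] ev(6)[of b c]
        in eventually_elim, auto simp: algebra_simps)
  show "inverse a * a = 1" if "a \<noteq> 0"
    by (rule mero_eqI)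
      (use ev(6)[of "inverse a" a] ev(7)[of a] ev(2) eventually_mero_nonzero[OF that]
        in eventually_elim, auto)
  show "a div b = a * inverse b"
    by (rule mero_eqI)
      (use ev(8)[of a b] ev(6)[of a "inverse b"] ev(7)[of b] in eventually_elim,
        auto simp: divide_inverse)
  show "inverse (0 :: mero) = 0"
    by (rule mero_eqI) (use ev(7)[of 0] ev(1) in eventually_elim, auto)
  show "(0 :: mero) \<noteq> 1"
  proof
    assume "(0 :: mero) = 1"
    then have "eventually (\<lambda>z. Rep_mero 0 z = 1) (cosparse UNIV)"
      using ev(2) by simp
    from eventually_conj[OF ev(1) this] have "eventually (\<lambda>z. False) (cosparse (UNIV :: complex set))"
      by (rule eventually_mono) auto
    then show False by (simp add: eventually_False)
  qed
qed

end

definition const_mero :: "complex \<Rightarrow> mero" where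
  "const_mero c = mero_of (\<lambda>_. c)"

text \<open>The translation \<open>T\<^sub>a f(\<lambda>) = f(\<lambda> + a)\<close>.\<close>

definition shift :: "complex \<Rightarrow> mero \<Rightarrow> mero" where
  "shift a f = mero_of (\<lambda>z. Rep_mero f (z + a))"


section \<open>q-notation\<close>

definition qpow :: "real \<Rightarrow> complex \<Rightarrow> complex" where
  "qpow q x = exp (x * complex_of_real (ln q))"

definition qpoch :: "complex list \<Rightarrow> complex \<Rightarrow> nat \<Rightarrow> complex" where
  "qpoch as Q k = (\<Prod>a\<leftarrow>as. \<Prod>i<k. 1 - a * Q ^ i)"

text \<open>
  The q-Racah polynomial \<open>R\<^sub>n(\<mu>(x); a,b,c,d; Q)\<close>, as a function of \<open>x\<close> rather than of
  \<open>\<mu>(x) = Q^(-x) + c d Q^(x+1)\<close>.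
\<close>

definition qracah ::
    "nat \<Rightarrow> complex \<Rightarrow> complex \<Rightarrow> complex \<Rightarrow> complex \<Rightarrow> complex \<Rightarrow> real \<Rightarrow> complex" where
  "qracah n x a b c d Q = (let Q' = complex_of_real Q in
     \<Sum>i\<le>n. qpoch [qpow Q (- of_nat n), a * b * Q' ^ (n + 1), qpow Q (- x), c * d * qpow Q (x + 1)] Q' i
            / qpoch [Q', a * Q', b * d * Q', c * Q'] Q' i * Q' ^ i)"


section \<open>Algebras presented by generators and relations\<close>

text \<open>
  Unital associative complex algebras generated by \<open>\<alpha>, \<beta>, \<gamma>, \<delta>\<close> and by symbols \<open>MuL f\<close>
  (for \<open>f(\<lambda>)\<close>) and \<open>MuR f\<close> (for \<open>f(\<mu>)\<close>): terms in the generators, modulo the least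
  congruence containing the algebra axioms and the given relations. \<open>Con c\<close> is the scalar
  multiple \<open>c \<cdot> 1\<close> of the unit.
\<close>

datatype fr_term =
    Con complex | Alpha | Beta | Gam | Delt | MuL mero | MuR mero
  | Add fr_term fr_term | Mul fr_term fr_term

instantiation fr_term :: "{zero, one, plus, times, uminus, minus}"
begin
definition zero_fr_term :: fr_term where "0 = Con 0"
definition one_fr_term :: fr_term where "1 = Con 1"
definition plus_fr_term :: "fr_term \<Rightarrow> fr_term \<Rightarrow> fr_term" where "s + t = Add s t"
definition times_fr_term :: "fr_term \<Rightarrow> fr_term \<Rightarrow> fr_term" where "s * t = Mul s t"
definition uminus_fr_term :: "fr_term \<Rightarrow> fr_term" where "- t = Con (- 1) * t"
definition minus_fr_term :: "fr_term \<Rightarrow> fr_term \<Rightarrow> fr_term" where "s - t = s + (- t)" for s t :: fr_term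
instance ..
end

inductive alg_cong :: "(fr_term \<Rightarrow> fr_term \<Rightarrow> bool) \<Rightarrow> fr_term \<Rightarrow> fr_term \<Rightarrow> bool"
  for R :: "fr_term \<Rightarrow> fr_term \<Rightarrow> bool"
where
  refl: "alg_cong R x x"
| sym: "alg_cong R x y \<Longrightarrow> alg_cong R y x"
| trans: "alg_cong R x y \<Longrightarrow> alg_cong R y z \<Longrightarrow> alg_cong R x z"
| add_cong: "alg_cong R x x' \<Longrightarrow> alg_cong R y y' \<Longrightarrow> alg_cong R (x + y) (x' + y')"
| mul_cong: "alg_cong R x x' \<Longrightarrow> alg_cong R y y' \<Longrightarrow> alg_cong R (x * y) (x' * y')"
| add_assoc: "alg_cong R (x + y + z) (x + (y + z))"
| add_comm: "alg_cong R (x + y) (y + x)"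
| add_zero: "alg_cong R (0 + x) x"
| add_neg: "alg_cong R (x + - x) 0"
| mul_assoc: "alg_cong R (x * y * z) (x * (y * z))"
| one_mul: "alg_cong R (1 * x) x"
| mul_one: "alg_cong R (x * 1) x"
| distrib_right: "alg_cong R ((x + y) * z) (x * z + y * z)"
| distrib_left: "alg_cong R (x * (y + z)) (x * y + x * z)"
| con_add: "alg_cong R (Con (c + d)) (Con c + Con d)"
| con_mul: "alg_cong R (Con (c * d)) (Con c * Con d)"
| con_central: "alg_cong R (Con c * x) (x * Con c)"
| rel: "R x y \<Longrightarrow> alg_cong R x y"

definition alg_class :: "(fr_term \<Rightarrow> fr_term \<Rightarrow> bool) \<Rightarrow> fr_term \<Rightarrow> fr_term set" where
  "alg_class R t = {s. alg_cong R t s}"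

definition presented_algebra :: "(fr_term \<Rightarrow> fr_term \<Rightarrow> bool) \<Rightarrow> fr_term set ring" where
  "presented_algebra R =
     \<lparr>carrier = range (alg_class R),
      mult = (\<lambda>X Y. \<Union>x\<in>X. \<Union>y\<in>Y. alg_class R (x * y)),
      one = alg_class R 1,
      zero = alg_class R 0,
      add = (\<lambda>X Y. \<Union>x\<in>X. \<Union>y\<in>Y. alg_class R (x + y))\<rparr>"


section \<open>The algebras F_R(M(2)) and F_R(SL(2))\<close>

definition fr_F :: "real \<Rightarrow> mero" where
  "fr_F q = mero_of (\<lambda>l. (qpow q (2 * (l + 1)) - qpow q (-2)) / (qpow q (2 * (l + 1)) - 1))"

definition fr_G :: "real \<Rightarrow> mero" where
  "fr_G q = mero_of (\<lambda>l. (qpow q (2 * (l + 1)) - qpow q 2) * (qpow q (2 * (l + 1)) - qpow q (-2))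
                        / (qpow q (2 * (l + 1)) - 1)\<^sup>2)"

text \<open>
  The functions \<open>H\<close> and \<open>I\<close> of two variables, as elements of \<open>\<mu>\<^sub>l(M) \<mu>\<^sub>r(M)\<close>. With
  \<open>u(x) = q^(2(x+1))\<close> and \<open>r = 1 / (u - 1)\<close> they are
  \<open>H = (q - 1/q) (u(\<lambda>) u(\<mu>) - 1) r(\<lambda>) r(\<mu>)\<close> and \<open>I = (q - 1/q) (u(\<mu>) - u(\<lambda>)) r(\<lambda>) r(\<mu>)\<close>.
\<close>

definition fr_u :: "real \<Rightarrow> mero" where
  "fr_u q = mero_of (\<lambda>l. qpow q (2 * (l + 1)))"

definition fr_r :: "real \<Rightarrow> mero" where
  "fr_r q = mero_of (\<lambda>l. 1 / (qpow q (2 * (l + 1)) - 1))"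

definition fr_H :: "real \<Rightarrow> fr_term" where
  "fr_H q = Con (of_real (q - 1 / q)) * (MuL (fr_u q) * MuR (fr_u q) - 1) * MuL (fr_r q) * MuR (fr_r q)"

definition fr_I :: "real \<Rightarrow> fr_term" where
  "fr_I q = Con (of_real (q - 1 / q)) * (MuR (fr_u q) - MuL (fr_u q)) * MuL (fr_r q) * MuR (fr_r q)"

inductive m2_rel :: "real \<Rightarrow> fr_term \<Rightarrow> fr_term \<Rightarrow> bool" for q :: real where
  l_const: "m2_rel q (MuL (const_mero c)) (Con c)"
| l_add: "m2_rel q (MuL (f + g)) (MuL f + MuL g)"
| l_mul: "m2_rel q (MuL (f * g)) (MuL f * MuL g)"
| r_const: "m2_rel q (MuR (const_mero c)) (Con c)"
| r_add: "m2_rel q (MuR (f + g)) (MuR f + MuR g)"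
| r_mul: "m2_rel q (MuR (f * g)) (MuR f * MuR g)"
| l_r: "m2_rel q (MuL f * MuR g) (MuR g * MuL f)"
| l_alpha: "m2_rel q (MuL f * Alpha) (Alpha * MuL (shift 1 f))"
| r_alpha: "m2_rel q (MuR f * Alpha) (Alpha * MuR (shift 1 f))"
| l_beta: "m2_rel q (MuL f * Beta) (Beta * MuL (shift 1 f))"
| r_beta: "m2_rel q (MuR f * Beta) (Beta * MuR (shift (-1) f))"
| l_gamma: "m2_rel q (MuL f * Gam) (Gam * MuL (shift (-1) f))"
| r_gamma: "m2_rel q (MuR f * Gam) (Gam * MuR (shift 1 f))"
| l_delta: "m2_rel q (MuL f * Delt) (Delt * MuL (shift (-1) f))"
| r_delta: "m2_rel q (MuR f * Delt) (Delt * MuR (shift (-1) f))"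
| alpha_beta: "m2_rel q (Alpha * Beta) (Con (of_real q) * MuR (shift (-1) (fr_F q)) * Beta * Alpha)"
| alpha_gamma: "m2_rel q (Alpha * Gam) (Con (of_real q) * MuL (fr_F q) * Gam * Alpha)"
| beta_delta: "m2_rel q (Beta * Delt) (Con (of_real q) * MuL (fr_F q) * Delt * Beta)"
| gamma_delta: "m2_rel q (Gam * Delt) (Con (of_real q) * MuR (shift (-1) (fr_F q)) * Delt * Gam)"
| alpha_delta: "m2_rel q (Alpha * Delt - Delt * Alpha) (fr_H q * Gam * Beta)"
| alpha_delta': "m2_rel q (MuR (fr_G q) * Alpha * Delt - MuL (fr_G q) * Delt * Alpha)
                          (fr_H q * Beta * Gam)"
| beta_gamma: "m2_rel q (Beta * Gam - MuR (fr_G q) * Gam * Beta) (fr_I q * Delt * Alpha)"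
| beta_gamma': "m2_rel q (Beta * Gam - MuL (fr_G q) * Gam * Beta) (fr_I q * Alpha * Delt)"

definition FR_M2 :: "real \<Rightarrow> fr_term set ring" where
  "FR_M2 q = presented_algebra (m2_rel q)"

definition fr_c :: "real \<Rightarrow> fr_term" where
  "fr_c q = Alpha * Delt - Con (of_real q) * MuL (fr_F q) * Gam * Beta"

text \<open>
  The quotient of \<open>FR_M2 q\<close> by \<open>c = 1\<close>, presented by adjoining this relation to those of
  \<open>FR_M2 q\<close>.
\<close>

definition sl2_rel :: "real \<Rightarrow> fr_term \<Rightarrow> fr_term \<Rightarrow> bool" where
  "sl2_rel q x y \<longleftrightarrow> m2_rel q x y \<or> x = fr_c q \<and> y = 1"

definition FR_SL2 :: "real \<Rightarrow> fr_term set ring" where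
  "FR_SL2 q = presented_algebra (sl2_rel q)"

abbreviation sl2_class :: "real \<Rightarrow> fr_term \<Rightarrow> fr_term set" where
  "sl2_class q \<equiv> alg_class (sl2_rel q)"

inductive homog_term :: "complex \<Rightarrow> complex \<Rightarrow> fr_term \<Rightarrow> bool" where
  "homog_term a b 0"
| "homog_term 0 0 (Con c)"
| "homog_term 1 1 Alpha"
| "homog_term 1 (-1) Beta"
| "homog_term (-1) 1 Gam"
| "homog_term (-1) (-1) Delt"
| "homog_term 0 0 (MuL f)"
| "homog_term 0 0 (MuR f)"
| "homog_term a b x \<Longrightarrow> homog_term a b y \<Longrightarrow> homog_term a b (x + y)"
| "homog_term a b x \<Longrightarrow> homog_term a' b' y \<Longrightarrow> homog_term (a + a') (b + b') (x * y)"

definition FR_SL2_deg :: "real \<Rightarrow> complex \<Rightarrow> complex \<Rightarrow> fr_term set set" where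
  "FR_SL2_deg q a b = sl2_class q ` {x. homog_term a b x}"

definition Xi_elem :: "real \<Rightarrow> fr_term set" where
  "Xi_elem q = sl2_class q
     (Con (of_real q) * MuL (mero_of (\<lambda>l. qpow q l)) * MuR (mero_of (\<lambda>m. qpow q (- m)))
      + Con (of_real (1 / q)) * MuL (mero_of (\<lambda>l. qpow q (- l))) * MuR (mero_of (\<lambda>m. qpow q m))
      - Con (qpow q (-2)) * MuL (mero_of (\<lambda>l. qpow q (- l) * (1 - qpow q (2 * (l + 2)))))
          * MuR (mero_of (\<lambda>m. qpow q (- m) * (1 - qpow q (2 * m)))) * Gam * Beta)"


section \<open>Tensor products\<close>

text \<open>
  A finite sum \<open>\<Sum> x\<^sub>i \<otimes> y\<^sub>i\<close> is represented by the multiset of the pairs \<open>(x\<^sub>i, y\<^sub>i)\<close>, and a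
  tensor product by the formal sums of pairs from \<open>P\<close>, modulo the least additive congruence
  containing the relations \<open>R\<close>.
\<close>

inductive fsum_cong ::
    "'x set \<Rightarrow> ('x multiset \<Rightarrow> 'x multiset \<Rightarrow> bool) \<Rightarrow> 'x multiset \<Rightarrow> 'x multiset \<Rightarrow> bool"
  for P :: "'x set" and R :: "'x multiset \<Rightarrow> 'x multiset \<Rightarrow> bool"
where
  refl: "set_mset S \<subseteq> P \<Longrightarrow> fsum_cong P R S S"
| sym: "fsum_cong P R S T \<Longrightarrow> fsum_cong P R T S"
| trans: "fsum_cong P R S T \<Longrightarrow> fsum_cong P R T U \<Longrightarrow> fsum_cong P R S U"
| add: "fsum_cong P R S S' \<Longrightarrow> fsum_cong P R T T' \<Longrightarrow> fsum_cong P R (S + T) (S' + T')"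
| rel: "R S T \<Longrightarrow> fsum_cong P R S T"

definition fsum_class ::
    "'x set \<Rightarrow> ('x multiset \<Rightarrow> 'x multiset \<Rightarrow> bool) \<Rightarrow> 'x multiset \<Rightarrow> 'x multiset set" where
  "fsum_class P R S = {T. fsum_cong P R S T}"


subsection \<open>The coproduct\<close>

text \<open>
  \<open>A \<otimes>~ A\<close>. That the tensor products are balanced over the complex numbers is the case of
  constant \<open>f\<close> of the last relation.
\<close>

definition AA_pairs :: "real \<Rightarrow> (fr_term set \<times> fr_term set) set" where
  "AA_pairs q = (\<Union>a b c. FR_SL2_deg q a c \<times> FR_SL2_deg q c b)"

inductive AA_rel ::
    "real \<Rightarrow> (fr_term set \<times> fr_term set) multiset \<Rightarrow> (fr_term set \<times> fr_term set) multiset \<Rightarrow> bool"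
  for q :: real
where
  zero: "Y \<in> FR_SL2_deg q c b \<Longrightarrow> AA_rel q {#(\<zero>\<^bsub>FR_SL2 q\<^esub>, Y)#} {#}"
| add_left: "X \<in> FR_SL2_deg q a c \<Longrightarrow> X' \<in> FR_SL2_deg q a c \<Longrightarrow> Y \<in> FR_SL2_deg q c b \<Longrightarrow>
    AA_rel q {#(X \<oplus>\<^bsub>FR_SL2 q\<^esub> X', Y)#} {#(X, Y), (X', Y)#}"
| add_right: "X \<in> FR_SL2_deg q a c \<Longrightarrow> Y \<in> FR_SL2_deg q c b \<Longrightarrow> Y' \<in> FR_SL2_deg q c b \<Longrightarrow>
    AA_rel q {#(X, Y \<oplus>\<^bsub>FR_SL2 q\<^esub> Y')#} {#(X, Y), (X, Y')#}"
| balanced: "X \<in> FR_SL2_deg q a c \<Longrightarrow> Y \<in> FR_SL2_deg q c b \<Longrightarrow>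
    AA_rel q {#(sl2_class q (MuR f) \<otimes>\<^bsub>FR_SL2 q\<^esub> X, Y)#} {#(X, sl2_class q (MuL f) \<otimes>\<^bsub>FR_SL2 q\<^esub> Y)#}"

primrec coproduct_term :: "real \<Rightarrow> fr_term \<Rightarrow> (fr_term set \<times> fr_term set) multiset" where
  "coproduct_term q (Con c) = {#(sl2_class q (Con c), sl2_class q 1)#}"
| "coproduct_term q Alpha =
     {#(sl2_class q Alpha, sl2_class q Alpha), (sl2_class q Beta, sl2_class q Gam)#}"
| "coproduct_term q Beta =
     {#(sl2_class q Alpha, sl2_class q Beta), (sl2_class q Beta, sl2_class q Delt)#}"
| "coproduct_term q Gam =
     {#(sl2_class q Gam, sl2_class q Alpha), (sl2_class q Delt, sl2_class q Gam)#}"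
| "coproduct_term q Delt =
     {#(sl2_class q Gam, sl2_class q Beta), (sl2_class q Delt, sl2_class q Delt)#}"
| "coproduct_term q (MuL f) = {#(sl2_class q (MuL f), sl2_class q 1)#}"
| "coproduct_term q (MuR f) = {#(sl2_class q 1, sl2_class q (MuR f))#}"
| "coproduct_term q (Add s t) = coproduct_term q s + coproduct_term q t"
| "coproduct_term q (Mul s t) =
     (\<Sum>(X, Y)\<in>#coproduct_term q s.
        {#(X \<otimes>\<^bsub>FR_SL2 q\<^esub> X', Y \<otimes>\<^bsub>FR_SL2 q\<^esub> Y'). (X', Y') \<in># coproduct_term q t#})"

text \<open>
  Maps on quotients are given on representatives. They do not depend on the representatives,
  so that a union over these (as in HOL.Equiv_Relations) or a definite description
  picks out their common value. This applies to the coproduct, to the tensor product of h-spaces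
  and of representations, and to \<open>H_rep\<close> below.
\<close>

definition coproduct :: "real \<Rightarrow> fr_term set \<Rightarrow> (fr_term set \<times> fr_term set) multiset set" where
  "coproduct q X = (\<Union>x\<in>X. fsum_class (AA_pairs q) (AA_rel q) (coproduct_term q x))"


section \<open>h-spaces and dynamical representations\<close>

text \<open>An M-vector space together with its weight spaces \<open>V\<^sub>a\<close>.\<close>

record 'v hspace = "(mero, 'v) module" +
  weight_space :: "complex \<Rightarrow> 'v set"


subsection \<open>Tensor products of h-spaces and of dynamical representations\<close>

inductive hs_rel ::
    "'v hspace \<Rightarrow> 'w hspace \<Rightarrow> ('v \<times> 'w) multiset \<Rightarrow> ('v \<times> 'w) multiset \<Rightarrow> bool"
  for V :: "'v hspace" and W :: "'w hspace"
where
  zero: "w \<in> carrier W \<Longrightarrow> hs_rel V W {#(\<zero>\<^bsub>V\<^esub>, w)#} {#}"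
| add_left: "v \<in> carrier V \<Longrightarrow> v' \<in> carrier V \<Longrightarrow> w \<in> carrier W \<Longrightarrow>
    hs_rel V W {#(v \<oplus>\<^bsub>V\<^esub> v', w)#} {#(v, w), (v', w)#}"
| add_right: "v \<in> carrier V \<Longrightarrow> w \<in> carrier W \<Longrightarrow> w' \<in> carrier W \<Longrightarrow>
    hs_rel V W {#(v, w \<oplus>\<^bsub>W\<^esub> w')#} {#(v, w), (v, w')#}"
| balanced: "v \<in> carrier V \<Longrightarrow> w \<in> weight_space W b \<Longrightarrow>
    hs_rel V W {#(f \<odot>\<^bsub>V\<^esub> v, w)#} {#(v, shift (- b) f \<odot>\<^bsub>W\<^esub> w)#}"

definition hs_sum :: "'v hspace \<Rightarrow> 'w hspace \<Rightarrow> ('v \<times> 'w) multiset \<Rightarrow> ('v \<times> 'w) multiset set" where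
  "hs_sum V W = fsum_class (carrier V \<times> carrier W) (hs_rel V W)"

definition pure_tensor :: "'v hspace \<Rightarrow> 'w hspace \<Rightarrow> 'v \<Rightarrow> 'w \<Rightarrow> ('v \<times> 'w) multiset set" where
  "pure_tensor V W v w = hs_sum V W {#(v, w)#}"

definition hs_tensor :: "'v hspace \<Rightarrow> 'w hspace \<Rightarrow> ('v \<times> 'w) multiset set hspace" where
  "hs_tensor V W =
     \<lparr>carrier = hs_sum V W ` {S. set_mset S \<subseteq> carrier V \<times> carrier W},
      mult = undefined,
      one = undefined,
      zero = hs_sum V W {#},
      add = (\<lambda>Z Z'. \<Union>S\<in>Z. \<Union>S'\<in>Z'. hs_sum V W (S + S')),
      smult = (\<lambda>f Z. \<Union>S\<in>Z. hs_sum V W {#(v, f \<odot>\<^bsub>W\<^esub> w). (v, w) \<in># S#}),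
      weight_space = (\<lambda>c. hs_sum V W `
        {S. \<forall>(v, w)\<in>set_mset S. \<exists>a b. a + b = c \<and> v \<in> weight_space V a \<and> w \<in> weight_space W b})\<rparr>"

definition tensor_rep ::
    "real \<Rightarrow> 'v hspace \<Rightarrow> 'w hspace \<Rightarrow> (fr_term set \<Rightarrow> 'v \<Rightarrow> 'v) \<Rightarrow> (fr_term set \<Rightarrow> 'w \<Rightarrow> 'w)
     \<Rightarrow> fr_term set \<Rightarrow> ('v \<times> 'w) multiset set \<Rightarrow> ('v \<times> 'w) multiset set" where
  "tensor_rep q V W \<pi>\<^sub>V \<pi>\<^sub>W X Z =
     (\<Union>D\<in>coproduct q X. \<Union>S\<in>Z.
        hs_sum V W (\<Sum>(X', X'')\<in>#D. {#(\<pi>\<^sub>V X' v, \<pi>\<^sub>W X'' w). (v, w) \<in># S#}))"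


subsection \<open>The representation on \<open>\<H>\<^sup>\<omega>\<close>\<close>

text \<open>A vector is its family of coordinates: \<open>g e\<^sub>k\<close> is \<open>Poly_Mapping.single k g\<close>.\<close>

type_synonym hvec = "nat \<Rightarrow>\<^sub>0 mero"

definition basis_vec :: "nat \<Rightarrow> hvec" where
  "basis_vec k = Poly_Mapping.single k 1"

definition H_space :: "complex \<Rightarrow> hvec hspace" where
  "H_space \<omega> =
     \<lparr>carrier = UNIV,
      mult = undefined,
      one = undefined,
      zero = 0,
      add = (+),
      smult = (\<lambda>f. Poly_Mapping.map ((*) f)),
      weight_space = (\<lambda>a. {v. \<forall>k\<in>Poly_Mapping.keys v. a = \<omega> + 2 * of_nat k})\<rparr>"

text \<open>The additive operator \<open>g e\<^sub>k \<mapsto> C\<^sub>k (T\<^sub>s g) e\<^bsub>j k\<^esub>\<close>.\<close>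

definition shift_op :: "complex \<Rightarrow> (nat \<Rightarrow> nat) \<Rightarrow> (nat \<Rightarrow> mero) \<Rightarrow> hvec \<Rightarrow> hvec" where
  "shift_op s j C v =
     (\<Sum>k\<in>Poly_Mapping.keys v. Poly_Mapping.single (j k) (C k * shift s (Poly_Mapping.lookup v k)))"

definition H_A :: "real \<Rightarrow> complex \<Rightarrow> nat \<Rightarrow> mero" where
  "H_A q \<omega> k = mero_of (\<lambda>l. qpow q (- of_nat k)
     * (1 - qpow q (2 * (l - \<omega> - of_nat k + 1))) / (1 - qpow q (2 * (l - \<omega> - 2 * of_nat k + 1))))"

definition H_B :: "real \<Rightarrow> complex \<Rightarrow> nat \<Rightarrow> mero" where
  "H_B q \<omega> k = (if k = 0 then 0 else mero_of (\<lambda>l.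
     (1 - qpow q (2 * of_nat k)) * (1 - qpow q (2 * (\<omega> + of_nat k - 1)))
     / ((1 - qpow q (2 * (l + 1))) * (1 - qpow q (2 * (\<omega> + 2 * of_nat k - l - 3))))))"

definition H_D :: "real \<Rightarrow> nat \<Rightarrow> mero" where
  "H_D q k = mero_of (\<lambda>l. qpow q (of_nat k)
     * (1 - qpow q (2 * (l + 1 - of_nat k))) / (1 - qpow q (2 * (l + 1))))"

primrec H_rep_term :: "real \<Rightarrow> complex \<Rightarrow> fr_term \<Rightarrow> hvec \<Rightarrow> hvec" where
  "H_rep_term q \<omega> (Con c) = shift_op 0 id (\<lambda>_. const_mero c)"
| "H_rep_term q \<omega> Alpha = shift_op (-1) id (H_A q \<omega>)"
| "H_rep_term q \<omega> Beta = shift_op 1 (\<lambda>k. k - 1) (H_B q \<omega>)"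
| "H_rep_term q \<omega> Gam = shift_op (-1) Suc (\<lambda>_. const_mero (- of_real (1 / q)))"
| "H_rep_term q \<omega> Delt = shift_op 1 id (H_D q)"
| "H_rep_term q \<omega> (MuL f) = shift_op 0 id (\<lambda>k. shift (- \<omega> - 2 * of_nat k) f)"
| "H_rep_term q \<omega> (MuR f) = shift_op 0 id (\<lambda>_. f)"
| "H_rep_term q \<omega> (Add s t) = (\<lambda>v. H_rep_term q \<omega> s v + H_rep_term q \<omega> t v)"
| "H_rep_term q \<omega> (Mul s t) = H_rep_term q \<omega> s \<circ> H_rep_term q \<omega> t"

definition H_rep :: "real \<Rightarrow> complex \<Rightarrow> fr_term set \<Rightarrow> hvec \<Rightarrow> hvec" where
  "H_rep q \<omega> X = (THE U. \<forall>x\<in>X. H_rep_term q \<omega> x = U)"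


section \<open>The tensor product representation and its eigenvectors\<close>

definition HH_space :: "complex \<Rightarrow> complex \<Rightarrow> (hvec \<times> hvec) multiset set hspace" where
  "HH_space \<omega>1 \<omega>2 = hs_tensor (H_space \<omega>1) (H_space \<omega>2)"

definition HH_rep ::
    "real \<Rightarrow> complex \<Rightarrow> complex \<Rightarrow> fr_term set \<Rightarrow> (hvec \<times> hvec) multiset set
     \<Rightarrow> (hvec \<times> hvec) multiset set" where
  "HH_rep q \<omega>1 \<omega>2 =
     tensor_rep q (H_space \<omega>1) (H_space \<omega>2) (H_rep q \<omega>1) (H_rep q \<omega>2)"

definition is_eigenvector :: "'v hspace \<Rightarrow> ('v \<Rightarrow> 'v) \<Rightarrow> complex \<Rightarrow> 'v \<Rightarrow> bool" where
  "is_eigenvector V U c v \<longleftrightarrow>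
     v \<in> carrier V \<and> v \<noteq> \<zero>\<^bsub>V\<^esub> \<and> U v = const_mero c \<odot>\<^bsub>V\<^esub> v"

definition Xi_eigenvalue :: "real \<Rightarrow> complex \<Rightarrow> complex \<Rightarrow> nat \<Rightarrow> complex" where
  "Xi_eigenvalue q \<omega>1 \<omega>2 y =
     qpow q (\<omega>1 + \<omega>2 + 2 * of_nat y - 1) + qpow q (1 - \<omega>1 - \<omega>2 - 2 * of_nat y)"

definition v_coeff :: "real \<Rightarrow> complex \<Rightarrow> complex \<Rightarrow> nat \<Rightarrow> nat \<Rightarrow> nat \<Rightarrow> mero" where
  "v_coeff q \<omega>1 \<omega>2 p y k = mero_of (\<lambda>l.
     (-1) ^ k * qpow q (2 * of_nat k * (\<omega>1 + \<omega>2) + of_nat k * (3 * of_nat p - 1))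
     * (qpoch [qpow q (- 2 * l), qpow q (- 2 * (\<omega>1 + of_nat p - 1)), qpow q (- 2 * of_nat p)]
          (of_real (q\<^sup>2)) k
        / qpoch [of_real (q\<^sup>2), qpow q (2 * \<omega>2), qpow q (2 * (\<omega>1 + \<omega>2 + of_nat p - l - 1))]
          (of_real (q\<^sup>2)) k)
     * qracah k (of_nat p - of_nat y) (qpow q (- 2 * (l + 1))) (qpow q (2 * (\<omega>2 - 1)))
         (qpow q (- 2 * (of_nat p + 1))) (qpow q (- 2 * (\<omega>1 + \<omega>2 + of_nat p - 1))) (q\<^sup>2))"

definition v_vec ::
    "real \<Rightarrow> complex \<Rightarrow> complex \<Rightarrow> nat \<Rightarrow> nat \<Rightarrow> (hvec \<times> hvec) multiset set" where
  "v_vec q \<omega>1 \<omega>2 p y =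
     (\<Oplus>\<^bsub>HH_space \<omega>1 \<omega>2\<^esub>k\<in>{0..p}. v_coeff q \<omega>1 \<omega>2 p y k
        \<odot>\<^bsub>HH_space \<omega>1 \<omega>2\<^esub>
          pure_tensor (H_space \<omega>1) (H_space \<omega>2) (basis_vec (p - k)) (basis_vec k))"

text \<open>
  The denominators \<open>(q^(2 \<omega>2); q^2)\<^sub>k\<close> and \<open>(b d Q; Q)\<^sub>i = (q^(-2 (\<omega>1 + p - 1)); q^2)\<^sub>i\<close>,
  \<open>i \<le> k \<le> p\<close>, occurring in \<open>v_coeff\<close> do not vanish. The remaining denominators never vanish
  (as meromorphic functions of \<open>\<lambda>\<close>).
\<close>

definition formula_defined :: "real \<Rightarrow> complex \<Rightarrow> complex \<Rightarrow> nat \<Rightarrow> bool" where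
  "formula_defined q \<omega>1 \<omega>2 p \<longleftrightarrow>
     qpoch [qpow q (2 * \<omega>2), qpow q (- 2 * (\<omega>1 + of_nat p - 1))] (of_real (q\<^sup>2)) p \<noteq> 0"

end

theory Submission
  imports Defs
begin

text \<open>
  The relations of \<open>A\<close> become polynomial identities when written in terms of \<open>q F\<close> alone. Therefore the
  action of \<open>A\<close> on \<open>\<H>\<^sup>\<omega>\<^sup>1 \<otimes> \<H>\<^sup>\<omega>\<^sup>2\<close> can be computed in the coordinates with respect to
  \<open>e\<^sub>j \<otimes> e\<^sub>k\<close>, where two tensors agree iff their coordinates do. On the vectors of weight
  \<open>\<omega>\<^sub>1 + \<omega>\<^sub>2 + 2p\<close> the element \<open>\<Xi>\<close> acts as a constant minus \<open>\<phi> \<gamma>\<beta>\<close>, with \<open>\<phi>\<close> a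
  meromorphic function.

  Eigenvectors exist for all parameters: \<open>\<beta>\<close> lowers the level \<open>y\<close> to \<open>y - 1\<close>, which has one dimension
  less, so it annihilates some \<open>v \<noteq> 0\<close> of level \<open>y\<close>, an eigenvector of \<open>\<Xi>\<close>. As \<open>\<gamma>\<close> is injective
  and commutes with \<open>\<Xi>\<close>, \<open>\<gamma>\<^sup>p\<^sup>-\<^sup>yv\<close> is an eigenvector of level \<open>p\<close>.

  When the formula is defined, the coefficients of \<open>\<Xi> v(y; p)\<close> form a three-term expression in \<open>k\<close>,
  which is the recurrence relation of the q-Racah polynomials in the degree. That recurrence holds for
  the partial sums of the hypergeometric series up to a remainder, which for the sum up to \<open>p\<close> is a
  multiple of \<open>(q\<^sup>-\<^sup>2\<^sup>k; q\<^sup>2)\<^sub>p (q\<^sup>-\<^sup>2\<^sup>(\<^sup>p\<^sup>-\<^sup>y\<^sup>); q\<^sup>2)\<^sub>p\<^sub>+\<^sub>1\<close> and hence vanishes for \<open>k \<le> p\<close>.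
\<close>

section \<open>Meromorphic functions\<close>

text \<open>Three choices of representatives enter the action on a tensor: a term for the element of
  \<open>A\<close>, a formal sum for its coproduct, and a formal sum for the tensor. All three are
  shown to be harmless on coordinates, where congruences become equalities in the field M. There a
  relation of \<open>A\<close>, after \<Delta>, involves three commuting variables: \<lambda> of the
  left factor, \<mu> of the right factor, and a middle one that is both \<mu> on the left and
  \<lambda> on the right.

  The two assertions have separate proofs because for special parameters the closed formula divides
  by zero while eigenvectors persist.

  For the formula, the hypergeometric sums of all degrees are cut at the same index
  \<open>p\<close>. Terms beyond the degree vanish by themselves, and beyond \<open>p\<close> the
  denominators contain the factor 1 - q^(-2p) q^(2p) = 0. The common cut-off lets the degrees k - 1,
  k, k + 1 be compared term by term. For k = p the recurrence formally reaches degree p + 1, but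
  with the coefficient A_p = 0.\<close>

definition has_rep :: "mero \<Rightarrow> (complex \<Rightarrow> complex) \<Rightarrow> bool" where
  "has_rep f F \<longleftrightarrow> eventually (\<lambda>z. Rep_mero f z = F z) (cosparse UNIV)"

lemma eventually_cosparse_shift:
  assumes "eventually P (cosparse (UNIV :: complex set))"
  shows "eventually (\<lambda>z. P (z + a)) (cosparse UNIV)"
proof -
  have "eventually (\<lambda>x. P (x + a)) (at z)" for z
  proof -
    have "eventually P (at (z - (- a)))"
      using assms by (simp add: eventually_cosparse_open_eq)
    then have "eventually P (filtermap (\<lambda>x. x - (- a)) (at z))"
      by (simp only: filtermap_at_shift)
    then show ?thesis by (simp add: eventually_filtermap)
  qed
  then show ?thesis by (simp add: eventually_cosparse_open_eq)
qed

lemma has_rep_Rep: "has_rep f (Rep_mero f)"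
  by (simp add: has_rep_def)

lemma has_rep_mero_of: "F meromorphic_on UNIV \<Longrightarrow> has_rep (mero_of F) F"
  unfolding has_rep_def by (rule eventually_Rep_mero_of)

lemma has_rep_const: "has_rep (const_mero c) (\<lambda>_. c)"
  unfolding const_mero_def by (intro has_rep_mero_of meromorphic_intros)

lemma has_rep_shift:
  assumes "has_rep f F"
  shows "has_rep (shift a f) (\<lambda>z. F (z + a))"
proof -
  have "(\<lambda>z. Rep_mero f (z + a)) meromorphic_on UNIV"
    by (rule meromorphic_on_compose[OF Rep_mero_meromorphic[of f]])
      (auto intro!: analytic_intros)
  then have "has_rep (shift a f) (\<lambda>z. Rep_mero f (z + a))"
    unfolding shift_def by (rule has_rep_mero_of)
  moreover have "eventually (\<lambda>z. Rep_mero f (z + a) = F (z + a)) (cosparse UNIV)"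
    using eventually_cosparse_shift[OF assms[unfolded has_rep_def]] .
  ultimately show ?thesis
    unfolding has_rep_def by eventually_elim simp
qed

lemma has_rep_0: "has_rep 0 (\<lambda>_. 0)"
  and has_rep_1: "has_rep 1 (\<lambda>_. 1)"
  using eventually_Rep_mero(1,2) by (simp_all add: has_rep_def)

lemma has_rep_add:
  assumes "has_rep f F" "has_rep g G"
  shows "has_rep (f + g) (\<lambda>z. F z + G z)"
  using assms eventually_Rep_mero(3)[of f g]
  unfolding has_rep_def by eventually_elim simp

lemma has_rep_diff:
  assumes "has_rep f F" "has_rep g G"
  shows "has_rep (f - g) (\<lambda>z. F z - G z)"
  using assms eventually_Rep_mero(4)[of f g]
  unfolding has_rep_def by eventually_elim simp

lemma has_rep_uminus:
  assumes "has_rep f F"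
  shows "has_rep (- f) (\<lambda>z. - F z)"
  using assms eventually_Rep_mero(5)[of f]
  unfolding has_rep_def by eventually_elim simp

lemma has_rep_mult:
  assumes "has_rep f F" "has_rep g G"
  shows "has_rep (f * g) (\<lambda>z. F z * G z)"
  using assms eventually_Rep_mero(6)[of f g]
  unfolding has_rep_def by eventually_elim simp

lemma has_rep_inverse:
  assumes "has_rep f F"
  shows "has_rep (inverse f) (\<lambda>z. inverse (F z))"
  using assms eventually_Rep_mero(7)[of f]
  unfolding has_rep_def by eventually_elim simp

lemmas has_rep_intros = has_rep_0 has_rep_1 has_rep_const has_rep_add has_rep_diff has_rep_uminus
  has_rep_mult has_rep_inverse has_rep_shift

text \<open>Values at poles are a convention, so formulas hold pointwise only off a closed discrete
  set. This rule turns such a generic identity into an equality in the field.\<close>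

lemma has_rep_eqI:
  assumes "has_rep f F" "has_rep g G" "eventually (\<lambda>z. F z = G z) (cosparse UNIV)"
  shows "f = g"
  by (rule mero_eqI)
    (use assms[unfolded has_rep_def] in eventually_elim, simp)

lemma has_rep_eqI':
  assumes "has_rep f F" "has_rep g F"
  shows "f = g"
  using assms by (rule has_rep_eqI) simp

lemma eventually_eq_if_has_rep:
  assumes "has_rep f F" "has_rep f G"
  shows "eventually (\<lambda>z. F z = G z) (cosparse UNIV)"
  using assms[unfolded has_rep_def] by eventually_elim simp

lemma has_rep_cong:
  assumes "has_rep f F" "eventually (\<lambda>z. F z = G z) (cosparse UNIV)"
  shows "has_rep f G"
  using assms unfolding has_rep_def by eventually_elim simp

lemma shift_0_right [simp]: "shift a 0 = 0"
  by (rule has_rep_eqI'[OF has_rep_shift[OF has_rep_0] has_rep_0])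

lemma shift_1_right [simp]: "shift a 1 = 1"
  by (rule has_rep_eqI'[OF has_rep_shift[OF has_rep_1] has_rep_1])

lemma shift_const [simp]: "shift a (const_mero c) = const_mero c"
  by (rule has_rep_eqI'[OF has_rep_shift[OF has_rep_const] has_rep_const])

lemma shift_0_left [simp]: "shift 0 f = f"
  using has_rep_shift[OF has_rep_Rep, of 0 f] has_rep_Rep[of f] by (auto intro: has_rep_eqI')

lemma shift_add: "shift a (f + g) = shift a f + shift a g"
  by (rule has_rep_eqI'[OF has_rep_shift[OF has_rep_add[OF has_rep_Rep has_rep_Rep]] has_rep_add[OF has_rep_shift[OF has_rep_Rep] has_rep_shift[OF has_rep_Rep]]])

lemma shift_diff: "shift a (f - g) = shift a f - shift a g"
  by (rule has_rep_eqI'[OF has_rep_shift[OF has_rep_diff[OF has_rep_Rep has_rep_Rep]] has_rep_diff[OF has_rep_shift[OF has_rep_Rep] has_rep_shift[OF has_rep_Rep]]])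

lemma shift_mult: "shift a (f * g) = shift a f * shift a g"
  by (rule has_rep_eqI'[OF has_rep_shift[OF has_rep_mult[OF has_rep_Rep has_rep_Rep]] has_rep_mult[OF has_rep_shift[OF has_rep_Rep] has_rep_shift[OF has_rep_Rep]]])

lemma shift_inverse: "shift a (inverse f) = inverse (shift a f)"
  by (rule has_rep_eqI'[OF has_rep_shift[OF has_rep_inverse[OF has_rep_Rep]] has_rep_inverse[OF has_rep_shift[OF has_rep_Rep]]])

lemma shift_shift [simp]: "shift a (shift b f) = shift (a + b) f"
  using has_rep_shift[OF has_rep_shift[OF has_rep_Rep], of a b f] has_rep_shift[OF has_rep_Rep, of "a + b" f]
  by (auto simp: add.assoc intro: has_rep_eqI')

lemma shift_eq_0_iff [simp]: "shift a f = 0 \<longleftrightarrow> f = 0"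
proof
  assume "shift a f = 0"
  then have "shift (- a) (shift a f) = shift (- a) 0" by simp
  then show "f = 0" by (simp del: shift_0_right) simp
qed simp

lemma const_mero_0 [simp]: "const_mero 0 = 0"
  by (rule has_rep_eqI'[OF has_rep_const has_rep_0])

lemma const_mero_1 [simp]: "const_mero 1 = 1"
  by (rule has_rep_eqI'[OF has_rep_const has_rep_1])

lemma const_mero_add: "const_mero (c + d) = const_mero c + const_mero d"
  by (rule has_rep_eqI'[OF has_rep_const has_rep_add[OF has_rep_const has_rep_const]])

lemma const_mero_diff: "const_mero (c - d) = const_mero c - const_mero d"
  by (rule has_rep_eqI'[OF has_rep_const has_rep_diff[OF has_rep_const has_rep_const]])

lemma const_mero_uminus: "const_mero (- c) = - const_mero c"
  by (rule has_rep_eqI'[OF has_rep_const has_rep_uminus[OF has_rep_const]])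

lemma const_mero_mult: "const_mero (c * d) = const_mero c * const_mero d"
  by (rule has_rep_eqI'[OF has_rep_const has_rep_mult[OF has_rep_const has_rep_const]])

lemma const_mero_eq_0_iff [simp]: "const_mero c = 0 \<longleftrightarrow> c = 0"
proof
  assume "const_mero c = 0"
  then have "has_rep 0 (\<lambda>_. c)"
    using has_rep_const[of c] by simp
  from eventually_eq_if_has_rep[OF this has_rep_0] show "c = 0"
    by (simp add: eventually_const_iff)
qed simp

section \<open>Powers of q\<close>

lemma qpow_add: "qpow q (a + b) = qpow q a * qpow q b"
  by (simp add: qpow_def ring_distribs exp_add)

lemma qpow_minus: "qpow q (- a) = inverse (qpow q a)"
  by (simp add: qpow_def exp_minus)

lemma qpow_diff: "qpow q (a - b) = qpow q a / qpow q b"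
  by (simp add: qpow_def left_diff_distrib exp_diff)

lemma qpow_nonzero [simp]: "qpow q a \<noteq> 0"
  by (simp add: qpow_def)

lemma qpow_0 [simp]: "qpow q 0 = 1"
  by (simp add: qpow_def)

lemma qpow_of_nat_mult: "qpow q (of_nat n * a) = qpow q a ^ n"
  by (simp add: qpow_def exp_of_nat_mult mult.assoc)

lemma qpow_1: "0 < q \<Longrightarrow> qpow q 1 = of_real q"
  using exp_of_real[of "ln q"] by (simp add: qpow_def)

lemma qpow_of_nat: "0 < q \<Longrightarrow> qpow q (of_nat n) = of_real q ^ n"
  using qpow_of_nat_mult[of q n 1] by (simp add: qpow_1)

lemma qpow_numeral_mult: "qpow q (numeral n * a) = qpow q a ^ numeral n"
  using qpow_of_nat_mult[of q "numeral n" a] by simp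

lemma qpow_numeral: "0 < q \<Longrightarrow> qpow q (numeral n) = of_real q ^ numeral n"
  using qpow_of_nat[of q "numeral n"] by simp

lemmas qpow_simps = qpow_add qpow_diff qpow_minus qpow_numeral_mult qpow_1 qpow_numeral
  ring_distribs

text \<open>By the identity theorem, solutions accumulating at a point would make the function
  constant, but its values at \<open>0\<close> and \<open>1 / a\<close> are \<open>1\<close> and
  \<open>q\<close>.\<close>

lemma eventually_qpow_neq:
  assumes "0 < q" "q < 1" "a \<noteq> 0"
  shows "eventually (\<lambda>z. qpow q (a * z) \<noteq> c) (cosparse UNIV)"
proof (rule ccontr)
  let ?f = "\<lambda>z. qpow q (a * z)"
  assume "\<not> ?thesis"
  then obtain z0 where "\<not> eventually (\<lambda>z. ?f z \<noteq> c) (at z0)"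
    by (auto simp: eventually_cosparse_open_eq)
  then have fr: "frequently (\<lambda>z. ?f z = c) (at z0)"
    by (simp add: frequently_def)
  have "?f analytic_on UNIV"
    unfolding qpow_def by (intro analytic_intros)
  then have "?f nicely_meromorphic_on UNIV"
    by (rule analytic_on_imp_nicely_meromorphic_on)
  then have const: "?f z = c" for z
    using frequently_eq_meromorphic_imp_constant[OF fr, of UNIV z] by auto
  have "qpow q 0 = c" "qpow q (a * (1 / a)) = c"
    using const[of 0] const[of "1 / a"] by simp_all
  then have "complex_of_real q = 1"
    using assms by (simp add: qpow_1)
  then show False using assms by simp
qed

section \<open>The representation on \<open>\<H>\<^sup>\<omega>\<close>\<close>

text \<open>The coefficients of \<open>e\<^sub>k\<close> as rational functions of \<open>w = q\<^sup>2\<^sup>\<omega>\<close>, \<open>K = q\<^sup>k\<close> and \<open>X = q\<^sup>2\<^sup>\<lambda>\<close>.\<close>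

definition ratA :: "'a \<Rightarrow> 'a \<Rightarrow> 'a \<Rightarrow> 'a \<Rightarrow> 'a :: field" where
  "ratA q w K X = K * (w * K\<^sup>2 - q\<^sup>2 * X) / (w * K ^ 4 - q\<^sup>2 * X)"

definition ratB :: "'a \<Rightarrow> 'a \<Rightarrow> 'a \<Rightarrow> 'a \<Rightarrow> 'a :: field" where
  "ratB q w K X = (1 - K\<^sup>2) * (q\<^sup>2 - w * K\<^sup>2) * q ^ 4 * X / ((1 - q\<^sup>2 * X) * (q ^ 6 * X - w * K ^ 4))"

definition ratD :: "'a \<Rightarrow> 'a \<Rightarrow> 'a \<Rightarrow> 'a :: field" where
  "ratD q K X = (K\<^sup>2 - q\<^sup>2 * X) / (K * (1 - q\<^sup>2 * X))"

text \<open>The function q F(\<lambda>) with \<open>X\<close> in place of q^(2 \<lambda>).\<close>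

definition ratp :: "'a \<Rightarrow> 'a \<Rightarrow> 'a :: field" where
  "ratp q X = (1 - q ^ 4 * X) / (q * (1 - q\<^sup>2 * X))"

text \<open>Rescaling numerator and denominator stays valid when the denominator is zero, so the
  normalizations below need no genericity assumptions.\<close>

lemma frac_eqI:
  fixes c :: "'a :: field"
  assumes "m = c * m'" "n = c * n'" "c \<noteq> 0"
  shows "m / n = m' / n'"
  using assms by simp

context
  fixes q w K X :: "'a :: field"
  assumes nz: "q \<noteq> 0" "w \<noteq> 0" "K \<noteq> 0"
begin

text \<open>Translating \<lambda> by -1 or 1 divides or multiplies \<open>X\<close> by q^2, and
  passing from e_k to e_(k+1) multiplies \<open>K\<close> by q. The right-hand sides use linear
  factors without nested fractions, so that the same factors recur in all identities.\<close>

lemma ratA_shift: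
  "ratA q w K (X / q\<^sup>2) = K * (w * K\<^sup>2 - X) / (w * K ^ 4 - X)"
  "ratA q w K (q\<^sup>2 * X) = K * (w * K\<^sup>2 - q ^ 4 * X) / (w * K ^ 4 - q ^ 4 * X)"
  "ratA q w (q * K) X = q * K * (w * K\<^sup>2 - X) / (q\<^sup>2 * (w * K ^ 4) - X)"
  "ratA q w (q * K) (q\<^sup>2 * X) = K * (w * K\<^sup>2 - q\<^sup>2 * X) / (q * (w * K ^ 4 - X))"
  apply (unfold ratA_def, rule frac_eqI[where c = "1"]; use nz in \<open>simp add: field_simps eval_nat_numeral\<close>)
  apply (unfold ratA_def, rule frac_eqI[where c = "1"]; use nz in \<open>simp add: field_simps eval_nat_numeral\<close>)
  apply (unfold ratA_def, rule frac_eqI[where c = "q\<^sup>2"]; use nz in \<open>simp add: field_simps eval_nat_numeral\<close>)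
  apply (unfold ratA_def, rule frac_eqI[where c = "q ^ 3"]; use nz in \<open>simp add: field_simps eval_nat_numeral\<close>)
  done

lemma ratB_shift:
  "ratB q w K (X / q\<^sup>2) = (1 - K\<^sup>2) * (q\<^sup>2 - w * K\<^sup>2) * q\<^sup>2 * X / ((1 - X) * (q ^ 4 * X - w * K ^ 4))"
  "ratB q w K (q\<^sup>2 * X) = (1 - K\<^sup>2) * (q\<^sup>2 - w * K\<^sup>2) * q ^ 6 * X / ((1 - q ^ 4 * X) * (q ^ 8 * X - w * K ^ 4))"
  "ratB q w (q * K) X = (1 - q\<^sup>2 * K\<^sup>2) * (1 - w * K\<^sup>2) * q\<^sup>2 * X / ((1 - q\<^sup>2 * X) * (q\<^sup>2 * X - w * K ^ 4))"
  "ratB q w (q * K) (X / q\<^sup>2) = (1 - q\<^sup>2 * K\<^sup>2) * (1 - w * K\<^sup>2) * X / ((1 - X) * (X - w * K ^ 4))"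
  "ratB q w (q * K) (q\<^sup>2 * X) = (1 - q\<^sup>2 * K\<^sup>2) * (1 - w * K\<^sup>2) * q ^ 4 * X / ((1 - q ^ 4 * X) * (q ^ 4 * X - w * K ^ 4))"
  apply (unfold ratB_def, rule frac_eqI[where c = "1"]; use nz in \<open>simp add: field_simps eval_nat_numeral\<close>)
  apply (unfold ratB_def, rule frac_eqI[where c = "1"]; use nz in \<open>simp add: field_simps eval_nat_numeral\<close>)
  apply (unfold ratB_def, rule frac_eqI[where c = "q ^ 4"]; use nz in \<open>simp add: field_simps eval_nat_numeral\<close>)
  apply (unfold ratB_def, rule frac_eqI[where c = "q ^ 4"]; use nz in \<open>simp add: field_simps eval_nat_numeral\<close>)
  apply (unfold ratB_def, rule frac_eqI[where c = "q ^ 4"]; use nz in \<open>simp add: field_simps eval_nat_numeral\<close>)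
  done

lemma ratD_shift:
  "ratD q K (X / q\<^sup>2) = (K\<^sup>2 - X) / (K * (1 - X))"
  "ratD q K (q\<^sup>2 * X) = (K\<^sup>2 - q ^ 4 * X) / (K * (1 - q ^ 4 * X))"
  "ratD q (q * K) X = q * (K\<^sup>2 - X) / (K * (1 - q\<^sup>2 * X))"
  "ratD q (q * K) (q\<^sup>2 * X) = q * (K\<^sup>2 - q\<^sup>2 * X) / (K * (1 - q ^ 4 * X))"
  apply (unfold ratD_def, rule frac_eqI[where c = "1"]; use nz in \<open>simp add: field_simps eval_nat_numeral\<close>)
  apply (unfold ratD_def, rule frac_eqI[where c = "1"]; use nz in \<open>simp add: field_simps eval_nat_numeral\<close>)
  apply (unfold ratD_def, rule frac_eqI[where c = "q"]; use nz in \<open>simp add: field_simps eval_nat_numeral\<close>)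
  apply (unfold ratD_def, rule frac_eqI[where c = "q"]; use nz in \<open>simp add: field_simps eval_nat_numeral\<close>)
  done

lemma ratp_shift:
  "ratp q (X / (w * K ^ 4)) = (w * K ^ 4 - q ^ 4 * X) / (q * (w * K ^ 4 - q\<^sup>2 * X))"
  "ratp q (X / (w * (q * K) ^ 4)) = q * (w * K ^ 4 - X) / (q\<^sup>2 * (w * K ^ 4) - X)"
  apply (unfold ratp_def, rule frac_eqI[where c = "inverse (w * K ^ 4)"]; use nz in \<open>simp add: field_simps eval_nat_numeral\<close>)
  apply (unfold ratp_def, rule frac_eqI[where c = "inverse (q * (w * K ^ 4))"]; use nz in \<open>simp add: field_simps eval_nat_numeral\<close>)
  done

text \<open>These are the relations of \<open>A\<close> on e_k. The expression
  \<open>- (1 / q) * ratB q w K (X / q\<^sup>2)\<close> is the eigenvalue of \<gamma>\<beta>, so the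
  first three express \<alpha>\<delta>, \<delta>\<alpha> and \<beta>\<gamma> through
  \<gamma>\<beta>, the first being c = 1. The other four exchange two generators.\<close>

lemma
  assumes "1 - X \<noteq> 0" "1 - q\<^sup>2 * X \<noteq> 0" "1 - q ^ 4 * X \<noteq> 0"
    "w * K ^ 4 - X \<noteq> 0" "w * K ^ 4 - q\<^sup>2 * X \<noteq> 0" "w * K ^ 4 - q ^ 4 * X \<noteq> 0"
    "q\<^sup>2 * (w * K ^ 4) - X \<noteq> 0"
  shows rat_AD: "ratA q w K X * ratD q K (X / q\<^sup>2)
       = 1 + ratp q (X / (w * K ^ 4)) * (- (1 / q) * ratB q w K (X / q\<^sup>2))"
    and rat_DA: "ratD q K X * ratA q w K (q\<^sup>2 * X)
       = 1 + (q + 1 / q - ratp q X) * (- (1 / q) * ratB q w K (X / q\<^sup>2))"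
    and rat_BC: "ratB q w (q * K) X * (- (1 / q))
       = ratp q (X / (w * K ^ 4)) * (1 + (q + 1 / q - ratp q X) * (- (1 / q) * ratB q w K (X / q\<^sup>2)))
         - ratp q X"
    and rat_AB: "(q + 1 / q - ratp q X) * (ratA q w K X * ratB q w (q * K) (X / q\<^sup>2))
       = ratB q w (q * K) X * ratA q w (q * K) (q\<^sup>2 * X)"
    and rat_CD: "(q + 1 / q - ratp q X) * (- (1 / q) * ratD q K (X / q\<^sup>2))
       = ratD q (q * K) X * (- (1 / q))"
    and rat_AC: "ratA q w (q * K) X * (- (1 / q))
       = ratp q (X / (w * (q * K) ^ 4)) * (- (1 / q) * ratA q w K (X / q\<^sup>2))"
    and rat_BD: "ratB q w (q * K) X * ratD q (q * K) (q\<^sup>2 * X)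
       = ratp q (X / (w * K ^ 4)) * (ratD q K X * ratB q w (q * K) (q\<^sup>2 * X))"
proof -
  have neq: "X \<noteq> w * K ^ 4" "q\<^sup>2 * X \<noteq> w * K ^ 4" "q ^ 4 * X \<noteq> w * K ^ 4"
    using assms by auto
  note rats = ratA_shift ratB_shift ratD_shift ratp_shift
  show "ratA q w K X * ratD q K (X / q\<^sup>2)
       = 1 + ratp q (X / (w * K ^ 4)) * (- (1 / q) * ratB q w K (X / q\<^sup>2))"
    unfolding rats unfolding ratA_def ratB_def ratD_def ratp_def
    using assms neq nz by (simp add: divide_simps; simp add: algebra_simps eval_nat_numeral)
  show "ratD q K X * ratA q w K (q\<^sup>2 * X)
       = 1 + (q + 1 / q - ratp q X) * (- (1 / q) * ratB q w K (X / q\<^sup>2))"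
    unfolding rats unfolding ratA_def ratB_def ratD_def ratp_def
    using assms neq nz by (simp add: divide_simps; simp add: algebra_simps eval_nat_numeral)
  show "ratB q w (q * K) X * (- (1 / q))
       = ratp q (X / (w * K ^ 4)) * (1 + (q + 1 / q - ratp q X) * (- (1 / q) * ratB q w K (X / q\<^sup>2)))
         - ratp q X"
    unfolding rats unfolding ratA_def ratB_def ratD_def ratp_def
    using assms neq nz by (simp add: divide_simps; simp add: algebra_simps eval_nat_numeral)
  show "(q + 1 / q - ratp q X) * (ratA q w K X * ratB q w (q * K) (X / q\<^sup>2))
       = ratB q w (q * K) X * ratA q w (q * K) (q\<^sup>2 * X)"
    unfolding rats unfolding ratA_def ratB_def ratD_def ratp_def
    using assms neq nz by (simp add: divide_simps; simp add: algebra_simps eval_nat_numeral)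
  show "(q + 1 / q - ratp q X) * (- (1 / q) * ratD q K (X / q\<^sup>2))
       = ratD q (q * K) X * (- (1 / q))"
    unfolding rats unfolding ratA_def ratB_def ratD_def ratp_def
    using assms neq nz by (simp add: divide_simps; simp add: algebra_simps eval_nat_numeral)
  show "ratA q w (q * K) X * (- (1 / q))
       = ratp q (X / (w * (q * K) ^ 4)) * (- (1 / q) * ratA q w K (X / q\<^sup>2))"
    unfolding rats unfolding ratA_def ratB_def ratD_def ratp_def
    using assms neq nz by (simp add: divide_simps; simp add: algebra_simps eval_nat_numeral)
  show "ratB q w (q * K) X * ratD q (q * K) (q\<^sup>2 * X)
       = ratp q (X / (w * K ^ 4)) * (ratD q K X * ratB q w (q * K) (q\<^sup>2 * X))"
    unfolding rats unfolding ratA_def ratB_def ratD_def ratp_def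
    using assms neq nz by (simp add: divide_simps; simp add: algebra_simps eval_nat_numeral)
qed

end

locale q_param =
  fixes q :: real
  assumes q_pos: "0 < q" and q_less_1: "q < 1"
begin

abbreviation Q :: complex where "Q \<equiv> complex_of_real q"

abbreviation X :: "complex \<Rightarrow> complex" where "X z \<equiv> qpow q (2 * z)"

lemma Q_nonzero: "Q \<noteq> 0"
  using q_pos by simp

lemma X_shift: "X (z + 1) = Q\<^sup>2 * X z" "X (z + - 1) = X z / Q\<^sup>2" "X (z - 1) = X z / Q\<^sup>2"
  "X (z + (- \<omega> - 2 * of_nat k)) = X z / (X \<omega> * (Q ^ k) ^ 4)"
  using q_pos
  by (simp add: qpow_simps qpow_of_nat; simp add: field_simps eval_nat_numeral)+

lemma eventually_X_neq:
  assumes "d \<noteq> 0"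
  shows "eventually (\<lambda>z. c - d * X z \<noteq> 0) (cosparse UNIV)"
proof -
  have "eventually (\<lambda>z. X z \<noteq> c / d) (cosparse UNIV)"
    by (rule eventually_qpow_neq[OF q_pos q_less_1]) simp
  then show ?thesis
    by eventually_elim (use assms in \<open>auto simp: field_simps\<close>)
qed

lemma has_rep_H_A: "has_rep (H_A q \<omega> k) (\<lambda>z. ratA Q (X \<omega>) (Q ^ k) (X z))"
proof -
  have "has_rep (H_A q \<omega> k) (\<lambda>l. qpow q (- of_nat k)
     * (1 - qpow q (2 * (l - \<omega> - of_nat k + 1))) / (1 - qpow q (2 * (l - \<omega> - 2 * of_nat k + 1))))"
    unfolding H_A_def qpow_def
    by (intro has_rep_mero_of meromorphic_intros analytic_on_imp_meromorphic_on analytic_intros)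
  moreover have "qpow q (- of_nat k)
     * (1 - qpow q (2 * (l - \<omega> - of_nat k + 1))) / (1 - qpow q (2 * (l - \<omega> - 2 * of_nat k + 1)))
     = ratA Q (X \<omega>) (Q ^ k) (X l)" for l
    unfolding ratA_def
    by (rule frac_eqI[where c = "inverse (X \<omega> * (Q ^ k) ^ 4)"])
      (use q_pos in \<open>(simp add: qpow_simps qpow_of_nat; simp add: field_simps eval_nat_numeral)+\<close>)
  ultimately show ?thesis by simp
qed

lemma has_rep_H_B: "has_rep (H_B q \<omega> k) (\<lambda>z. ratB Q (X \<omega>) (Q ^ k) (X z))"
proof (cases "k = 0")
  case True
  then show ?thesis by (simp add: H_B_def ratB_def has_rep_0)
next
  case False
  have "has_rep (H_B q \<omega> k) (\<lambda>l. (1 - qpow q (2 * of_nat k)) * (1 - qpow q (2 * (\<omega> + of_nat k - 1)))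
     / ((1 - qpow q (2 * (l + 1))) * (1 - qpow q (2 * (\<omega> + 2 * of_nat k - l - 3)))))"
    unfolding H_B_def qpow_def if_not_P[OF False]
    by (intro has_rep_mero_of meromorphic_intros analytic_on_imp_meromorphic_on analytic_intros)
  moreover have "(1 - qpow q (2 * of_nat k)) * (1 - qpow q (2 * (\<omega> + of_nat k - 1)))
     / ((1 - qpow q (2 * (l + 1))) * (1 - qpow q (2 * (\<omega> + 2 * of_nat k - l - 3))))
     = ratB Q (X \<omega>) (Q ^ k) (X l)" for l
    unfolding ratB_def
    \<comment> \<open>With w = q^(2 \<omega>) the second denominator factor is 1 - w K^4 / (Q^6 X),
      which dictates the scaling.\<close>
    by (rule frac_eqI[where c = "inverse (Q ^ 6 * X l)"])
      (use q_pos in \<open>(simp add: qpow_simps qpow_of_nat; simp add: field_simps eval_nat_numeral)+\<close>)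
  ultimately show ?thesis by simp
qed

lemma has_rep_H_D: "has_rep (H_D q k) (\<lambda>z. ratD Q (Q ^ k) (X z))"
proof -
  have "has_rep (H_D q k) (\<lambda>l. qpow q (of_nat k)
     * (1 - qpow q (2 * (l + 1 - of_nat k))) / (1 - qpow q (2 * (l + 1))))"
    unfolding H_D_def qpow_def
    by (intro has_rep_mero_of meromorphic_intros analytic_on_imp_meromorphic_on analytic_intros)
  moreover have "qpow q (of_nat k)
     * (1 - qpow q (2 * (l + 1 - of_nat k))) / (1 - qpow q (2 * (l + 1)))
     = ratD Q (Q ^ k) (X l)" for l
    unfolding ratD_def
    by (rule frac_eqI[where c = "inverse (Q ^ k)"])
      (use q_pos in \<open>(simp add: qpow_simps qpow_of_nat; simp add: field_simps eval_nat_numeral)+\<close>)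
  ultimately show ?thesis by simp
qed

text \<open>In terms of \<open>pF = q F\<close> and \<open>nF = q + 1/q - pF\<close> the structure functions become polynomial:
  \<open>q F(\<mu> - 1) = 1 / nF(\<mu>)\<close>, \<open>G = pF nF\<close>, \<open>H(\<lambda>, \<mu>) = pF(\<lambda>) - nF(\<mu>)\<close> and
  \<open>I(\<lambda>, \<mu>) = pF(\<lambda>) - pF(\<mu>)\<close>.\<close>

definition pF :: mero where "pF = const_mero Q * fr_F q"

definition nF :: mero where "nF = const_mero (Q + 1 / Q) - pF"

text \<open>The coefficient of \<gamma> on every e_k.\<close>

definition C0 :: mero where "C0 = const_mero (- (1 / Q))"

lemma has_rep_fr_F: "has_rep (fr_F q) (\<lambda>z. ratp Q (X z) / Q)"
proof -
  have "has_rep (fr_F q) (\<lambda>l. (qpow q (2 * (l + 1)) - qpow q (-2)) / (qpow q (2 * (l + 1)) - 1))"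
    unfolding fr_F_def qpow_def
    by (intro has_rep_mero_of meromorphic_intros analytic_on_imp_meromorphic_on analytic_intros)
  moreover have "(qpow q (2 * (l + 1)) - qpow q (-2)) / (qpow q (2 * (l + 1)) - 1) = ratp Q (X l) / Q" for l
    unfolding ratp_def divide_divide_eq_left
    by (rule frac_eqI[where c = "- inverse (Q\<^sup>2)"])
      (use q_pos in \<open>(simp add: qpow_simps qpow_of_nat; simp add: field_simps eval_nat_numeral)+\<close>)
  ultimately show ?thesis by simp
qed

lemma has_rep_pF: "has_rep pF (\<lambda>z. ratp Q (X z))"
  using has_rep_mult[OF has_rep_const[of Q] has_rep_fr_F] Q_nonzero by (simp add: pF_def)

lemma has_rep_nF: "has_rep nF (\<lambda>z. Q + 1 / Q - ratp Q (X z))"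
  unfolding nF_def by (intro has_rep_diff has_rep_const has_rep_pF)

lemma has_rep_C0: "has_rep C0 (\<lambda>z. - (1 / Q))"
  using has_rep_const[of "- (1 / Q)"] by (simp add: C0_def)

lemma has_rep_fr_u: "has_rep (fr_u q) (\<lambda>z. Q\<^sup>2 * X z)"
proof -
  have "has_rep (fr_u q) (\<lambda>l. qpow q (2 * (l + 1)))"
    unfolding fr_u_def qpow_def
    by (intro has_rep_mero_of meromorphic_intros analytic_on_imp_meromorphic_on analytic_intros)
  then show ?thesis by (simp only: X_shift)
qed

lemma has_rep_fr_r: "has_rep (fr_r q) (\<lambda>z. 1 / (Q\<^sup>2 * X z - 1))"
proof -
  have "has_rep (fr_r q) (\<lambda>l. 1 / (qpow q (2 * (l + 1)) - 1))"
    unfolding fr_r_def qpow_def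
    by (intro has_rep_mero_of meromorphic_intros analytic_on_imp_meromorphic_on analytic_intros)
  then show ?thesis by (simp only: X_shift)
qed

lemma has_rep_fr_G: "has_rep (fr_G q) (\<lambda>z. (Q\<^sup>2 * X z - Q\<^sup>2) * (Q\<^sup>2 * X z - 1 / Q\<^sup>2) / (Q\<^sup>2 * X z - 1)\<^sup>2)"
proof -
  have "has_rep (fr_G q) (\<lambda>l. (qpow q (2 * (l + 1)) - qpow q 2) * (qpow q (2 * (l + 1)) - qpow q (-2))
                        / (qpow q (2 * (l + 1)) - 1)\<^sup>2)"
    unfolding fr_G_def qpow_def
    by (intro has_rep_mero_of meromorphic_intros analytic_on_imp_meromorphic_on analytic_intros)
  then show ?thesis using q_pos by (simp only: X_shift qpow_minus qpow_numeral inverse_eq_divide)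
qed

lemma fr_G_eq: "fr_G q = pF * nF"
  apply (rule has_rep_eqI[OF has_rep_fr_G has_rep_mult[OF has_rep_pF has_rep_nF]])
  using eventually_X_neq[of "Q\<^sup>2" 1] Q_nonzero apply simp
  apply (erule eventually_mono)
  apply (simp add: ratp_def divide_simps; simp add: algebra_simps eval_nat_numeral)
  done

lemma fr_r_eq: "const_mero (Q - 1 / Q) * fr_r q = pF - const_mero Q"
  apply (rule has_rep_eqI[OF has_rep_mult[OF has_rep_const has_rep_fr_r] has_rep_diff[OF has_rep_pF has_rep_const]])
  using eventually_X_neq[of "Q\<^sup>2" 1] Q_nonzero apply simp
  apply (erule eventually_mono)
  apply (simp add: ratp_def divide_simps; simp add: algebra_simps eval_nat_numeral)
  done

lemma fr_u_fr_r: "fr_u q * fr_r q = 1 + fr_r q"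
  apply (rule has_rep_eqI[OF has_rep_mult[OF has_rep_fr_u has_rep_fr_r] has_rep_add[OF has_rep_1 has_rep_fr_r]])
  using eventually_X_neq[of "Q\<^sup>2" 1] Q_nonzero apply simp
  apply (erule eventually_mono)
  apply (simp add: divide_simps; simp add: algebra_simps eval_nat_numeral)
  done

lemma shift_fr_F: "const_mero Q * shift (- 1) (fr_F q) * nF = 1"
proof (rule has_rep_eqI[OF has_rep_mult[OF has_rep_mult[OF has_rep_const has_rep_shift[OF has_rep_fr_F]] has_rep_nF] has_rep_1])
  have "eventually (\<lambda>z. 1 - Q\<^sup>2 * X z \<noteq> 0) (cosparse UNIV)" "eventually (\<lambda>z. 1 - 1 * X z \<noteq> 0) (cosparse UNIV)"
    using Q_nonzero by (intro eventually_X_neq; simp)+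
  then show "\<forall>\<^sub>\<approx>z. Q * (ratp Q (X (z + - 1)) / Q) * (Q + 1 / Q - ratp Q (X z)) = 1"
  proof eventually_elim
    case (elim z)
    with Q_nonzero show ?case
      unfolding X_shift
      by (simp add: ratp_def divide_simps; simp add: algebra_simps eval_nat_numeral)
  qed
qed

lemma nF_nonzero: "nF \<noteq> 0"
  using shift_fr_F by auto

lemma shift_fr_F_eq: "const_mero Q * shift (- 1) (fr_F q) = inverse nF"
  using shift_fr_F nF_nonzero by (simp add: field_simps)

lemma eventually_rat_identities:
  "eventually (\<lambda>z. 1 - X z \<noteq> 0 \<and> 1 - Q\<^sup>2 * X z \<noteq> 0 \<and> 1 - Q ^ 4 * X z \<noteq> 0
    \<and> X \<omega> * (Q ^ k) ^ 4 - X z \<noteq> 0 \<and> X \<omega> * (Q ^ k) ^ 4 - Q\<^sup>2 * X z \<noteq> 0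
    \<and> X \<omega> * (Q ^ k) ^ 4 - Q ^ 4 * X z \<noteq> 0 \<and> Q\<^sup>2 * (X \<omega> * (Q ^ k) ^ 4) - X z \<noteq> 0) (cosparse UNIV)"
  using eventually_X_neq[of 1 1] eventually_X_neq[of "Q\<^sup>2" 1] eventually_X_neq[of "Q ^ 4" 1]
    eventually_X_neq[of 1 "X \<omega> * (Q ^ k) ^ 4"] eventually_X_neq[of "Q\<^sup>2" "X \<omega> * (Q ^ k) ^ 4"]
    eventually_X_neq[of "Q ^ 4" "X \<omega> * (Q ^ k) ^ 4"] eventually_X_neq[of 1 "Q\<^sup>2 * (X \<omega> * (Q ^ k) ^ 4)"]
    Q_nonzero
  by (simp add: eventually_conj_iff del: right_minus_eq)

text \<open>The eigenvalue of \<gamma>\<beta> on e_k. The translation T_1 in \<beta> is undone by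
  T_(-1) in \<gamma>, so \<gamma>\<beta> is M-linear and diagonal.\<close>

definition gamma_beta :: "complex \<Rightarrow> nat \<Rightarrow> mero" where
  "gamma_beta \<omega> k = C0 * shift (- 1) (H_B q \<omega> k)"

abbreviation pL :: "complex \<Rightarrow> nat \<Rightarrow> mero" where
  "pL \<omega> k \<equiv> shift (- \<omega> - 2 * of_nat k) pF"

lemma
  shows H_AD: "H_A q \<omega> k * shift (- 1) (H_D q k) = 1 + pL \<omega> k * gamma_beta \<omega> k"
    and H_DA: "H_D q k * shift 1 (H_A q \<omega> k) = 1 + nF * gamma_beta \<omega> k"
    and H_BC: "H_B q \<omega> (Suc k) * C0 = pL \<omega> k * (1 + nF * gamma_beta \<omega> k) - pF"
    and H_AB: "nF * (H_A q \<omega> k * shift (- 1) (H_B q \<omega> (Suc k)))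
                 = H_B q \<omega> (Suc k) * shift 1 (H_A q \<omega> (Suc k))"
    and H_CD: "nF * (C0 * shift (- 1) (H_D q k)) = H_D q (Suc k) * C0"
    and H_AC: "H_A q \<omega> (Suc k) * C0 = pL \<omega> (Suc k) * (C0 * shift (- 1) (H_A q \<omega> k))"
    and H_BD: "H_B q \<omega> (Suc k) * shift 1 (H_D q (Suc k))
                 = pL \<omega> k * (H_D q k * shift 1 (H_B q \<omega> (Suc k)))"
proof -
  note reps = has_rep_intros has_rep_H_A has_rep_H_B has_rep_H_D has_rep_pF has_rep_nF has_rep_C0
  show "H_A q \<omega> k * shift (- 1) (H_D q k) = 1 + pL \<omega> k * gamma_beta \<omega> k"
    unfolding gamma_beta_def
    by (rule has_rep_eqI, ((rule reps)+)[1], ((rule reps)+)[1],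
        rule eventually_mono[OF eventually_rat_identities[of \<omega> k]], unfold X_shift power_Suc,
        rule rat_AD[where w = "X \<omega>" and K = "Q ^ k"]; use q_pos in simp)
  show "H_D q k * shift 1 (H_A q \<omega> k) = 1 + nF * gamma_beta \<omega> k"
    unfolding gamma_beta_def
    by (rule has_rep_eqI, ((rule reps)+)[1], ((rule reps)+)[1],
        rule eventually_mono[OF eventually_rat_identities[of \<omega> k]], unfold X_shift power_Suc,
        rule rat_DA[where w = "X \<omega>" and K = "Q ^ k"]; use q_pos in simp)
  show "H_B q \<omega> (Suc k) * C0 = pL \<omega> k * (1 + nF * gamma_beta \<omega> k) - pF"
    unfolding gamma_beta_def
    by (rule has_rep_eqI, ((rule reps)+)[1], ((rule reps)+)[1],
        rule eventually_mono[OF eventually_rat_identities[of \<omega> k]], unfold X_shift power_Suc,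
        rule rat_BC[where w = "X \<omega>" and K = "Q ^ k"]; use q_pos in simp)
  show "nF * (H_A q \<omega> k * shift (- 1) (H_B q \<omega> (Suc k)))
                 = H_B q \<omega> (Suc k) * shift 1 (H_A q \<omega> (Suc k))"
    unfolding gamma_beta_def
    by (rule has_rep_eqI, ((rule reps)+)[1], ((rule reps)+)[1],
        rule eventually_mono[OF eventually_rat_identities[of \<omega> k]], unfold X_shift power_Suc,
        rule rat_AB[where w = "X \<omega>" and K = "Q ^ k"]; use q_pos in simp)
  show "nF * (C0 * shift (- 1) (H_D q k)) = H_D q (Suc k) * C0"
    unfolding gamma_beta_def
    by (rule has_rep_eqI, ((rule reps)+)[1], ((rule reps)+)[1],
        rule eventually_mono[OF eventually_rat_identities[of \<omega> k]], unfold X_shift power_Suc,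
        rule rat_CD[where w = "X \<omega>" and K = "Q ^ k"]; use q_pos in simp)
  show "H_A q \<omega> (Suc k) * C0 = pL \<omega> (Suc k) * (C0 * shift (- 1) (H_A q \<omega> k))"
    unfolding gamma_beta_def
    by (rule has_rep_eqI, ((rule reps)+)[1], ((rule reps)+)[1],
        rule eventually_mono[OF eventually_rat_identities[of \<omega> k]], unfold X_shift power_Suc,
        rule rat_AC[where w = "X \<omega>" and K = "Q ^ k"]; use q_pos in simp)
  show "H_B q \<omega> (Suc k) * shift 1 (H_D q (Suc k))
                 = pL \<omega> k * (H_D q k * shift 1 (H_B q \<omega> (Suc k)))"
    unfolding gamma_beta_def
    by (rule has_rep_eqI, ((rule reps)+)[1], ((rule reps)+)[1],
        rule eventually_mono[OF eventually_rat_identities[of \<omega> k]], unfold X_shift power_Suc,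
        rule rat_BD[where w = "X \<omega>" and K = "Q ^ k"]; use q_pos in simp)
qed

section \<open>The generators in coordinates on one factor\<close>

lemma shift_op_superset:
  assumes "finite S" "Poly_Mapping.keys v \<subseteq> S"
  shows "shift_op s j C v = (\<Sum>k\<in>S. Poly_Mapping.single (j k) (C k * shift s (Poly_Mapping.lookup v k)))"
  unfolding shift_op_def
  by (rule sum.mono_neutral_left[OF assms]) (auto simp: in_keys_iff)

text \<open>\<open>fr_H\<close> and \<open>fr_I\<close> act on a simultaneous eigenvector of \<open>\<mu>\<^sub>l\<close> and \<open>\<mu>\<^sub>r\<close> by these scalars.\<close>

lemma fr_H_scalar:
  "const_mero (Q - 1 / Q) * ((shift a (fr_u q) * fr_u q - 1) * (shift a (fr_r q) * fr_r q)) = shift a pF - nF"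
proof -
  have r: "const_mero (Q - 1 / Q) * shift a (fr_r q) = shift a pF - const_mero Q" for a
    using arg_cong[OF fr_r_eq, of "shift a"] by (simp add: shift_mult shift_diff)
  have u: "shift a (fr_u q) * shift a (fr_r q) = 1 + shift a (fr_r q)"
    using arg_cong[OF fr_u_fr_r, of "shift a"] by (simp add: shift_mult shift_add)
  have "(shift a (fr_u q) * fr_u q - 1) * (shift a (fr_r q) * fr_r q)
      = (shift a (fr_u q) * shift a (fr_r q)) * (fr_u q * fr_r q) - shift a (fr_r q) * fr_r q"
    by (simp add: algebra_simps)
  also have "\<dots> = 1 + shift a (fr_r q) + fr_r q"
    unfolding u fr_u_fr_r by (simp add: algebra_simps)
  finally have "const_mero (Q - 1 / Q) * ((shift a (fr_u q) * fr_u q - 1) * (shift a (fr_r q) * fr_r q))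
      = const_mero (Q - 1 / Q) + const_mero (Q - 1 / Q) * shift a (fr_r q) + const_mero (Q - 1 / Q) * fr_r q"
    by (simp add: ring_distribs)
  then show ?thesis
    unfolding r[of a] r[of 0, unfolded shift_0_left]
    by (simp add: nF_def const_mero_add const_mero_diff)
qed

lemma fr_I_scalar:
  "const_mero (Q - 1 / Q) * ((fr_u q - shift a (fr_u q)) * (shift a (fr_r q) * fr_r q)) = shift a pF - pF"
proof -
  have r: "const_mero (Q - 1 / Q) * shift a (fr_r q) = shift a pF - const_mero Q" for a
    using arg_cong[OF fr_r_eq, of "shift a"] by (simp add: shift_mult shift_diff)
  have u: "shift a (fr_u q) * shift a (fr_r q) = 1 + shift a (fr_r q)"
    using arg_cong[OF fr_u_fr_r, of "shift a"] by (simp add: shift_mult shift_add)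
  have "(fr_u q - shift a (fr_u q)) * (shift a (fr_r q) * fr_r q)
      = (fr_u q * fr_r q) * shift a (fr_r q) - (shift a (fr_u q) * shift a (fr_r q)) * fr_r q"
    by (simp add: algebra_simps)
  also have "\<dots> = shift a (fr_r q) - fr_r q"
    unfolding u fr_u_fr_r by (simp add: algebra_simps)
  finally show ?thesis
    using r[of a] r[of 0] by (simp add: right_diff_distrib)
qed

lemma fr_term_simps:
  "s + t = Add s t" "s * t = Mul s t" "- t = Mul (Con (- 1)) t" "s - t = Add s (Mul (Con (- 1)) t)"
  "(1 :: fr_term) = Con 1" "(0 :: fr_term) = Con 0" for s t :: fr_term
  by (simp_all add: plus_fr_term_def times_fr_term_def uminus_fr_term_def minus_fr_term_def
      one_fr_term_def zero_fr_term_def)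

lemma const_times_shift_fr_F: "const_mero Q * shift a (fr_F q) = shift a pF"
  by (simp add: pF_def shift_mult)

lemma H_B_0: "H_B q \<omega> 0 = 0"
  by (simp add: H_B_def)

lemma gamma_beta_0: "gamma_beta \<omega> 0 = 0"
  by (simp add: gamma_beta_def H_B_0)

lemma shift_C0 [simp]: "shift a C0 = C0"
  by (simp add: C0_def)

lemma H_AB': "H_A q \<omega> k * shift (- 1) (H_B q \<omega> (Suc k))
    = inverse nF * H_B q \<omega> (Suc k) * shift 1 (H_A q \<omega> (Suc k))"
  using H_AB[of \<omega> k] nF_nonzero by (simp add: field_simps)

lemma H_CD': "C0 * shift (- 1) (H_D q k) = inverse nF * H_D q (Suc k) * C0"
  using H_CD[of k] nF_nonzero by (simp add: field_simps)

lemma lookup_shift_op_id: "Poly_Mapping.lookup (shift_op s id C v) j = C j * shift s (Poly_Mapping.lookup v j)"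
proof -
  have "Poly_Mapping.lookup (shift_op s id C v) j
      = (\<Sum>k\<in>insert j (Poly_Mapping.keys v). (if k = j then C k * shift s (Poly_Mapping.lookup v k) else 0))"
    by (subst shift_op_superset[of "insert j (Poly_Mapping.keys v)"])
      (auto simp: lookup_sum lookup_single when_def intro!: sum.cong)
  then show ?thesis by simp
qed

lemma lookup_Alpha: "Poly_Mapping.lookup (H_rep_term q \<omega> Alpha v) j = H_A q \<omega> j * shift (- 1) (Poly_Mapping.lookup v j)"
  and lookup_Delt: "Poly_Mapping.lookup (H_rep_term q \<omega> Delt v) j = H_D q j * shift 1 (Poly_Mapping.lookup v j)"
  and lookup_Con: "Poly_Mapping.lookup (H_rep_term q \<omega> (Con c) v) j = const_mero c * Poly_Mapping.lookup v j"
  and lookup_MuR: "Poly_Mapping.lookup (H_rep_term q \<omega> (MuR f) v) j = f * Poly_Mapping.lookup v j"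
  and lookup_MuL: "Poly_Mapping.lookup (H_rep_term q \<omega> (MuL f) v) j
    = shift (- \<omega> - 2 * of_nat j) f * Poly_Mapping.lookup v j"
  by (simp_all add: lookup_shift_op_id)

lemma lookup_Beta: "Poly_Mapping.lookup (H_rep_term q \<omega> Beta v) j
    = H_B q \<omega> (Suc j) * shift 1 (Poly_Mapping.lookup v (Suc j))"
proof -
  have "Poly_Mapping.lookup (H_rep_term q \<omega> Beta v) j
      = (\<Sum>k\<in>insert (Suc j) (Poly_Mapping.keys v).
          (if k = Suc j then H_B q \<omega> k * shift 1 (Poly_Mapping.lookup v k) else 0))"
  proof -
    \<comment> \<open>Truncated subtraction sends both indices 0 and 1 to 0; the spurious term k = 0
      carries the coefficient \<open>H_B q \<omega> 0 = 0\<close>.\<close>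
    have "(H_B q \<omega> k * shift 1 (Poly_Mapping.lookup v k) when k - 1 = j)
        = (if k = Suc j then H_B q \<omega> k * shift 1 (Poly_Mapping.lookup v k) else 0)" for k
      by (cases k) (auto simp: H_B_0)
    then show ?thesis
      unfolding H_rep_term.simps
      by (subst shift_op_superset[of "insert (Suc j) (Poly_Mapping.keys v)"])
        (simp_all only: lookup_sum lookup_single, auto)
  qed
  then show ?thesis by simp
qed

lemma lookup_Gam: "Poly_Mapping.lookup (H_rep_term q \<omega> Gam v) j
    = (case j of 0 \<Rightarrow> 0 | Suc i \<Rightarrow> C0 * shift (- 1) (Poly_Mapping.lookup v i))"
proof (cases j)
  case 0
  then show ?thesis
    unfolding H_rep_term.simps shift_op_def by (simp add: lookup_sum lookup_single)
next
  case (Suc i)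
  have "Poly_Mapping.lookup (H_rep_term q \<omega> Gam v) (Suc i)
      = (\<Sum>k\<in>insert i (Poly_Mapping.keys v). (if k = i then C0 * shift (- 1) (Poly_Mapping.lookup v k) else 0))"
    unfolding H_rep_term.simps
    by (subst shift_op_superset[of "insert i (Poly_Mapping.keys v)"])
      (auto simp: lookup_sum lookup_single when_def C0_def intro!: sum.cong)
  then show ?thesis by (simp add: Suc)
qed

declare H_rep_term.simps(1-7) [simp del]

lemmas lookup_H_rep = lookup_Alpha lookup_Beta lookup_Gam lookup_Delt lookup_Con lookup_MuL lookup_MuR

context
  fixes \<omega> :: complex
begin

abbreviation "opA \<equiv> H_rep_term q \<omega> Alpha"
abbreviation "opB \<equiv> H_rep_term q \<omega> Beta"
abbreviation "opC \<equiv> H_rep_term q \<omega> Gam"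
abbreviation "opD \<equiv> H_rep_term q \<omega> Delt"

lemma lookup_CB: "Poly_Mapping.lookup (opC (opB v)) j = gamma_beta \<omega> j * Poly_Mapping.lookup v j"
  by (cases j) (simp_all add: lookup_H_rep gamma_beta_0 shift_mult, simp add: gamma_beta_def mult_ac)

lemma lookup_AD: "Poly_Mapping.lookup (opA (opD v)) j
    = Poly_Mapping.lookup v j + pL \<omega> j * Poly_Mapping.lookup (opC (opB v)) j"
  unfolding lookup_CB using arg_cong[OF H_AD[of \<omega> j], of "\<lambda>x. x * Poly_Mapping.lookup v j"]
  by (simp add: lookup_H_rep shift_mult ring_distribs mult.assoc del: mult_cancel_right)

lemma lookup_DA: "Poly_Mapping.lookup (opD (opA v)) j
    = Poly_Mapping.lookup v j + nF * Poly_Mapping.lookup (opC (opB v)) j"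
  unfolding lookup_CB using arg_cong[OF H_DA[of j \<omega>], of "\<lambda>x. x * Poly_Mapping.lookup v j"]
  by (simp add: lookup_H_rep shift_mult ring_distribs mult.assoc del: mult_cancel_right)

lemma lookup_BC: "Poly_Mapping.lookup (opB (opC v)) j
    = (pL \<omega> j - pF) * Poly_Mapping.lookup v j + pL \<omega> j * nF * Poly_Mapping.lookup (opC (opB v)) j"
  unfolding lookup_CB using arg_cong[OF H_BC[of \<omega> j], of "\<lambda>x. x * Poly_Mapping.lookup v j"]
  by (simp add: lookup_H_rep shift_mult ring_distribs mult.assoc del: mult_cancel_right)

lemma lookup_AB: "Poly_Mapping.lookup (opA (opB v)) j = inverse nF * Poly_Mapping.lookup (opB (opA v)) j"
  by (simp add: lookup_H_rep shift_mult, simp only: mult.assoc[symmetric] H_AB' simp_thms)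

lemma lookup_BD: "Poly_Mapping.lookup (opB (opD v)) j = pL \<omega> j * Poly_Mapping.lookup (opD (opB v)) j"
  by (simp add: lookup_H_rep shift_mult, simp only: mult.assoc[symmetric] H_BD simp_thms)

lemma lookup_CD: "Poly_Mapping.lookup (opC (opD v)) j = inverse nF * Poly_Mapping.lookup (opD (opC v)) j"
proof (cases j)
  case (Suc n)
  show ?thesis unfolding Suc
    using arg_cong[OF H_CD'[of n], of "\<lambda>x. x * Poly_Mapping.lookup v n"]
    by (simp add: lookup_H_rep shift_mult mult.assoc del: mult_cancel_right mult_cancel_left)
qed (simp add: lookup_H_rep)

lemma lookup_AC: "Poly_Mapping.lookup (opA (opC v)) j = pL \<omega> j * Poly_Mapping.lookup (opC (opA v)) j"
proof (cases j)
  case (Suc n)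
  show ?thesis unfolding Suc
    using arg_cong[OF H_AC[of \<omega> n], of "\<lambda>x. x * shift (- 2) (Poly_Mapping.lookup v n)"]
    by (simp add: lookup_H_rep shift_mult mult.assoc del: mult_cancel_right mult_cancel_left of_nat_Suc)
qed (simp add: lookup_H_rep)

end

lemmas lookup_quadratic = lookup_AB lookup_AC lookup_BD lookup_CD lookup_AD lookup_DA lookup_BC

lemma const_minus_1: "const_mero (- 1) = - 1"
  by (simp add: const_mero_uminus)

lemma lookup_fr_H: "Poly_Mapping.lookup (H_rep_term q \<omega> (fr_H q) v) j
    = (pL \<omega> j - nF) * Poly_Mapping.lookup v j"
  unfolding fr_H_scalar[symmetric] fr_H_def
  by (simp add: fr_term_simps lookup_add lookup_H_rep const_minus_1 algebra_simps)

lemma lookup_fr_I: "Poly_Mapping.lookup (H_rep_term q \<omega> (fr_I q) v) j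
    = (pL \<omega> j - pF) * Poly_Mapping.lookup v j"
  unfolding fr_I_scalar[symmetric] fr_I_def
  by (simp add: fr_term_simps lookup_add lookup_H_rep const_minus_1 algebra_simps)

lemma const_F_shift: "const_mero Q * (shift (- 1) (fr_F q) * g) = inverse nF * g"
  "const_mero Q * (shift a (fr_F q) * g) = shift a pF * g"
  using shift_fr_F_eq const_times_shift_fr_F[of a] by (metis mult.assoc)+

text \<open>Since \<alpha>\<delta>, \<delta>\<alpha> and \<beta>\<gamma> are affine in
  \<gamma>\<beta>, the four mixed relations reduce to polynomial identities in \<open>pL\<close>,
  \<open>pF\<close> and \<open>nF\<close>.\<close>

lemma H_rep_m2_rel:
  assumes "m2_rel q s t"
  shows "H_rep_term q \<omega> s = H_rep_term q \<omega> t"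
proof (rule ext, rule poly_mapping_eqI)
  fix v j
  show "Poly_Mapping.lookup (H_rep_term q \<omega> s v) j = Poly_Mapping.lookup (H_rep_term q \<omega> t v) j"
    using assms
  proof cases
    case (alpha_beta)
    then show ?thesis
      by (simp add: fr_term_simps lookup_AB) (simp add: lookup_Con lookup_MuR const_F_shift(1))
  next
    case alpha_gamma
    then show ?thesis
      by (simp add: fr_term_simps lookup_AC) (simp add: lookup_Con lookup_MuL const_F_shift(2))
  next
    case beta_delta
    then show ?thesis
      by (simp add: fr_term_simps lookup_BD) (simp add: lookup_Con lookup_MuL const_F_shift(2))
  next
    case gamma_delta
    then show ?thesis
      by (simp add: fr_term_simps lookup_CD) (simp add: lookup_Con lookup_MuR const_F_shift(1))
  next
    case alpha_delta
    then show ?thesis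
      by (simp add: fr_term_simps lookup_add lookup_AD lookup_DA lookup_Con lookup_fr_H const_minus_1 algebra_simps)
  next
    case alpha_delta'
    then show ?thesis
      by (simp add: fr_term_simps lookup_add lookup_AD lookup_DA lookup_BC lookup_Con lookup_MuL lookup_MuR lookup_fr_H
          fr_G_eq shift_mult const_minus_1, simp add: nF_def shift_diff algebra_simps)
  next
    case beta_gamma
    then show ?thesis
      by (simp add: fr_term_simps lookup_add lookup_AD lookup_DA lookup_BC lookup_Con lookup_MuL lookup_MuR lookup_fr_I
          fr_G_eq shift_mult const_minus_1, simp add: nF_def shift_diff algebra_simps)
  next
    case beta_gamma'
    then show ?thesis
      by (simp add: fr_term_simps lookup_add lookup_AD lookup_DA lookup_BC lookup_Con lookup_MuL lookup_MuR lookup_fr_I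
          fr_G_eq shift_mult const_minus_1, simp add: nF_def shift_diff algebra_simps)
  qed (cases j; simp add: fr_term_simps lookup_add lookup_H_rep shift_add shift_mult ring_distribs mult_ac diff_diff_eq add_ac)+
qed

lemma H_rep_fr_c: "H_rep_term q \<omega> (fr_c q) = H_rep_term q \<omega> 1"
proof (rule ext, rule poly_mapping_eqI)
  fix v j
  show "Poly_Mapping.lookup (H_rep_term q \<omega> (fr_c q) v) j = Poly_Mapping.lookup (H_rep_term q \<omega> 1 v) j"
    by (simp add: fr_c_def fr_term_simps lookup_add lookup_AD lookup_Con lookup_MuL const_minus_1 const_F_shift(2))
qed

lemma H_rep_Con_commute:
  "H_rep_term q \<omega> x (H_rep_term q \<omega> (Con c) v) = H_rep_term q \<omega> (Con c) (H_rep_term q \<omega> x v)"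
proof (induction x arbitrary: v)
  case (Add s t)
  then show ?case by (intro poly_mapping_eqI) (simp add: lookup_add lookup_Con ring_distribs)
qed (intro poly_mapping_eqI; simp add: lookup_H_rep shift_mult mult_ac split: nat.split)+

lemma H_rep_term_add: "H_rep_term q \<omega> x (u + v) = H_rep_term q \<omega> x u + H_rep_term q \<omega> x v"
proof (induction x arbitrary: u v)
  case (Add s t)
  then show ?case by (simp add: add_ac)
qed (intro poly_mapping_eqI; simp add: lookup_add lookup_H_rep shift_add ring_distribs split: nat.split)+

lemma H_rep_alg_cong:
  assumes "alg_cong (sl2_rel q) s t"
  shows "H_rep_term q \<omega> s = H_rep_term q \<omega> t"
  using assms
proof induction
  case (rel x y)
  then show ?case by (auto simp: sl2_rel_def H_rep_m2_rel H_rep_fr_c)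
next
  case (add_neg x)
  show ?case
    by (intro ext poly_mapping_eqI) (simp add: fr_term_simps lookup_add lookup_Con const_minus_1)
next
  case (distrib_left x y z)
  show ?case by (intro ext) (simp add: fr_term_simps H_rep_term_add)
next
  case (con_central c x)
  show ?case by (intro ext) (simp add: fr_term_simps H_rep_Con_commute)
next
  case (one_mul x)
  show ?case by (intro ext poly_mapping_eqI) (simp add: fr_term_simps lookup_Con)
next
  case (mul_one x)
  have "H_rep_term q \<omega> (Con 1) v = v" for v
    by (intro poly_mapping_eqI) (simp add: lookup_Con)
  then show ?case by (intro ext) (simp add: fr_term_simps)
next
  case (con_add c d)
  show ?case by (intro ext poly_mapping_eqI) (simp add: fr_term_simps lookup_add lookup_Con const_mero_add ring_distribs)
next
  case (con_mul c d)
  show ?case by (intro ext poly_mapping_eqI) (simp add: fr_term_simps lookup_Con const_mero_mult)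
next
  case (add_zero x)
  show ?case by (intro ext poly_mapping_eqI) (simp add: fr_term_simps lookup_add lookup_Con)
qed (auto simp: fr_term_simps add_ac)

section \<open>Passage from terms to elements of A\<close>

lemma alg_class_eqI: "alg_cong R s t \<Longrightarrow> alg_class R s = alg_class R t"
  unfolding alg_class_def by (blast intro: alg_cong.sym alg_cong.trans)

lemma self_in_alg_class: "t \<in> alg_class R t"
  by (simp add: alg_class_def alg_cong.refl)

lemma H_rep_class: "H_rep q \<omega> (sl2_class q t) = H_rep_term q \<omega> t"
  unfolding H_rep_def
proof (rule the_equality)
  show "\<forall>x\<in>sl2_class q t. H_rep_term q \<omega> x = H_rep_term q \<omega> t"
    by (auto simp: alg_class_def intro: H_rep_alg_cong[symmetric])
next
  fix U
  assume "\<forall>x\<in>sl2_class q t. H_rep_term q \<omega> x = U"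
  from bspec[OF this self_in_alg_class] show "U = H_rep_term q \<omega> t" by simp
qed

lemma mult_class: "sl2_class q s \<otimes>\<^bsub>FR_SL2 q\<^esub> sl2_class q t = sl2_class q (s * t)"
proof -
  have "sl2_class q (x * y) = sl2_class q (s * t)" if "x \<in> sl2_class q s" "y \<in> sl2_class q t" for x y
    using that by (intro alg_class_eqI) (auto simp: alg_class_def intro: alg_cong.mul_cong alg_cong.sym)
  then have "(\<Union>x\<in>sl2_class q s. \<Union>y\<in>sl2_class q t. sl2_class q (x * y))
      = (\<Union>x\<in>sl2_class q s. \<Union>y\<in>sl2_class q t. sl2_class q (s * t))"
    by (intro SUP_cong HOL.refl)
  also have "\<dots> = sl2_class q (s * t)"
    using self_in_alg_class[of s] self_in_alg_class[of t] by blast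
  finally show ?thesis
    by (simp add: FR_SL2_def presented_algebra_def)
qed

lemma add_class: "sl2_class q s \<oplus>\<^bsub>FR_SL2 q\<^esub> sl2_class q t = sl2_class q (s + t)"
proof -
  have "sl2_class q (x + y) = sl2_class q (s + t)" if "x \<in> sl2_class q s" "y \<in> sl2_class q t" for x y
    using that by (intro alg_class_eqI) (auto simp: alg_class_def intro: alg_cong.add_cong alg_cong.sym)
  then have "(\<Union>x\<in>sl2_class q s. \<Union>y\<in>sl2_class q t. sl2_class q (x + y))
      = (\<Union>x\<in>sl2_class q s. \<Union>y\<in>sl2_class q t. sl2_class q (s + t))"
    by (intro SUP_cong HOL.refl)
  also have "\<dots> = sl2_class q (s + t)"
    using self_in_alg_class[of s] self_in_alg_class[of t] by blast
  finally show ?thesis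
    by (simp add: FR_SL2_def presented_algebra_def)
qed

lemma zero_class: "\<zero>\<^bsub>FR_SL2 q\<^esub> = sl2_class q 0"
  by (simp add: FR_SL2_def presented_algebra_def)

end

section \<open>The tensor product in coordinates\<close>

locale tensor_H = q_param +
  fixes \<omega>1 \<omega>2 :: complex
begin

abbreviation V :: "hvec hspace" where "V \<equiv> H_space \<omega>1"
abbreviation W :: "hvec hspace" where "W \<equiv> H_space \<omega>2"

text \<open>\<Delta>(f(\<lambda>)) = f(\<lambda>) \<otimes> 1 multiplies the left factor e_j by f
  translated by minus its weight. Moving this scalar to the right past e_k translates it by minus
  the weight of e_k as well.\<close>

definition lam :: "nat \<Rightarrow> nat \<Rightarrow> mero \<Rightarrow> mero" where
  "lam j k f = shift (- \<omega>2 - 2 * of_nat k + (- \<omega>1 - 2 * of_nat j)) f"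

text \<open>The scalar f after it has been moved from the left factor past e_k. It is also the
  action of f(\<lambda>) on the right factor e_k, and thus represents the middle variable.\<close>

definition rho :: "nat \<Rightarrow> mero \<Rightarrow> mero" where
  "rho k f = shift (- \<omega>2 - 2 * of_nat k) f"

lemma rho_lam_simps [simp]:
  "rho k 0 = 0" "rho k 1 = 1" "rho k (f + g) = rho k f + rho k g" "rho k (f - g) = rho k f - rho k g"
  "rho k (f * g) = rho k f * rho k g" "rho k (inverse f) = inverse (rho k f)" "rho k f = 0 \<longleftrightarrow> f = 0"
  "rho k (const_mero c) = const_mero c" "rho k C0 = C0"
  "lam j k 1 = 1" "lam j k (f + g) = lam j k f + lam j k g" "lam j k (f - g) = lam j k f - lam j k g"
  "lam j k (f * g) = lam j k f * lam j k g" "lam j k (const_mero c) = const_mero c"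
  by (simp_all add: rho_def lam_def shift_add shift_diff shift_mult shift_inverse)

text \<open>The coordinate of \<open>v \<otimes> w\<close> at \<open>e\<^sub>j \<otimes> e\<^sub>k\<close>: scalars are moved to the right factor.\<close>

definition tens :: "hvec \<Rightarrow> hvec \<Rightarrow> nat \<Rightarrow> nat \<Rightarrow> mero" where
  "tens v w j k = rho k (Poly_Mapping.lookup v j) * Poly_Mapping.lookup w k"

definition coord :: "(hvec \<times> hvec) multiset \<Rightarrow> nat \<Rightarrow> nat \<Rightarrow> mero" where
  "coord S j k = (\<Sum>(v, w)\<in>#S. tens v w j k)"

lemma coord_empty [simp]: "coord {#} j k = 0"
  and coord_add_mset [simp]: "coord (add_mset (v, w) S) j k = tens v w j k + coord S j k"
  and coord_union [simp]: "coord (S + T) j k = coord S j k + coord T j k"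
  by (simp_all add: coord_def)

text \<open>The coproduct followed by the action on pairs, by recursion on the term, so that a
  product of terms becomes a composition. The link with \<open>coproduct_term\<close> is
  \<open>act_sum_coproduct_term\<close>.\<close>

primrec act :: "fr_term \<Rightarrow> (hvec \<times> hvec) multiset \<Rightarrow> (hvec \<times> hvec) multiset" where
  "act (Con c) S = {#(H_rep_term q \<omega>1 (Con c) v, w). (v, w) \<in># S#}"
| "act Alpha S = {#(opA \<omega>1 v, opA \<omega>2 w). (v, w) \<in># S#} + {#(opB \<omega>1 v, opC \<omega>2 w). (v, w) \<in># S#}"
| "act Beta S = {#(opA \<omega>1 v, opB \<omega>2 w). (v, w) \<in># S#} + {#(opB \<omega>1 v, opD \<omega>2 w). (v, w) \<in># S#}"
| "act Gam S = {#(opC \<omega>1 v, opA \<omega>2 w). (v, w) \<in># S#} + {#(opD \<omega>1 v, opC \<omega>2 w). (v, w) \<in># S#}"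
| "act Delt S = {#(opC \<omega>1 v, opB \<omega>2 w). (v, w) \<in># S#} + {#(opD \<omega>1 v, opD \<omega>2 w). (v, w) \<in># S#}"
| "act (MuL f) S = {#(H_rep_term q \<omega>1 (MuL f) v, w). (v, w) \<in># S#}"
| "act (MuR f) S = {#(v, H_rep_term q \<omega>2 (MuR f) w). (v, w) \<in># S#}"
| "act (Add s t) S = act s S + act t S"
| "act (Mul s t) S = act s (act t S)"

text \<open>The same action transported to arrays of coordinates. Being a function of the
  coordinates alone, it makes the action independent of the formal sum that represents a
  tensor.\<close>

primrec coord_op :: "fr_term \<Rightarrow> (nat \<Rightarrow> nat \<Rightarrow> mero) \<Rightarrow> nat \<Rightarrow> nat \<Rightarrow> mero" where
  "coord_op (Con c) \<Psi> = (\<lambda>j k. const_mero c * \<Psi> j k)"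
| "coord_op Alpha \<Psi> = (\<lambda>j k. rho k (H_A q \<omega>1 j) * H_A q \<omega>2 k * shift (- 1) (\<Psi> j k)
     + (case k of 0 \<Rightarrow> 0 | Suc k' \<Rightarrow> rho k (H_B q \<omega>1 (Suc j)) * C0 * shift (- 1) (\<Psi> (Suc j) k')))"
| "coord_op Beta \<Psi> = (\<lambda>j k. rho k (H_A q \<omega>1 j) * H_B q \<omega>2 (Suc k) * shift 1 (\<Psi> j (Suc k))
     + rho k (H_B q \<omega>1 (Suc j)) * H_D q k * shift 1 (\<Psi> (Suc j) k))"
| "coord_op Gam \<Psi> = (\<lambda>j k. (case j of 0 \<Rightarrow> 0 | Suc j' \<Rightarrow> C0 * H_A q \<omega>2 k * shift (- 1) (\<Psi> j' k))
     + (case k of 0 \<Rightarrow> 0 | Suc k' \<Rightarrow> rho k (H_D q j) * C0 * shift (- 1) (\<Psi> j k')))"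
| "coord_op Delt \<Psi> = (\<lambda>j k. (case j of 0 \<Rightarrow> 0 | Suc j' \<Rightarrow> C0 * H_B q \<omega>2 (Suc k) * shift 1 (\<Psi> j' (Suc k)))
     + rho k (H_D q j) * H_D q k * shift 1 (\<Psi> j k))"
| "coord_op (MuL f) \<Psi> = (\<lambda>j k. lam j k f * \<Psi> j k)"
| "coord_op (MuR f) \<Psi> = (\<lambda>j k. f * \<Psi> j k)"
| "coord_op (Add s t) \<Psi> = (\<lambda>j k. coord_op s \<Psi> j k + coord_op t \<Psi> j k)"
| "coord_op (Mul s t) \<Psi> = coord_op s (coord_op t \<Psi>)"

lemma coord_image:
  assumes "\<And>v w. tens (f v) (g w) j k = c * shift s (tens v w j' k')"
  shows "coord {#(f v, g w). (v, w) \<in># S#} j k = c * shift s (coord S j' k')"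
  by (induction S) (auto simp: assms shift_add ring_distribs)

lemma rho_shift:
  "shift s (tens v w j k) = shift (s - \<omega>2 - 2 * of_nat k) (Poly_Mapping.lookup v j) * shift s (Poly_Mapping.lookup w k)"
  by (simp add: tens_def rho_def shift_mult algebra_simps)

text \<open>In \<alpha> \<otimes> \<beta> a scalar on the left either passes e_(k+1) and is then
  translated by 1 through \<beta>, or is translated by -1 through \<alpha> and then passes e_k. Both
  give the same translation, since \<beta> lowers the weight by 2.\<close>

lemma shift_rho_Suc: "shift 1 (rho (Suc k) f) = shift (- \<omega>2 - 2 * of_nat k + (- 1)) f"
  and rho_shift_minus_1: "rho k (shift (- 1) f) = shift (- \<omega>2 - 2 * of_nat k + (- 1)) f"
  by (simp_all add: rho_def algebra_simps)

lemma tens_scalar: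
  "tens (H_rep_term q \<omega>1 (Con c) v) w j k = const_mero c * tens v w j k"
  "tens v (H_rep_term q \<omega>2 (Con c) w) j k = const_mero c * tens v w j k"
  "tens (H_rep_term q \<omega>1 (MuL f) v) w j k = lam j k f * tens v w j k"
  "tens v (H_rep_term q \<omega>2 (MuR f) w) j k = f * tens v w j k"
  "tens (H_rep_term q \<omega>1 (MuR f) v) w j k = rho k f * tens v w j k"
  "tens v (H_rep_term q \<omega>2 (MuL f) w) j k = rho k f * tens v w j k"
  by (simp_all add: tens_def lookup_H_rep lam_def rho_def shift_mult)

lemma coord_act: "coord (act x S) = coord_op x (coord S)"
proof (induction x arbitrary: S)
  case (Con c)
  have "coord (act (Con c) S) j k = const_mero c * shift 0 (coord S j k)" for j k
    unfolding act.simps by (rule coord_image) (simp add: tens_scalar)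
  then show ?case by (intro ext) simp
next
  case (MuL f)
  have "coord (act (MuL f) S) j k = lam j k f * shift 0 (coord S j k)" for j k
    unfolding act.simps by (rule coord_image) (simp add: tens_scalar)
  then show ?case by (intro ext) simp
next
  case (MuR f)
  have "coord (act (MuR f) S) j k = f * shift 0 (coord S j k)" for j k
    unfolding act.simps by (rule coord_image) (simp add: tens_scalar)
  then show ?case by (intro ext) simp
next
  case Alpha
  have 1: "coord {#(opA \<omega>1 v, opA \<omega>2 w). (v, w) \<in># S#} j k
      = (rho k (H_A q \<omega>1 j) * H_A q \<omega>2 k) * shift (- 1) (coord S j k)" for j k
    by (rule coord_image) (simp add: rho_shift, simp add: tens_def lookup_H_rep rho_def shift_mult algebra_simps)
  have 2: "coord {#(opB \<omega>1 v, opC \<omega>2 w). (v, w) \<in># S#} j (Suc k)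
      = (rho (Suc k) (H_B q \<omega>1 (Suc j)) * C0) * shift (- 1) (coord S (Suc j) k)" for j k
    by (rule coord_image) (simp add: rho_shift, simp add: tens_def lookup_H_rep rho_def shift_mult algebra_simps)
  \<comment> \<open>No multiple of e_0 lies in the image of \<gamma>; the factor \<open>0\<close>
    brings this into the shape that \<open>coord_image\<close> expects.\<close>
  have 3: "coord {#(opB \<omega>1 v, opC \<omega>2 w). (v, w) \<in># S#} j 0 = 0 * shift (- 1) (coord S (Suc j) 0)" for j
    by (rule coord_image) (simp add: tens_def lookup_H_rep)
  show ?case by (intro ext) (simp add: 1 2 3 split: nat.split)
next
  case Beta
  have 1: "coord {#(opA \<omega>1 v, opB \<omega>2 w). (v, w) \<in># S#} j k
      = (rho k (H_A q \<omega>1 j) * H_B q \<omega>2 (Suc k)) * shift 1 (coord S j (Suc k))" for j k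
    by (rule coord_image) (simp add: tens_def lookup_H_rep shift_mult shift_rho_Suc rho_shift_minus_1 mult_ac)
  have 2: "coord {#(opB \<omega>1 v, opD \<omega>2 w). (v, w) \<in># S#} j k
      = (rho k (H_B q \<omega>1 (Suc j)) * H_D q k) * shift 1 (coord S (Suc j) k)" for j k
    by (rule coord_image) (simp add: rho_shift, simp add: tens_def lookup_H_rep rho_def shift_mult algebra_simps)
  show ?case by (intro ext) (simp add: 1 2)
next
  case Gam
  have 1: "coord {#(opC \<omega>1 v, opA \<omega>2 w). (v, w) \<in># S#} (Suc j) k
      = (C0 * H_A q \<omega>2 k) * shift (- 1) (coord S j k)" for j k
    by (rule coord_image) (simp add: rho_shift, simp add: tens_def lookup_H_rep rho_def shift_mult algebra_simps)
  have 2: "coord {#(opD \<omega>1 v, opC \<omega>2 w). (v, w) \<in># S#} j (Suc k)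
      = (rho (Suc k) (H_D q j) * C0) * shift (- 1) (coord S j k)" for j k
    by (rule coord_image) (simp add: rho_shift, simp add: tens_def lookup_H_rep rho_def shift_mult algebra_simps)
  have 3: "coord {#(opC \<omega>1 v, opA \<omega>2 w). (v, w) \<in># S#} 0 k = 0 * shift (- 1) (coord S 0 k)" for k
    by (rule coord_image) (simp add: tens_def lookup_H_rep)
  have 4: "coord {#(opD \<omega>1 v, opC \<omega>2 w). (v, w) \<in># S#} j 0 = 0 * shift (- 1) (coord S j 0)" for j
    by (rule coord_image) (simp add: tens_def lookup_H_rep)
  show ?case by (intro ext) (simp add: 1 2 3 4 split: nat.split)
next
  case Delt
  have 1: "coord {#(opC \<omega>1 v, opB \<omega>2 w). (v, w) \<in># S#} (Suc j) k
      = (C0 * H_B q \<omega>2 (Suc k)) * shift 1 (coord S j (Suc k))" for j k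
    by (rule coord_image) (simp add: tens_def lookup_H_rep shift_mult shift_rho_Suc rho_shift_minus_1 mult_ac)
  have 2: "coord {#(opD \<omega>1 v, opD \<omega>2 w). (v, w) \<in># S#} j k
      = (rho k (H_D q j) * H_D q k) * shift 1 (coord S j k)" for j k
    by (rule coord_image) (simp add: rho_shift, simp add: tens_def lookup_H_rep rho_def shift_mult algebra_simps)
  have 3: "coord {#(opC \<omega>1 v, opB \<omega>2 w). (v, w) \<in># S#} 0 k = 0 * shift 1 (coord S 0 k)" for k
    by (rule coord_image) (simp add: tens_def lookup_H_rep)
  show ?case by (intro ext) (simp add: 1 2 3 split: nat.split)
next
  case (Add s t)
  then show ?case by (intro ext) simp
qed simp

definition c0 :: mero where "c0 = const_mero (Q + 1 / Q)"

lemma pF_nF: "pF = c0 - nF" "rho k pF = c0 - rho k nF" "lam j k pF = c0 - lam j k nF"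
  by (simp_all add: nF_def c0_def rho_def lam_def shift_diff)

lemma c0_simps [simp]: "rho k c0 = c0" "lam j k c0 = c0" "shift a c0 = c0"
  by (simp_all add: c0_def)

lemma rho_pL: "rho k (pL \<omega>1 j) = lam j k pF"
  by (simp add: rho_def lam_def)

lemma pL_rho: "pL \<omega>2 k = rho k pF"
  by (simp add: rho_def)

text \<open>Rewriting to a normal order: on either factor only \<alpha>\<beta>, \<gamma>\<delta>,
  \<gamma>\<alpha>, \<delta>\<beta>, \<gamma>\<beta> and the identity remain. On the left factor
  \<mu> becomes \<open>rho k\<close> and \<lambda> becomes \<open>lam j k\<close>; on the right
  factor \<lambda> becomes \<open>rho k\<close>. All coefficients are then scalars of the
  coordinate.\<close>

lemma tens_left:
  "tens (opB \<omega>1 (opA \<omega>1 x)) y j k = rho k nF * tens (opA \<omega>1 (opB \<omega>1 x)) y j k"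
  "tens (opD \<omega>1 (opC \<omega>1 x)) y j k = rho k nF * tens (opC \<omega>1 (opD \<omega>1 x)) y j k"
  "tens (opA \<omega>1 (opC \<omega>1 x)) y j k = lam j k pF * tens (opC \<omega>1 (opA \<omega>1 x)) y j k"
  "tens (opB \<omega>1 (opD \<omega>1 x)) y j k = lam j k pF * tens (opD \<omega>1 (opB \<omega>1 x)) y j k"
  "tens (opA \<omega>1 (opD \<omega>1 x)) y j k = tens x y j k + lam j k pF * tens (opC \<omega>1 (opB \<omega>1 x)) y j k"
  "tens (opD \<omega>1 (opA \<omega>1 x)) y j k = tens x y j k + rho k nF * tens (opC \<omega>1 (opB \<omega>1 x)) y j k"
  "tens (opB \<omega>1 (opC \<omega>1 x)) y j k = (lam j k pF - rho k pF) * tens x y j k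
     + lam j k pF * rho k nF * tens (opC \<omega>1 (opB \<omega>1 x)) y j k"
  unfolding tens_def lookup_quadratic rho_lam_simps rho_pL by (simp_all add: algebra_simps nF_nonzero)

lemma tens_right:
  "tens x (opB \<omega>2 (opA \<omega>2 y)) j k = nF * tens x (opA \<omega>2 (opB \<omega>2 y)) j k"
  "tens x (opD \<omega>2 (opC \<omega>2 y)) j k = nF * tens x (opC \<omega>2 (opD \<omega>2 y)) j k"
  "tens x (opA \<omega>2 (opC \<omega>2 y)) j k = rho k pF * tens x (opC \<omega>2 (opA \<omega>2 y)) j k"
  "tens x (opB \<omega>2 (opD \<omega>2 y)) j k = rho k pF * tens x (opD \<omega>2 (opB \<omega>2 y)) j k"
  "tens x (opA \<omega>2 (opD \<omega>2 y)) j k = tens x y j k + rho k pF * tens x (opC \<omega>2 (opB \<omega>2 y)) j k"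
  "tens x (opD \<omega>2 (opA \<omega>2 y)) j k = tens x y j k + nF * tens x (opC \<omega>2 (opB \<omega>2 y)) j k"
  "tens x (opB \<omega>2 (opC \<omega>2 y)) j k = (rho k pF - pF) * tens x y j k
     + rho k pF * nF * tens x (opC \<omega>2 (opB \<omega>2 y)) j k"
  unfolding tens_def lookup_quadratic pL_rho by (simp_all add: algebra_simps nF_nonzero)

lemma coord_act_scalar:
  "coord (act (Con c) S) j k = const_mero c * coord S j k"
  "coord (act (MuL f) S) j k = lam j k f * coord S j k"
  "coord (act (MuR f) S) j k = f * coord S j k"
  unfolding coord_act by simp_all

declare act.simps(1,6,7) [simp del]

lemma coord_act_fr_H: "coord (act (fr_H q) S) j k = (lam j k pF - nF) * coord S j k"
proof -
  have "coord (act (fr_H q) S) j k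
      = const_mero (Q - 1 / Q) * ((lam j k (fr_u q) * fr_u q - 1) * (lam j k (fr_r q) * fr_r q)) * coord S j k"
    by (simp add: fr_H_def fr_term_simps coord_act_scalar const_minus_1 ring_distribs mult_ac)
  then show ?thesis by (simp only: lam_def fr_H_scalar)
qed

lemma coord_act_fr_I: "coord (act (fr_I q) S) j k = (lam j k pF - pF) * coord S j k"
proof -
  have "coord (act (fr_I q) S) j k
      = const_mero (Q - 1 / Q) * ((fr_u q - lam j k (fr_u q)) * (lam j k (fr_r q) * fr_r q)) * coord S j k"
    by (simp add: fr_I_def fr_term_simps coord_act_scalar const_minus_1 ring_distribs mult_ac)
  then show ?thesis by (simp only: lam_def fr_I_scalar)
qed

lemma const_lam_fr_F: "const_mero Q * (lam j k (fr_F q) * g) = lam j k pF * g"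
  unfolding lam_def by (rule const_F_shift(2))

lemma lam_shift [simp]:
  "shift a (lam j k f) = lam j k (shift a f)"
  "lam (Suc j) k f = lam j k (shift (- 2) f)" "lam j (Suc k) f = lam j k (shift (- 2) f)"
  by (simp_all add: lam_def algebra_simps)

text \<open>After normal ordering of both factors and elimination of \<open>pF\<close> by
  \<open>pF_nF\<close>, each quadratic relation is a polynomial identity in \<open>nF\<close>,
  \<open>rho k nF\<close> and \<open>lam j k nF\<close>; the middle variable drops out.\<close>

lemma coord_act_m2_rel:
  assumes "m2_rel q s t"
  shows "coord (act s {#(v, w)#}) j k = coord (act t {#(v, w)#}) j k"
proof -
  \<comment> \<open>Multiplied by \<open>nF\<close>, the relation contains no inverses and can be
    verified as a polynomial identity.\<close>
  have BA: "coord (act (Mul Beta Alpha) {#(v, w)#}) j k = nF * coord (act (Mul Alpha Beta) {#(v, w)#}) j k"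
    by (simp add: tens_left tens_right ring_distribs) (simp add: pF_nF algebra_simps)
  have DC: "coord (act (Mul Delt Gam) {#(v, w)#}) j k = nF * coord (act (Mul Gam Delt) {#(v, w)#}) j k"
    by (simp add: tens_left tens_right ring_distribs) (simp add: pF_nF algebra_simps)
  show ?thesis
    using assms
  proof cases
    case alpha_beta
    then show ?thesis
      using BA by (simp only: fr_term_simps act.simps(9) coord_act_scalar const_F_shift(1)) (simp add: nF_nonzero)
  next
    case gamma_delta
    then show ?thesis
      using DC by (simp only: fr_term_simps act.simps(9) coord_act_scalar const_F_shift(1)) (simp add: nF_nonzero)
  next
    case alpha_gamma
    then show ?thesis
      by (simp add: fr_term_simps coord_act_scalar const_lam_fr_F tens_left tens_right ring_distribs; simp add: pF_nF algebra_simps)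
  next
    case beta_delta
    then show ?thesis
      by (simp add: fr_term_simps coord_act_scalar const_lam_fr_F tens_left tens_right ring_distribs; simp add: pF_nF algebra_simps)
  next
    case alpha_delta
    then show ?thesis
      by (simp add: fr_term_simps coord_act_scalar coord_act_fr_H tens_left tens_right ring_distribs const_minus_1; simp add: pF_nF algebra_simps)
  next
    case alpha_delta'
    then show ?thesis
      by (simp add: fr_term_simps coord_act_scalar coord_act_fr_H tens_left tens_right ring_distribs const_minus_1 fr_G_eq; simp add: pF_nF algebra_simps)
  next
    case beta_gamma
    then show ?thesis
      by (simp add: fr_term_simps coord_act_scalar coord_act_fr_I tens_left tens_right ring_distribs const_minus_1 fr_G_eq; simp add: pF_nF algebra_simps)
  next
    case beta_gamma'
    then show ?thesis
      by (simp add: fr_term_simps coord_act_scalar coord_act_fr_I tens_left tens_right ring_distribs const_minus_1 fr_G_eq; simp add: pF_nF algebra_simps)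
  qed ((simp add: fr_term_simps coord_act_scalar const_mero_add const_mero_mult shift_add shift_mult
        ring_distribs mult_ac; fail)
      | (cases j; cases k; simp only: fr_term_simps coord_act coord_op.simps;
        simp add: shift_mult ring_distribs))+
qed

text \<open>The element c is grouplike, so c = 1 on both factors gives c = 1 on the tensor
  product.\<close>

lemma coord_act_fr_c: "coord (act (fr_c q) {#(v, w)#}) j k = coord (act 1 {#(v, w)#}) j k"
  by (simp add: fr_c_def fr_term_simps coord_act_scalar const_lam_fr_F tens_left tens_right ring_distribs const_minus_1; simp add: pF_nF algebra_simps)

lemma act_empty [simp]: "act x {#} = {#}"
  by (induction x) (simp_all add: act.simps)

lemma act_union: "act x (S + T) = act x S + act x T"
  by (induction x arbitrary: S T) (simp_all add: act.simps add_ac)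

lemma coord_act_eqI:
  assumes "\<And>v w j k. coord (act s {#(v, w)#}) j k = coord (act t {#(v, w)#}) j k"
  shows "coord (act s S) = coord (act t S)"
proof (induction S)
  case (add p S)
  obtain v w where p: "p = (v, w)" by fastforce
  have "act x (add_mset p S) = act x {#(v, w)#} + act x S" for x
    using act_union[of x "{#p#}" S] p by simp
  with add assms show ?case by (intro ext) simp
qed simp

lemma coord_op_const: "coord_op x (\<lambda>j k. const_mero c * \<Psi> j k) = (\<lambda>j k. const_mero c * coord_op x \<Psi> j k)"
proof (induction x arbitrary: \<Psi>)
  case (Mul s t)
  show ?case by (simp only: coord_op.simps Mul.IH)
qed (intro ext; simp add: shift_mult ring_distribs mult_ac split: nat.split)+

text \<open>Here the action on tensors becomes independent of the term chosen for an element of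
  \<open>A\<close>: the relations hold for the images under \<Delta> once these are evaluated on
  coordinates.\<close>

lemma coord_act_alg_cong:
  assumes "alg_cong (sl2_rel q) s t"
  shows "coord (act s S) = coord (act t S)"
  using assms
proof (induction arbitrary: S)
  case (rel x y)
  then show ?case
    by (intro coord_act_eqI) (auto simp: sl2_rel_def coord_act_m2_rel coord_act_fr_c)
next
  case (mul_cong x x' y y')
  then show ?case by (simp add: fr_term_simps) (simp add: coord_act)
next
  case (add_neg x)
  show ?case by (intro ext) (simp add: fr_term_simps coord_act_scalar const_minus_1)
next
  case (distrib_left x y z)
  show ?case by (intro ext) (simp add: fr_term_simps act_union)
next
  case (con_central c x)
  show ?case by (simp add: fr_term_simps) (simp add: coord_act coord_op_const)
next
  case (mul_one x)
  show ?case by (simp add: fr_term_simps) (simp add: coord_act)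
qed (intro ext; simp add: fr_term_simps coord_act_scalar const_mero_add const_mero_mult ring_distribs add_ac mult_ac)+

section \<open>Independence of the formal sum that represents a coproduct\<close>

definition act_sum ::
    "(fr_term set \<times> fr_term set) multiset \<Rightarrow> (hvec \<times> hvec) multiset \<Rightarrow> (hvec \<times> hvec) multiset" where
  "act_sum D S = (\<Sum>(X', X'')\<in>#D. {#(H_rep q \<omega>1 X' v, H_rep q \<omega>2 X'' w). (v, w) \<in># S#})"

lemma act_sum_empty [simp]: "act_sum {#} S = {#}"
  and act_sum_add_mset: "act_sum (add_mset (X', X'') D) S
    = {#(H_rep q \<omega>1 X' v, H_rep q \<omega>2 X'' w). (v, w) \<in># S#} + act_sum D S"
  and act_sum_union: "act_sum (D + D') S = act_sum D S + act_sum D' S"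
  by (simp_all add: act_sum_def)

lemma H_rep_Con_1: "H_rep_term q \<omega> (Con 1) v = v"
  by (intro poly_mapping_eqI) (simp add: lookup_Con)

text \<open>Factorwise multiplication of coproducts becomes composition. The assumptions are there
  because \<open>H_rep\<close> is computed, and hence multiplicative, on classes of terms.\<close>

lemma act_sum_mult:
  assumes "set_mset D \<subseteq> range (sl2_class q) \<times> range (sl2_class q)"
    and "set_mset D' \<subseteq> range (sl2_class q) \<times> range (sl2_class q)"
  shows "act_sum (\<Sum>(X, Y)\<in>#D. {#(X \<otimes>\<^bsub>FR_SL2 q\<^esub> X', Y \<otimes>\<^bsub>FR_SL2 q\<^esub> Y'). (X', Y') \<in># D'#}) S
    = act_sum D (act_sum D' S)"
  using assms(1)
proof (induction D)
  case (add p D)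
  then obtain s t where p: "p = (sl2_class q s, sl2_class q t)" by auto
  have "act_sum {#(sl2_class q s \<otimes>\<^bsub>FR_SL2 q\<^esub> X', sl2_class q t \<otimes>\<^bsub>FR_SL2 q\<^esub> Y'). (X', Y') \<in># D'#} S
      = {#(H_rep_term q \<omega>1 s v, H_rep_term q \<omega>2 t w). (v, w) \<in># act_sum D' S#}"
    using assms(2)
  proof (induction D')
    case (add p' D')
    then obtain s' t' where p': "p' = (sl2_class q s', sl2_class q t')" by auto
    from add show ?case
      by (simp add: p' act_sum_add_mset mult_class H_rep_class fr_term_simps multiset.map_comp o_def case_prod_unfold)
  qed simp
  with add show ?case
    by (simp add: p act_sum_union act_sum_add_mset H_rep_class)
qed simp

lemma coproduct_term_classes:
  "set_mset (coproduct_term q x) \<subseteq> range (sl2_class q) \<times> range (sl2_class q)"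
proof (induction x)
  case (Mul s t)
  show ?case
  proof
    fix p assume "p \<in> set_mset (coproduct_term q (Mul s t))"
    then obtain X Y X' Y' where XY: "(X, Y) \<in># coproduct_term q s" "(X', Y') \<in># coproduct_term q t"
      and p: "p = (X \<otimes>\<^bsub>FR_SL2 q\<^esub> X', Y \<otimes>\<^bsub>FR_SL2 q\<^esub> Y')"
      by auto
    from XY Mul.IH obtain a b c d where "X = sl2_class q a" "Y = sl2_class q b" "X' = sl2_class q c" "Y' = sl2_class q d"
      by blast
    then show "p \<in> range (sl2_class q) \<times> range (sl2_class q)"
      by (simp add: p mult_class)
  qed
qed auto

lemma act_sum_coproduct_term: "act_sum (coproduct_term q x) S = act x S"
proof (induction x arbitrary: S)
  case (Mul s t)
  show ?case
    by (simp only: coproduct_term.simps act_sum_mult[OF coproduct_term_classes coproduct_term_classes] Mul.IH act.simps)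
next
  case (Add s t)
  then show ?case by (simp add: act_sum_union)
qed (simp_all add: act_sum_add_mset H_rep_class fr_term_simps H_rep_Con_1 act.simps)

lemma tens_add: "tens (v + v') w j k = tens v w j k + tens v' w j k"
  "tens v (w + w') j k = tens v w j k + tens v w' j k"
  "tens 0 w j k = 0" "tens v 0 j k = 0"
  by (simp_all add: tens_def lookup_add ring_distribs)

text \<open>In the balancing relation f(\<mu>) on the left factor and f(\<lambda>) on the right one
  both multiply the coordinate by \<open>rho k f\<close>; the other relations are
  additivity.\<close>

lemma coord_act_sum_AA_rel:
  assumes "AA_rel q D D'"
  shows "coord (act_sum D S) j k = coord (act_sum D' S) j k"
  using assms
proof cases
  case (zero Y c b)
  then obtain t where "Y = sl2_class q t" by (auto simp: FR_SL2_deg_def)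
  then show ?thesis
    using zero by (induction S) (auto simp: act_sum_add_mset zero_class H_rep_class fr_term_simps tens_scalar)
next
  case (add_left X a c X' Y b)
  then obtain s s' t where "X = sl2_class q s" "X' = sl2_class q s'" "Y = sl2_class q t"
    by (auto simp: FR_SL2_deg_def)
  then show ?thesis
    using add_left by (induction S) (auto simp: act_sum_add_mset add_class H_rep_class fr_term_simps tens_add)
next
  case (add_right X a c Y b Y')
  then obtain s t t' where "X = sl2_class q s" "Y = sl2_class q t" "Y' = sl2_class q t'"
    by (auto simp: FR_SL2_deg_def)
  then show ?thesis
    using add_right by (induction S) (auto simp: act_sum_add_mset add_class H_rep_class fr_term_simps tens_add)
next
  case (balanced X a c Y b f)
  then obtain s t where "X = sl2_class q s" "Y = sl2_class q t"
    by (auto simp: FR_SL2_deg_def)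
  then show ?thesis
    using balanced by (induction S) (auto simp: act_sum_add_mset mult_class H_rep_class fr_term_simps tens_scalar)
qed

lemma coord_act_sum_cong:
  assumes "fsum_cong P (AA_rel q) D D'"
  shows "coord (act_sum D S) = coord (act_sum D' S)"
  using assms by induction (auto simp: act_sum_union coord_act_sum_AA_rel intro!: ext)

lemma coord_act_sum_coproduct:
  assumes "D \<in> coproduct q (sl2_class q x)"
  shows "coord (act_sum D S) = coord (act x S)"
proof -
  from assms obtain y where "y \<in> sl2_class q x" "D \<in> fsum_class (AA_pairs q) (AA_rel q) (coproduct_term q y)"
    by (auto simp: coproduct_def)
  then have "alg_cong (sl2_rel q) x y" "fsum_cong (AA_pairs q) (AA_rel q) (coproduct_term q y) D"
    by (auto simp: alg_class_def fsum_class_def)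
  then show ?thesis
    by (metis coord_act_alg_cong coord_act_sum_cong act_sum_coproduct_term)
qed

section \<open>Coordinates as a complete invariant of tensors\<close>

lemma lookup_map_times: "Poly_Mapping.lookup (Poly_Mapping.map ((*) f) v) j = f * Poly_Mapping.lookup v j"
  for f :: mero
  by (simp add: Poly_Mapping.map.rep_eq when_def)

lemma coord_hs_rel:
  assumes "hs_rel V W S T"
  shows "coord S j k = coord T j k"
  using assms
proof cases
  case (balanced v w b f)
  show ?thesis
  \<comment> \<open>A nonzero coefficient of \<open>w\<close> at \<open>k\<close> forces the weight
    \<open>b\<close> to be the weight of e_k, so that the translation by \<open>- b\<close> is
    \<open>rho k\<close>.\<close>
  proof (cases "Poly_Mapping.lookup w k = 0")
    case True
    with balanced show ?thesis by (simp add: tens_def H_space_def lookup_map_times)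
  next
    case False
    with balanced have "b = \<omega>2 + 2 * of_nat k" by (simp add: H_space_def in_keys_iff)
    with balanced show ?thesis
      by (simp add: tens_def H_space_def lookup_map_times) (simp add: rho_def)
  qed
qed (auto simp: H_space_def tens_add)

lemma coord_cong:
  assumes "fsum_cong P (hs_rel V W) S T"
  shows "coord S = coord T"
  using assms by induction (auto simp: coord_hs_rel intro!: ext)

abbreviation cong :: "(hvec \<times> hvec) multiset \<Rightarrow> (hvec \<times> hvec) multiset \<Rightarrow> bool" where
  "cong \<equiv> fsum_cong UNIV (hs_rel V W)"

lemma H_space_simps [simp]:
  "carrier (H_space \<omega>) = UNIV" "zero (H_space \<omega>) = 0" "add (H_space \<omega>) = (+)"
  by (simp_all add: H_space_def)

lemma cong_refl: "cong S S"
  by (rule fsum_cong.refl) simp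

lemma cong_sum:
  assumes "\<And>i. i \<in> I \<Longrightarrow> cong (S i) (T i)"
  shows "cong (sum S I) (sum T I)"
  using assms
  by (induction I rule: infinite_finite_induct) (auto intro: cong_refl fsum_cong.add)

lemma cong_add_left: "cong {#(v + v', w)#} {#(v, w), (v', w)#}"
  using hs_rel.add_left[of v V v' w W] by (intro fsum_cong.rel) simp

lemma cong_add_right: "cong {#(v, w + w')#} {#(v, w), (v, w')#}"
  using hs_rel.add_right[of v V w W w'] by (intro fsum_cong.rel) simp

lemma cong_zero_left: "cong {#(0, w)#} {#}"
  using hs_rel.zero[of w W V] by (intro fsum_cong.rel) simp

lemma smult_H_space: "f \<odot>\<^bsub>H_space \<omega>\<^esub> v = Poly_Mapping.map ((*) f) v"
  by (simp add: H_space_def)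

lemma cong_balanced:
  "cong {#(Poly_Mapping.map ((*) f) v, Poly_Mapping.single k g)#} {#(v, Poly_Mapping.single k (rho k f * g))#}"
proof -
  have "Poly_Mapping.single k g \<in> weight_space W (\<omega>2 + 2 * of_nat k)"
    by (auto simp: H_space_def)
  from hs_rel.balanced[of v V, OF _ this, of f]
  have "cong {#(Poly_Mapping.map ((*) f) v, Poly_Mapping.single k g)#}
     {#(v, Poly_Mapping.map ((*) (shift (- (\<omega>2 + 2 * of_nat k)) f)) (Poly_Mapping.single k g))#}"
    by (intro fsum_cong.rel) (simp add: smult_H_space)
  also have "Poly_Mapping.map ((*) (shift (- (\<omega>2 + 2 * of_nat k)) f)) (Poly_Mapping.single k g)
      = Poly_Mapping.single k (rho k f * g)"
    by (rule poly_mapping_eqI) (simp add: lookup_map_times lookup_single when_def rho_def)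
  finally show ?thesis .
qed

text \<open>The relations mention zero on the left only; balancing with the scalar 0 carries it to
  the right.\<close>

lemma cong_zero_right: "cong {#(v, 0)#} {#}"
proof -
  have "cong {#(0, 0)#} {#(v, 0)#}"
    using cong_balanced[of 0 v 0 0] by (simp add: poly_mapping_eqI[of "Poly_Mapping.map ((*) 0) v" 0] lookup_map_times)
  then show ?thesis
    by (meson cong_zero_left fsum_cong.sym fsum_cong.trans)
qed

definition normal_form :: "nat \<Rightarrow> (nat \<Rightarrow> nat \<Rightarrow> mero) \<Rightarrow> (hvec \<times> hvec) multiset" where
  "normal_form N \<Psi> = (\<Sum>(j, k)\<in>{..<N} \<times> {..<N}. {#(basis_vec j, Poly_Mapping.single k (\<Psi> j k))#})"

text \<open>Formal sums are finite, so normal forms are truncated. Asking for all large cut-offs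
  allows two sums to be brought to a common one.\<close>

definition has_nf :: "(hvec \<times> hvec) multiset \<Rightarrow> bool" where
  "has_nf S \<longleftrightarrow> (\<exists>N0. \<forall>N\<ge>N0. cong S (normal_form N (coord S)))"

lemma normal_form_add: "cong (normal_form N (\<lambda>j k. \<Psi> j k + \<Psi>' j k)) (normal_form N \<Psi> + normal_form N \<Psi>')"
  unfolding normal_form_def sum.distrib[symmetric]
proof (rule cong_sum, clarify)
  fix j k
  have "{#(basis_vec j, Poly_Mapping.single k (\<Psi> j k)), (basis_vec j, Poly_Mapping.single k (\<Psi>' j k))#}
      = {#(basis_vec j, Poly_Mapping.single k (\<Psi> j k))#} + {#(basis_vec j, Poly_Mapping.single k (\<Psi>' j k))#}"
    by simp
  then show "cong {#(basis_vec j, Poly_Mapping.single k (\<Psi> j k + \<Psi>' j k))#}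
      ({#(basis_vec j, Poly_Mapping.single k (\<Psi> j k))#} + {#(basis_vec j, Poly_Mapping.single k (\<Psi>' j k))#})"
    using cong_add_right[of "basis_vec j" "Poly_Mapping.single k (\<Psi> j k)" "Poly_Mapping.single k (\<Psi>' j k)"]
    by (simp only: single_add)
qed

lemma has_nf_union:
  assumes "has_nf S" "has_nf T"
  shows "has_nf (S + T)"
proof -
  from assms obtain N1 N2 where "\<forall>N\<ge>N1. cong S (normal_form N (coord S))" "\<forall>N\<ge>N2. cong T (normal_form N (coord T))"
    by (auto simp: has_nf_def)
  moreover have "coord (S + T) = (\<lambda>j k. coord S j k + coord T j k)"
    by (intro ext) simp
  ultimately have "\<forall>N\<ge>max N1 N2. cong (S + T) (normal_form N (coord (S + T)))"
    using fsum_cong.trans[OF fsum_cong.add fsum_cong.sym[OF normal_form_add]] by simp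
  then show ?thesis unfolding has_nf_def by blast
qed

lemma has_nf_cong:
  assumes "has_nf T" "cong S T"
  shows "has_nf S"
proof -
  from assms(1) obtain N0 where "\<forall>N\<ge>N0. cong T (normal_form N (coord T))" unfolding has_nf_def by blast
  then have "\<forall>N\<ge>N0. cong S (normal_form N (coord S))"
    unfolding coord_cong[OF assms(2)] using fsum_cong.trans[OF assms(2)] by blast
  then show ?thesis unfolding has_nf_def by blast
qed

lemma has_nf_empty: "has_nf {#}"
proof -
  have "cong (normal_form N (coord {#})) {#}" for N
  proof -
    have "cong (normal_form N (coord {#})) (\<Sum>(j, k)\<in>{..<N} \<times> {..<N}. {#})"
      unfolding normal_form_def by (intro cong_sum) (auto intro: cong_zero_right)
    then show ?thesis by simp
  qed
  then show ?thesis unfolding has_nf_def by (blast intro: fsum_cong.sym)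
qed

lemma coord_single: "coord {#(Poly_Mapping.single a g, Poly_Mapping.single b h)#} j k
    = (if j = a \<and> k = b then rho b g * h else 0)"
  by (simp add: tens_def lookup_single when_def)

lemma has_nf_single: "has_nf {#(Poly_Mapping.single a g, Poly_Mapping.single b h)#}"
proof -
  let ?S = "{#(Poly_Mapping.single a g, Poly_Mapping.single b h)#}"
  let ?U = "\<lambda>p. if p = (a, b) then {#(basis_vec a, Poly_Mapping.single b (rho b g * h))#} else {#}"
  have 1: "cong ?S {#(basis_vec a, Poly_Mapping.single b (rho b g * h))#}"
  proof -
    have "Poly_Mapping.single a g = Poly_Mapping.map ((*) g) (basis_vec a)"
      by (rule poly_mapping_eqI) (simp add: lookup_map_times basis_vec_def lookup_single when_def)
    then show ?thesis by (simp add: cong_balanced)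
  qed
  have "cong ?S (normal_form N (coord ?S))" if "N \<ge> Suc (max a b)" for N
  proof -
    have "cong (normal_form N (coord ?S)) (\<Sum>p\<in>{..<N} \<times> {..<N}. ?U p)"
      unfolding normal_form_def
    proof (rule cong_sum, clarify)
      fix j k
      show "cong {#(basis_vec j, Poly_Mapping.single k (coord ?S j k))#} (?U (j, k))"
        by (cases "j = a \<and> k = b")
          (auto simp: coord_single simp del: coord_add_mset intro: cong_refl cong_zero_right)
    qed
    also have "(\<Sum>p\<in>{..<N} \<times> {..<N}. ?U p) = {#(basis_vec a, Poly_Mapping.single b (rho b g * h))#}"
      using that by (subst sum.delta) auto
    finally show ?thesis using 1 by (blast intro: fsum_cong.sym fsum_cong.trans)
  qed
  then show ?thesis unfolding has_nf_def by blast
qed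

text \<open>Induction over the supports of both vectors, one basis term at a time, reduces to
  multiples of e_a \<otimes> e_b.\<close>

lemma has_nf_pair: "has_nf {#(v, w)#}"
proof -
  have update: "Poly_Mapping.update k c u = u + Poly_Mapping.single k c" if "k \<notin> Poly_Mapping.keys u" for k c and u :: hvec
    using that by (intro poly_mapping_eqI) (auto simp: lookup_update lookup_add lookup_single in_keys_iff when_def)
  have single: "has_nf {#(v, Poly_Mapping.single b h)#}" for b h
  proof (induction v rule: update_induct)
    case const
    then show ?case using has_nf_cong[OF has_nf_empty cong_zero_left] .
  next
    case (update u a g)
    then have "has_nf ({#(u, Poly_Mapping.single b h)#} + {#(Poly_Mapping.single a g, Poly_Mapping.single b h)#})"
      by (intro has_nf_union has_nf_single)
    with update \<open>\<And>k c u. k \<notin> Poly_Mapping.keys u \<Longrightarrow> Poly_Mapping.update k c u = u + Poly_Mapping.single k c\<close>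
    show ?case using has_nf_cong[OF _ cong_add_left] by (simp add: add_mset_commute)
  qed
  show ?thesis
  proof (induction w rule: update_induct)
    case const
    then show ?case using has_nf_cong[OF has_nf_empty cong_zero_right] .
  next
    case (update u a g)
    then have "has_nf ({#(v, u)#} + {#(v, Poly_Mapping.single a g)#})"
      by (intro has_nf_union single)
    with update \<open>\<And>k c u. k \<notin> Poly_Mapping.keys u \<Longrightarrow> Poly_Mapping.update k c u = u + Poly_Mapping.single k c\<close>
    show ?case using has_nf_cong[OF _ cong_add_right] by (simp add: add_mset_commute)
  qed
qed

lemma has_nf: "has_nf S"
proof (induction S)
  case (add p S)
  then show ?case
    using has_nf_union[OF has_nf_pair[of "fst p" "snd p"] add] by simp
qed (rule has_nf_empty)

text \<open>Sums with equal coordinates are congruent to the same normal form at a common cut-off;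
  conversely every relation preserves coordinates.\<close>

lemma cong_iff: "cong S T \<longleftrightarrow> coord S = coord T"
proof
  assume eq: "coord S = coord T"
  from has_nf[of S] has_nf[of T] obtain N1 N2
    where N: "\<forall>N\<ge>N1. cong S (normal_form N (coord S))" "\<forall>N\<ge>N2. cong T (normal_form N (coord T))"
    by (auto simp: has_nf_def)
  from N(1)[rule_format, of "max N1 N2"] N(2)[rule_format, of "max N1 N2"] eq
  show "cong S T" by (auto intro: fsum_cong.trans fsum_cong.sym)
qed (rule coord_cong)

section \<open>The tensor product space and the action on its classes\<close>

abbreviation hs :: "(hvec \<times> hvec) multiset \<Rightarrow> (hvec \<times> hvec) multiset set" where
  "hs \<equiv> hs_sum V W"

lemma hs_def: "hs S = {T. coord T = coord S}"
  by (auto simp: hs_sum_def fsum_class_def cong_iff)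

lemma hs_eq_iff: "hs S = hs T \<longleftrightarrow> coord S = coord T"
  unfolding hs_def by auto

abbreviation HH :: "(hvec \<times> hvec) multiset set hspace" where
  "HH \<equiv> HH_space \<omega>1 \<omega>2"

lemma UN_hs:
  assumes "\<And>T. coord T = coord S \<Longrightarrow> f T = f S"
  shows "(\<Union>T\<in>hs S. f T) = f S"
proof -
  have "(\<Union>T\<in>hs S. f T) = (\<Union>T\<in>hs S. f S)"
    by (intro SUP_cong HOL.refl assms) (simp add: hs_def)
  moreover have "S \<in> hs S" by (simp add: hs_def)
  ultimately show ?thesis by blast
qed

lemma HH_carrier: "carrier HH = range hs"
  by (simp add: HH_space_def hs_tensor_def)

lemma HH_zero: "\<zero>\<^bsub>HH\<^esub> = hs {#}"
  by (simp add: HH_space_def hs_tensor_def)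

lemma HH_add: "hs S \<oplus>\<^bsub>HH\<^esub> hs T = hs (S + T)"
proof -
  have "hs S \<oplus>\<^bsub>HH\<^esub> hs T = (\<Union>S'\<in>hs S. \<Union>T'\<in>hs T. hs (S' + T'))"
    by (simp add: HH_space_def hs_tensor_def)
  also have "\<dots> = (\<Union>S'\<in>hs S. hs (S' + T))"
    by (intro SUP_cong HOL.refl UN_hs) (auto simp: hs_eq_iff intro!: ext)
  also have "\<dots> = hs (S + T)"
    by (rule UN_hs) (auto simp: hs_eq_iff intro!: ext)
  finally show ?thesis .
qed

lemma coord_smult: "coord {#(v, f \<odot>\<^bsub>W\<^esub> w). (v, w) \<in># S#} j k = f * coord S j k"
  by (induction S) (auto simp: tens_def smult_H_space lookup_map_times ring_distribs mult_ac)

lemma HH_smult: "f \<odot>\<^bsub>HH\<^esub> hs S = hs {#(v, f \<odot>\<^bsub>W\<^esub> w). (v, w) \<in># S#}"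
proof -
  have "f \<odot>\<^bsub>HH\<^esub> hs S = (\<Union>T\<in>hs S. hs {#(v, f \<odot>\<^bsub>W\<^esub> w). (v, w) \<in># T#})"
    by (simp add: HH_space_def hs_tensor_def)
  also have "\<dots> = hs {#(v, f \<odot>\<^bsub>W\<^esub> w). (v, w) \<in># S#}"
    by (rule UN_hs) (auto simp: hs_eq_iff coord_smult intro!: ext)
  finally show ?thesis .
qed

definition homog_pair :: "fr_term set \<Rightarrow> fr_term set \<Rightarrow> bool" where
  "homog_pair X' Y' \<longleftrightarrow>
    (\<exists>a b c s t. X' = sl2_class q s \<and> Y' = sl2_class q t \<and> homog_term a c s \<and> homog_term c b t)"

lemma homog_pairI: "homog_term a c s \<Longrightarrow> homog_term c b t \<Longrightarrow> homog_pair (sl2_class q s) (sl2_class q t)"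
  unfolding homog_pair_def by blast

lemma coproduct_term_homogeneous:
  assumes "(X', Y') \<in># coproduct_term q x"
  shows "homog_pair X' Y'"
  using assms
proof (induction x arbitrary: X' Y')
  case (Mul x y)
  from Mul.prems obtain X1 Y1 X2 Y2 where 1: "(X1, Y1) \<in># coproduct_term q x" "(X2, Y2) \<in># coproduct_term q y"
    and XY: "X' = X1 \<otimes>\<^bsub>FR_SL2 q\<^esub> X2" "Y' = Y1 \<otimes>\<^bsub>FR_SL2 q\<^esub> Y2"
    by auto
  from Mul.IH(1)[OF 1(1)] obtain a b c s t
    where st: "X1 = sl2_class q s" "Y1 = sl2_class q t" "homog_term a c s" "homog_term c b t"
    unfolding homog_pair_def by blast
  from Mul.IH(2)[OF 1(2)] obtain a' b' c' s' t'
    where st': "X2 = sl2_class q s'" "Y2 = sl2_class q t'" "homog_term a' c' s'" "homog_term c' b' t'"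
    unfolding homog_pair_def by blast
  show ?case
    unfolding XY st st' mult_class
    by (rule homog_pairI[OF homog_term.intros(10)[OF st(3) st'(3)] homog_term.intros(10)[OF st(4) st'(4)]])
next
  case (Add x y)
  then show ?case by auto
qed (auto simp: one_fr_term_def; rule homog_pairI; rule homog_term.intros(2-8))+

text \<open>Without such a member the union defining \<open>HH_rep\<close> would be empty.
  Reflexivity of the congruence holds only for pairs whose inner degrees match, which is why
  homogeneity was established.\<close>

lemma coproduct_term_in_coproduct: "coproduct_term q x \<in> coproduct q (sl2_class q x)"
proof -
  have "set_mset (coproduct_term q x) \<subseteq> AA_pairs q"
  proof
    fix p assume "p \<in> set_mset (coproduct_term q x)"
    then obtain X' Y' where p: "p = (X', Y')" "(X', Y') \<in># coproduct_term q x" by (cases p) auto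
    from coproduct_term_homogeneous[OF p(2)] show "p \<in> AA_pairs q"
      unfolding AA_pairs_def FR_SL2_deg_def p(1) homog_pair_def by blast
  qed
  then show ?thesis
    unfolding coproduct_def fsum_class_def using self_in_alg_class fsum_cong.refl by blast
qed

lemma HH_rep_class: "HH_rep q \<omega>1 \<omega>2 (sl2_class q x) (hs S) = hs (act x S)"
proof -
  have "HH_rep q \<omega>1 \<omega>2 (sl2_class q x) (hs S)
      = (\<Union>D\<in>coproduct q (sl2_class q x). \<Union>T\<in>hs S. hs (act_sum D T))"
    by (simp only: HH_rep_def tensor_rep_def act_sum_def)
  also have "\<dots> = (\<Union>D\<in>coproduct q (sl2_class q x). hs (act x S))"
  proof (intro SUP_cong HOL.refl)
    fix D assume D: "D \<in> coproduct q (sl2_class q x)"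
    have "(\<Union>T\<in>hs S. hs (act_sum D T)) = hs (act_sum D S)"
      by (rule UN_hs) (simp add: hs_eq_iff coord_act_sum_coproduct[OF D] coord_act)
    then show "(\<Union>T\<in>hs S. hs (act_sum D T)) = hs (act x S)"
      using coord_act_sum_coproduct[OF D] hs_eq_iff by auto
  qed
  also have "\<dots> = hs (act x S)"
    using coproduct_term_in_coproduct[of x] by blast
  finally show ?thesis .
qed

section \<open>Vectors of a fixed weight\<close>

text \<open>The coefficients stand in the right factor, where the scalars of the tensor product act,
  so \<open>g k\<close> is itself the coordinate.\<close>

definition level :: "nat \<Rightarrow> (nat \<Rightarrow> mero) \<Rightarrow> (hvec \<times> hvec) multiset" where
  "level p g = (\<Sum>k\<in>{0..p}. {#(basis_vec (p - k), Poly_Mapping.single k (g k))#})"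

lemma coord_sum: "coord (sum S I) j k = (\<Sum>i\<in>I. coord (S i) j k)"
  by (induction I rule: infinite_finite_induct) simp_all

lemma coord_level: "coord (level p g) j k = (if j + k = p then g k else 0)"
proof -
  have "coord (level p g) j k = (\<Sum>i\<in>{0..p}. if i = k then (if j = p - k then g k else 0) else 0)"
    unfolding level_def coord_sum basis_vec_def coord_single by (intro sum.cong) auto
  then show ?thesis by auto
qed

lemma level_weight_space: "hs (level p g) \<in> weight_space HH (\<omega>1 + \<omega>2 + 2 * of_nat p)"
proof -
  have "\<exists>a b. a + b = \<omega>1 + \<omega>2 + 2 * of_nat p \<and> v \<in> weight_space V a \<and> w \<in> weight_space W b"
    if vw: "(v, w) \<in># level p g" for v w
  proof -
    from vw obtain k where k: "k \<le> p" and "v = basis_vec (p - k)" "w = Poly_Mapping.single k (g k)"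
      by (auto simp: level_def set_mset_sum)
    then have "v \<in> weight_space V (\<omega>1 + 2 * of_nat (p - k))" "w \<in> weight_space W (\<omega>2 + 2 * of_nat k)"
      by (auto simp: H_space_def basis_vec_def)
    moreover have "\<omega>1 + 2 * of_nat (p - k) + (\<omega>2 + 2 * of_nat k) = \<omega>1 + \<omega>2 + 2 * of_nat p"
      using k by (simp add: of_nat_diff algebra_simps)
    ultimately show ?thesis by blast
  qed
  then show ?thesis by (auto simp: HH_space_def hs_tensor_def)
qed

definition Xi_term :: fr_term where
  "Xi_term = Con (of_real q) * MuL (mero_of (\<lambda>l. qpow q l)) * MuR (mero_of (\<lambda>m. qpow q (- m)))
      + Con (of_real (1 / q)) * MuL (mero_of (\<lambda>l. qpow q (- l))) * MuR (mero_of (\<lambda>m. qpow q m))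
      - Con (qpow q (-2)) * MuL (mero_of (\<lambda>l. qpow q (- l) * (1 - qpow q (2 * (l + 2)))))
          * MuR (mero_of (\<lambda>m. qpow q (- m) * (1 - qpow q (2 * m)))) * Gam * Beta"

lemma Xi_elem_class: "Xi_elem q = sl2_class q Xi_term"
  by (simp add: Xi_elem_def Xi_term_def)

definition total_weight :: "nat \<Rightarrow> complex" where
  "total_weight N = \<omega>1 + \<omega>2 + 2 * of_nat N"

definition phi :: "nat \<Rightarrow> mero" where
  "phi N = const_mero (qpow q (-2))
     * (shift (- total_weight N) (mero_of (\<lambda>l. qpow q (- l) * (1 - qpow q (2 * (l + 2)))))
        * mero_of (\<lambda>m. qpow q (- m) * (1 - qpow q (2 * m))))"

text \<open>On total weight t the moment maps satisfy \<lambda> = \<mu> - t, so the two exponentials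
  in \<Xi> become constants with this sum. It is the eigenvalue on vectors of level N killed by
  \<beta>.\<close>

definition Xi_const :: "nat \<Rightarrow> complex" where
  "Xi_const N = qpow q (total_weight N - 1) + qpow q (1 - total_weight N)"

lemma lam_eq_shift: "lam j k f = shift (- total_weight (j + k)) f"
  by (simp add: lam_def total_weight_def algebra_simps)

lemma has_rep_qpow: "has_rep (mero_of (\<lambda>l. qpow q l)) (\<lambda>l. qpow q l)"
  "has_rep (mero_of (\<lambda>l. qpow q (- l))) (\<lambda>l. qpow q (- l))"
  "has_rep (mero_of (\<lambda>l. qpow q (- l) * (1 - qpow q (2 * (l + 2))))) (\<lambda>l. qpow q (- l) * (1 - qpow q (2 * (l + 2))))"
  "has_rep (mero_of (\<lambda>l. qpow q (- l) * (1 - qpow q (2 * l)))) (\<lambda>l. qpow q (- l) * (1 - qpow q (2 * l)))"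
  unfolding qpow_def
  by (intro has_rep_mero_of meromorphic_intros analytic_on_imp_meromorphic_on analytic_intros)+

lemma Xi_const_eq:
  "const_mero Q * (shift (- total_weight N) (mero_of (\<lambda>l. qpow q l)) * mero_of (\<lambda>m. qpow q (- m)))
   + const_mero (1 / Q) * (shift (- total_weight N) (mero_of (\<lambda>l. qpow q (- l))) * mero_of (\<lambda>m. qpow q m))
   = const_mero (Xi_const N)"
  apply (rule has_rep_eqI)
    apply ((rule has_rep_intros has_rep_qpow)+)[1]
   apply (rule has_rep_const)
  using q_pos by (simp add: Xi_const_def qpow_simps; simp add: field_simps)

lemma coord_Xi_form:
  "coord (act (Con a * MuL f1 * MuR g1 + Con b * MuL f2 * MuR g2 - Con c * MuL f3 * MuR g3 * Gam * Beta) S) j k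
    = (const_mero a * (lam j k f1 * g1) + const_mero b * (lam j k f2 * g2)) * coord S j k
      - const_mero c * (lam j k f3 * g3) * coord_op (Mul Gam Beta) (coord S) j k"
proof -
  have "coord_op (Mul Gam Beta) (coord S) = coord (act Gam (act Beta S))"
    by (simp only: coord_act coord_op.simps)
  then show ?thesis
    by (simp add: fr_term_simps coord_act_scalar const_minus_1 ring_distribs mult_ac del: act.simps(3,4) coord_op.simps)
qed

lemma coord_Xi: "coord (act Xi_term S) j k
    = const_mero (Xi_const (j + k)) * coord S j k - phi (j + k) * coord_op (Mul Gam Beta) (coord S) j k"
  unfolding Xi_const_eq[symmetric] phi_def Xi_term_def coord_Xi_form lam_eq_shift by simp

text \<open>Since \<Xi> is \<open>Xi_const p\<close> minus \<open>phi p\<close> times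
  \<gamma>\<beta> on this level and \<gamma>\<beta> preserves the level, only the coordinates with j
  + k = p give conditions.\<close>

lemma is_eigenvector_level:
  assumes "k0 \<le> p" "g k0 \<noteq> 0"
    and "\<And>k. k \<le> p \<Longrightarrow> phi p * coord_op (Mul Gam Beta) (coord (level p g)) (p - k) k
      = (const_mero (Xi_const p) - const_mero E) * g k"
  shows "is_eigenvector HH (HH_rep q \<omega>1 \<omega>2 (Xi_elem q)) E (hs (level p g))"
proof -
  let ?L = "level p g"
  have "coord ?L (p - k0) k0 \<noteq> coord {#} (p - k0) k0"
    using assms(1,2) by (simp add: coord_level)
  then have "hs ?L \<noteq> \<zero>\<^bsub>HH\<^esub>"
    unfolding HH_zero hs_eq_iff by metis
  moreover have "coord (act Xi_term ?L) j k = const_mero E * coord ?L j k" for j k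
  proof (cases "j + k = p")
    case True
    then show ?thesis
      using assms(3)[of k] unfolding coord_Xi
      by (auto simp: coord_level algebra_simps simp del: coord_op.simps)
  next
    case False
    then have "coord_op (Mul Gam Beta) (coord ?L) j k = 0"
      by (auto simp: coord_level split: nat.split)
    with False show ?thesis unfolding coord_Xi by (simp add: coord_level del: coord_op.simps)
  qed
  then have "HH_rep q \<omega>1 \<omega>2 (Xi_elem q) (hs ?L) = const_mero E \<odot>\<^bsub>HH\<^esub> hs ?L"
    unfolding Xi_elem_class HH_rep_class HH_smult hs_eq_iff by (intro ext) (simp add: coord_smult)
  ultimately show ?thesis
    by (simp add: is_eigenvector_def HH_carrier)
qed

lemma has_rep_phi: "has_rep (phi N) (\<lambda>z. qpow q (total_weight N)
     * (1 - Q ^ 4 * X z / (qpow q (total_weight N))\<^sup>2) * (1 - X z) / (Q\<^sup>2 * X z))"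
proof (rule has_rep_cong)
  show "has_rep (phi N) (\<lambda>z. qpow q (- 2) * (qpow q (- (z + - total_weight N)) * (1 - qpow q (2 * (z + - total_weight N + 2)))
      * (qpow q (- z) * (1 - qpow q (2 * z)))))"
    unfolding phi_def by (rule has_rep_intros has_rep_qpow)+
next
  have "qpow q (- 2) * (qpow q (- (z + - total_weight N)) * (1 - qpow q (2 * (z + - total_weight N + 2)))
      * (qpow q (- z) * (1 - qpow q (2 * z)))) = qpow q (total_weight N)
     * (1 - Q ^ 4 * X z / (qpow q (total_weight N))\<^sup>2) * (1 - X z) / (Q\<^sup>2 * X z)" for z
    using q_pos by (simp add: qpow_simps; simp add: field_simps eval_nat_numeral)
  then show "\<forall>\<^sub>\<approx>z. qpow q (- 2) * (qpow q (- (z + - total_weight N)) * (1 - qpow q (2 * (z + - total_weight N + 2)))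
      * (qpow q (- z) * (1 - qpow q (2 * z)))) = qpow q (total_weight N)
     * (1 - Q ^ 4 * X z / (qpow q (total_weight N))\<^sup>2) * (1 - X z) / (Q\<^sup>2 * X z)"
    by simp
qed

lemma total_weight_Suc: "qpow q (total_weight (Suc N)) = Q\<^sup>2 * qpow q (total_weight N)"
proof -
  have "total_weight (Suc N) = 2 + total_weight N" by (simp add: total_weight_def)
  then show ?thesis using q_pos by (simp only: qpow_add qpow_numeral)
qed

lemma X_total_weight: "X (z + - total_weight N) = X z / (qpow q (total_weight N))\<^sup>2"
  by (simp add: qpow_simps field_simps)

text \<open>Multiplication by \<open>\<phi>\<close> turns an eigenvalue of \<open>\<gamma>\<beta>\<close> into one of \<open>\<Xi>\<close>. The next two
  identities express that \<open>\<Xi>\<close> commutes with \<open>\<gamma>\<close>.\<close>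

lemma phi_recursion:
  "phi (Suc N) * shift (- 1) (shift (- total_weight N) pF - pF)
     = const_mero (Xi_const (Suc N)) - const_mero (Xi_const N)" (is ?A)
  "phi (Suc N) * shift (- 1) (shift (- total_weight N) pF * nF) = shift (- 1) (phi N)" (is ?B)
proof -
  let ?u = "qpow q (total_weight N)"
  have ev: "eventually (\<lambda>z. 1 - 1 * X z \<noteq> 0) (cosparse UNIV)" "eventually (\<lambda>z. ?u\<^sup>2 - 1 * X z \<noteq> 0) (cosparse UNIV)"
    by (rule eventually_X_neq, simp)+
  have Xi: "Xi_const N = ?u / Q + Q / ?u" "Xi_const (Suc N) = Q * ?u + 1 / (Q * ?u)"
    unfolding Xi_const_def qpow_diff total_weight_Suc
    using q_pos by (simp_all add: qpow_1 field_simps eval_nat_numeral)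
  show ?A
    apply (rule has_rep_eqI)
      apply ((rule has_rep_mult has_rep_phi has_rep_shift has_rep_diff has_rep_pF)+)[1]
     apply ((rule has_rep_diff has_rep_const)+)[1]
    using ev
  proof eventually_elim
    case (elim z)
    then show ?case
      unfolding X_total_weight X_shift total_weight_Suc Xi ratp_def
      using q_pos by (simp add: divide_simps; simp add: algebra_simps eval_nat_numeral)
  qed
  show ?B
    apply (rule has_rep_eqI)
      apply ((rule has_rep_mult has_rep_phi has_rep_shift has_rep_pF has_rep_nF)+)[1]
     apply ((rule has_rep_shift has_rep_phi)+)[1]
    using ev
  proof eventually_elim
    case (elim z)
    then show ?case
      unfolding X_total_weight X_shift total_weight_Suc ratp_def
      using q_pos by (simp add: divide_simps; simp add: algebra_simps eval_nat_numeral)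
  qed
qed

text \<open>There are n equations for n + 1 unknowns. If \<open>x n\<close> is nonzero the next
  entry can be solved for; otherwise the unit vector at n + 1 is a solution.\<close>

lemma two_term_recursion:
  fixes x y :: "nat \<Rightarrow> 'a :: field"
  shows "\<exists>g. (\<exists>k\<le>n. g k \<noteq> 0) \<and> (\<forall>k<n. x k * g (Suc k) + y k * g k = 0)"
proof (induction n)
  case 0
  show ?case by (intro exI[of _ "\<lambda>_. 1"]) simp
next
  case (Suc n)
  show ?case
  proof (cases "x n = 0")
    case True
    then show ?thesis
      by (intro exI[of _ "\<lambda>k. if k = Suc n then 1 else 0"]) (auto simp: less_Suc_eq)
  next
    case False
    from Suc obtain g where g: "\<exists>k\<le>n. g k \<noteq> 0" "\<forall>k<n. x k * g (Suc k) + y k * g k = 0" by blast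
    let ?g = "g(Suc n := - y n * g n / x n)"
    from g(1) obtain k where "k \<le> n" "g k \<noteq> 0" by blast
    then have "\<exists>k\<le>Suc n. ?g k \<noteq> 0" by (intro exI[of _ k]) auto
    moreover have "\<forall>k<Suc n. x k * ?g (Suc k) + y k * ?g k = 0"
      using g(2) False by (auto simp: less_Suc_eq)
    ultimately show ?thesis by blast
  qed
qed

lemma H_D_nonzero: "H_D q k \<noteq> 0"
proof
  assume "H_D q k = 0"
  with has_rep_H_D[of k] have "has_rep 0 (\<lambda>z. ratD Q (Q ^ k) (X z))" by simp
  from eventually_eq_if_has_rep[OF this has_rep_0]
  have "eventually (\<lambda>z. ratD Q (Q ^ k) (X z) = 0) (cosparse UNIV)" .
  moreover have "eventually (\<lambda>z. (Q ^ k)\<^sup>2 - Q\<^sup>2 * X z \<noteq> 0) (cosparse UNIV)" "eventually (\<lambda>z. 1 - Q\<^sup>2 * X z \<noteq> 0) (cosparse UNIV)"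
    using Q_nonzero by (intro eventually_X_neq; simp)+
  ultimately have "eventually (\<lambda>z. False) (cosparse (UNIV :: complex set))"
    by eventually_elim (use Q_nonzero in \<open>auto simp: ratD_def\<close>)
  then show False by (simp add: eventually_False)
qed

text \<open>The counterpart of \<open>lookup_BC\<close> on the tensor product. Applying \<gamma> to
  it computes \<gamma>\<beta> on \<gamma>v from \<gamma>\<beta> on v.\<close>

lemma coord_op_beta_gamma:
  "coord_op (Mul Beta Gam) (coord S) j k
    = (lam j k pF - pF) * coord S j k + lam j k pF * nF * coord_op (Mul Gam Beta) (coord S) j k"
proof -
  have "coord (act (Mul Beta Gam) S) j k
      = (lam j k pF - pF) * coord S j k + lam j k pF * nF * coord (act (Mul Gam Beta) S) j k"
  proof (induction S)
    case (add p S)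
    obtain v w where p: "p = (v, w)" by fastforce
    have "act x (add_mset p S) = act x {#(v, w)#} + act x S" for x
      using act_union[of x "{#p#}" S] p by simp
    moreover have "coord (act (Mul Beta Gam) {#(v, w)#}) j k
      = (lam j k pF - pF) * coord {#(v, w)#} j k + lam j k pF * nF * coord (act (Mul Gam Beta) {#(v, w)#}) j k"
      by (simp add: tens_left tens_right ring_distribs; simp add: pF_nF algebra_simps)
    ultimately show ?case
      using add by (simp add: p ring_distribs del: act.simps)
  qed simp
  then show ?thesis by (simp only: coord_act)
qed

text \<open>Injectivity of \<gamma> is triangularity: the highest nonzero coordinate is moved up by
  one, with a nonzero factor.\<close>

lemma gamma_level:
  obtains g' where "coord_op Gam (coord (level p g)) = coord (level (Suc p) g')"
    and "(\<exists>k\<le>p. g k \<noteq> 0) \<Longrightarrow> (\<exists>k\<le>Suc p. g' k \<noteq> 0)"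
proof
  let ?g = "\<lambda>k. coord_op Gam (coord (level p g)) (Suc p - k) k"
  show "coord_op Gam (coord (level p g)) = coord (level (Suc p) ?g)"
  proof (intro ext)
    fix j k
    show "coord_op Gam (coord (level p g)) j k = coord (level (Suc p) ?g) j k"
    proof (cases "j + k = Suc p")
      case True
      then have "j = Suc p - k" by simp
      with True show ?thesis by (simp add: coord_level del: coord_op.simps)
    next
      case False
      then show ?thesis by (auto simp: coord_level split: nat.split)
    qed
  qed
  assume "\<exists>k\<le>p. g k \<noteq> 0"
  define m where "m = Max {k. k \<le> p \<and> g k \<noteq> 0}"
  have fin: "finite {k. k \<le> p \<and> g k \<noteq> 0}" by simp
  have "m \<in> {k. k \<le> p \<and> g k \<noteq> 0}"
    unfolding m_def using \<open>\<exists>k\<le>p. g k \<noteq> 0\<close> by (intro Max_in fin) auto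
  moreover have "g (Suc m) = 0" if "Suc m \<le> p"
  proof (rule ccontr)
    assume "g (Suc m) \<noteq> 0"
    with that have "Suc m \<le> m" unfolding m_def by (intro Max_ge fin) simp
    then show False by simp
  qed
  ultimately have m: "m \<le> p" "g m \<noteq> 0" "Suc m \<le> p \<Longrightarrow> g (Suc m) = 0" by auto
  have C0: "C0 \<noteq> 0" using Q_nonzero by (simp add: C0_def)
  \<comment> \<open>Only \<delta> \<otimes> \<gamma> contributes at \<open>Suc m\<close>: the term
    from \<gamma> \<otimes> \<alpha> would contain the entry after the last nonzero one.\<close>
  have "?g (Suc m) = rho (Suc m) (H_D q (p - m)) * C0 * shift (- 1) (g m)"
    using m by (cases "p - m") (auto simp: coord_level simp del: lam_shift)
  then have "?g (Suc m) \<noteq> 0"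
    using m(2) C0 H_D_nonzero by simp
  with m(1) show "\<exists>k\<le>Suc p. ?g k \<noteq> 0"
    by (intro exI[of _ "Suc m"]) (simp del: coord_op.simps)
qed

lemma gamma_semilinear:
  assumes "\<And>j k. j + k = p \<Longrightarrow> \<Psi>' j k = e * \<Psi> j k" "\<And>j k. j + k \<noteq> p \<Longrightarrow> \<Psi>' j k = 0 \<and> \<Psi> j k = 0"
  shows "coord_op Gam \<Psi>' j k = shift (- 1) e * coord_op Gam \<Psi> j k"
proof -
  have "\<Psi>' j k = e * \<Psi> j k" for j k using assms by (cases "j + k = p") auto
  then show ?thesis by (simp add: shift_mult ring_distribs mult_ac split: nat.split)
qed

text \<open>The eigenvalue \<open>e\<close> of \<gamma>\<beta> is a meromorphic function; only its
  product with \<open>phi p\<close> is tied to constants, and the induction carries that product.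
  The kernel of \<beta> at level y gives e = 0, and \<gamma>\<beta>\<gamma> =
  \<gamma>(\<beta>\<gamma>) gives the next \<open>e\<close>.\<close>

lemma exists_eigenvector:
  assumes "y \<le> p"
  shows "\<exists>g e. (\<exists>k\<le>p. g k \<noteq> 0)
    \<and> coord_op (Mul Gam Beta) (coord (level p g)) = (\<lambda>j k. e * coord (level p g) j k)
    \<and> phi p * e = const_mero (Xi_const p) - const_mero (Xi_const y)"
  using assms
proof (induction p rule: dec_induct)
  case base
  from two_term_recursion[of y "\<lambda>k. rho k (H_A q \<omega>1 (y - Suc k)) * H_B q \<omega>2 (Suc k)"
      "\<lambda>k. rho k (H_B q \<omega>1 (y - k)) * H_D q k"]
  obtain g where g: "\<exists>k\<le>y. g k \<noteq> 0"
    "\<forall>k<y. rho k (H_A q \<omega>1 (y - Suc k)) * H_B q \<omega>2 (Suc k) * g (Suc k) + rho k (H_B q \<omega>1 (y - k)) * H_D q k * g k = 0"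
    by blast
  \<comment> \<open>Since \<beta> applies T_1 to every coefficient, the solution is translated back
    beforehand.\<close>
  define h where "h = (\<lambda>k. shift (- 1) (g k))"
  have "coord_op Beta (coord (level y h)) j k = 0" for j k
  proof (cases "Suc (j + k) = y")
    case True
    then have "j = y - Suc k" "Suc j = y - k" "k < y" by auto
    with g(2) True show ?thesis by (simp add: coord_level h_def)
  next
    case False
    then show ?thesis by (simp add: coord_level)
  qed
  then have "coord_op (Mul Gam Beta) (coord (level y h)) = (\<lambda>j k. 0 * coord (level y h) j k)"
    by (intro ext) (simp del: coord_op.simps add: coord_op.simps(4,9) split: nat.split)
  moreover have "\<exists>k\<le>y. h k \<noteq> 0" using g(1) by (simp add: h_def)
  ultimately show ?case by (intro exI[of _ h] exI[of _ 0]) (simp del: coord_op.simps)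
next
  case (step p)
  then obtain g e where g: "\<exists>k\<le>p. g k \<noteq> 0"
    "coord_op (Mul Gam Beta) (coord (level p g)) = (\<lambda>j k. e * coord (level p g) j k)"
    and e: "phi p * e = const_mero (Xi_const p) - const_mero (Xi_const y)" by blast
  obtain g' where g': "coord_op Gam (coord (level p g)) = coord (level (Suc p) g')" "\<exists>k\<le>Suc p. g' k \<noteq> 0"
    using gamma_level[of p g] g(1) by metis
  define P where "P = shift (- total_weight p) pF"
  let ?e = "shift (- 1) (P - pF) + shift (- 1) (P * nF) * shift (- 1) e"
  have "coord_op (Mul Beta Gam) (coord (level p g)) j k = ((P - pF) + P * nF * e) * coord (level p g) j k"
    if "j + k = p" for j k
    unfolding coord_op_beta_gamma g(2) lam_eq_shift that P_def[symmetric] by (simp add: algebra_simps)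
  moreover have "coord_op (Mul Beta Gam) (coord (level p g)) j k = 0 \<and> coord (level p g) j k = 0"
    if "j + k \<noteq> p" for j k
    unfolding coord_op_beta_gamma g(2) using that by (simp add: coord_level)
  ultimately have "coord_op Gam (coord_op (Mul Beta Gam) (coord (level p g))) j k
      = shift (- 1) ((P - pF) + P * nF * e) * coord_op Gam (coord (level p g)) j k" for j k
    by (rule gamma_semilinear)
  moreover have "coord_op Gam (coord_op (Mul Beta Gam) (coord (level p g)))
      = coord_op (Mul Gam Beta) (coord (level (Suc p) g'))"
    by (simp only: coord_op.simps(9) g'(1))
  ultimately have "coord_op (Mul Gam Beta) (coord (level (Suc p) g')) = (\<lambda>j k. ?e * coord (level (Suc p) g') j k)"
    by (intro ext) (simp only: g'(1) shift_add shift_mult)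
  moreover have "phi (Suc p) * ?e = const_mero (Xi_const (Suc p)) - const_mero (Xi_const y)"
  proof -
    have "phi (Suc p) * ?e = phi (Suc p) * shift (- 1) (P - pF) + (phi (Suc p) * shift (- 1) (P * nF)) * shift (- 1) e"
      by (simp only: ring_distribs mult.assoc)
    also have "\<dots> = const_mero (Xi_const (Suc p)) - const_mero (Xi_const p) + shift (- 1) (phi p * e)"
      unfolding P_def phi_recursion by (simp only: shift_mult)
    also have "\<dots> = const_mero (Xi_const (Suc p)) - const_mero (Xi_const y)"
      by (simp add: e shift_diff)
    finally show ?thesis .
  qed
  ultimately show ?case using g'(2) by blast
qed

lemma Xi_const_eigenvalue: "Xi_const y = Xi_eigenvalue q \<omega>1 \<omega>2 y"
  by (simp add: Xi_const_def Xi_eigenvalue_def total_weight_def algebra_simps)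

lemma exists_Xi_eigenvector:
  assumes "y \<le> p"
  shows "\<exists>v\<in>weight_space HH (\<omega>1 + \<omega>2 + 2 * of_nat p).
    is_eigenvector HH (HH_rep q \<omega>1 \<omega>2 (Xi_elem q)) (Xi_eigenvalue q \<omega>1 \<omega>2 y) v"
proof -
  from exists_eigenvector[OF assms] obtain g e k0 where k0: "k0 \<le> p" "g k0 \<noteq> 0"
    and g: "coord_op (Mul Gam Beta) (coord (level p g)) = (\<lambda>j k. e * coord (level p g) j k)"
    and e: "phi p * e = const_mero (Xi_const p) - const_mero (Xi_const y)" by blast
  have "is_eigenvector HH (HH_rep q \<omega>1 \<omega>2 (Xi_elem q)) (Xi_const y) (hs (level p g))"
  proof (rule is_eigenvector_level[of k0 p g, OF k0])
    fix k assume "k \<le> p"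
    then show "phi p * coord_op (Mul Gam Beta) (coord (level p g)) (p - k) k
        = (const_mero (Xi_const p) - const_mero (Xi_const y)) * g k"
      unfolding g e[symmetric] by (simp add: coord_level)
  qed
  then show ?thesis
    using level_weight_space unfolding Xi_const_eigenvalue by blast
qed

end

section \<open>The recurrence relation of the q-Racah polynomials\<close>

context
  fixes a b c d Q :: "'a :: field"
begin

text \<open>The degree \<open>n\<close> enters through \<open>N = q\<^sup>n\<close> and the variable \<open>x\<close> through \<open>s = q\<^sup>-\<^sup>x\<close> and \<open>t = cdq\<^sup>x\<^sup>+\<^sup>1\<close>.\<close>

definition racah_num :: "nat \<Rightarrow> 'a \<Rightarrow> 'a" where
  "racah_num i N = (\<Prod>m<i. (1 - Q ^ m / N) * (1 - a * b * Q * N * Q ^ m))"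

text \<open>With N = q^n, \<open>racah_A\<close> and \<open>racah_C\<close> are the standard
  coefficients A_n and C_n of (1 - q^(-x))(1 - c d q^(x+1)) R_n + A_n (R_(n+1) - R_n) + C_n (R_(n-1)
  - R_n) = 0.\<close>

definition racah_A :: "'a \<Rightarrow> 'a" where
  "racah_A N = (1 - a * b * Q * N) * (1 - a * Q * N) * (1 - b * d * Q * N) * (1 - c * Q * N)
     / ((1 - a * b * Q * N\<^sup>2) * (1 - a * b * Q\<^sup>2 * N\<^sup>2))"

definition racah_C :: "'a \<Rightarrow> 'a" where
  "racah_C N = Q * (1 - N) * (1 - b * N) * (c - a * b * N) * (d - a * N)
     / ((1 - a * b * N\<^sup>2) * (1 - a * b * Q * N\<^sup>2))"

text \<open>In the bracket on the left the constant and the cubic terms in \<open>I\<close> cancel,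
  so the left side is linear in \<open>I\<close>. The right side is its interpolation between I = Q
  N and I = 1 / (a b N), where its two terms vanish in turn.\<close>

lemma racah_core:
  assumes "N \<noteq> 0" "Q \<noteq> 0" "I \<noteq> 0" "1 - a * b * Q * N\<^sup>2 \<noteq> 0"
  shows "((1 - a * I) * (1 - b * d * I) * (1 - c * I) - (1 - I / (Q * N)) * (1 - a * b * N * I) * (1 - c * d * Q * I)) / I
     = (1 - a * Q * N) * (1 - b * d * Q * N) * (1 - c * Q * N) * (1 - a * b * N * I) / (Q * N * (1 - a * b * Q * N\<^sup>2))
       + Q * (1 - b * N) * (c - a * b * N) * (d - a * N) * (1 - I / (Q * N)) / (1 - a * b * Q * N\<^sup>2)"
  using assms by (simp add: divide_simps; simp add: algebra_simps eval_nat_numeral)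

lemma racah_num_Suc: "racah_num (Suc j) N = racah_num j N * ((1 - Q ^ j / N) * (1 - a * b * Q * N * Q ^ j))"
  by (simp add: racah_num_def)

text \<open>Replacing N by Q N moves one of the two products a step down and the other a step up.
  All factors but the outermost are common, and the difference of the outer ones factors.\<close>

lemma racah_num_diff:
  assumes "N \<noteq> 0" "Q \<noteq> 0"
  shows "racah_num (Suc j) (Q * N) - racah_num (Suc j) N
     = (Q ^ Suc j - 1) * (1 - a * b * Q\<^sup>2 * N\<^sup>2) / (Q * N) * (\<Prod>m<j. (1 - Q ^ m / N) * (1 - a * b * Q\<^sup>2 * N * Q ^ m))"
proof -
  let ?Y = "(\<Prod>m<j. 1 - Q ^ m / N) * (\<Prod>m<j. 1 - a * b * Q\<^sup>2 * N * Q ^ m)"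
  have 1: "racah_num (Suc j) (Q * N) = ((1 - 1 / (Q * N)) * (1 - a * b * Q\<^sup>2 * N * Q ^ j)) * ?Y"
  proof -
    have "(\<Prod>m<Suc j. 1 - Q ^ m / (Q * N)) = (1 - 1 / (Q * N)) * (\<Prod>m<j. 1 - Q ^ m / N)"
      by (subst prod.lessThan_Suc_shift) (use assms in simp)
    moreover have "(\<Prod>m<Suc j. 1 - a * b * Q * (Q * N) * Q ^ m)
        = (\<Prod>m<j. 1 - a * b * Q\<^sup>2 * N * Q ^ m) * (1 - a * b * Q\<^sup>2 * N * Q ^ j)"
      by (simp add: power2_eq_square mult_ac)
    ultimately show ?thesis unfolding racah_num_def prod.distrib by (simp only: mult_ac)
  qed
  have 2: "racah_num (Suc j) N = ((1 - Q ^ j / N) * (1 - a * b * Q * N)) * ?Y"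
  proof -
    have "(\<Prod>m<Suc j. 1 - a * b * Q * N * Q ^ m) = (1 - a * b * Q * N) * (\<Prod>m<j. 1 - a * b * Q\<^sup>2 * N * Q ^ m)"
      by (subst prod.lessThan_Suc_shift) (simp add: power2_eq_square mult_ac)
    moreover have "(\<Prod>m<Suc j. 1 - Q ^ m / N) = (\<Prod>m<j. 1 - Q ^ m / N) * (1 - Q ^ j / N)"
      by simp
    ultimately show ?thesis unfolding racah_num_def prod.distrib by (simp only: mult_ac)
  qed
  have "(1 - 1 / (Q * N)) * (1 - a * b * Q\<^sup>2 * N * Q ^ j) - (1 - Q ^ j / N) * (1 - a * b * Q * N)
      = (Q ^ Suc j - 1) * (1 - a * b * Q\<^sup>2 * N\<^sup>2) / (Q * N)"
    using assms by (simp add: divide_simps; simp add: algebra_simps eval_nat_numeral)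
  then show ?thesis
    unfolding 1 2 prod.distrib by (simp only: left_diff_distrib[symmetric])
qed

text \<open>Comparison of coefficients of the recurrence in \<open>racah_basis\<close>: the first
  term stems from index j, the others from index j + 1, after common denominators are
  removed.\<close>

lemma racah_coeff:
  fixes j :: nat
  assumes nz: "N \<noteq> 0" "Q \<noteq> 0" "1 - a * b * N\<^sup>2 \<noteq> 0" "1 - a * b * Q * N\<^sup>2 \<noteq> 0" "1 - a * b * Q\<^sup>2 * N\<^sup>2 \<noteq> 0"
  defines "I \<equiv> Q ^ Suc j"
  shows "racah_num j N * ((1 - I) * (1 - a * I) * (1 - b * d * I) * (1 - c * I)) / I
      + racah_A N * (racah_num (Suc j) (Q * N) - racah_num (Suc j) N)
      + racah_C N * (racah_num (Suc j) (N / Q) - racah_num (Suc j) N)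
    = racah_num (Suc j) N * (1 - I) * (1 - c * d * Q * I) / I"
proof -
  define A' where "A' = (1 - a * Q * N) * (1 - b * d * Q * N) * (1 - c * Q * N) / (1 - a * b * Q * N\<^sup>2)"
  define C' where "C' = (1 - b * N) * (c - a * b * N) * (d - a * N) / (1 - a * b * Q * N\<^sup>2)"
  define g where "g = (1 - a * I) * (1 - b * d * I) * (1 - c * I)"
  define h where "h = 1 - c * d * Q * I"
  define Y where "Y = (\<Prod>m<j. (1 - Q ^ m / N) * (1 - a * b * Q\<^sup>2 * N * Q ^ m))"
  define Y' where "Y' = (\<Prod>m<j. (1 - Q ^ m / (N / Q)) * (1 - a * b * Q\<^sup>2 * (N / Q) * Q ^ m))"
  have I: "I \<noteq> 0" using nz by (simp add: I_def)
  \<comment> \<open>\<open>E1\<close> and \<open>E2\<close> each cancel one denominator of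
    \<open>racah_A\<close> and \<open>racah_C\<close>, which leaves both with the denominator of
    \<open>racah_core\<close>.\<close>
  define E1 where "E1 = 1 - a * b * Q\<^sup>2 * N\<^sup>2"
  define E2 where "E2 = 1 - a * b * N\<^sup>2"
  have A: "racah_A N * (racah_num (Suc j) (Q * N) - racah_num (Suc j) N)
      = - (1 - I) * ((1 - a * b * Q * N) * A' / (Q * N) * Y)"
  proof -
    have "racah_num (Suc j) (Q * N) - racah_num (Suc j) N = E1 * (- (1 - I) / (Q * N) * Y)"
      using racah_num_diff[OF nz(1,2), of j] unfolding I_def Y_def E1_def by (simp add: mult_ac)
    moreover have "racah_A N * E1 = (1 - a * b * Q * N) * A'"
      using nz by (simp add: racah_A_def A'_def E1_def)
    ultimately show ?thesis by (simp only: mult.assoc[symmetric]) simp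
  qed
  have C: "racah_C N * (racah_num (Suc j) (N / Q) - racah_num (Suc j) N)
      = (1 - I) * (Q * (1 - N) * C' / N * Y')"
  proof -
    have "racah_num (Suc j) (N / Q) - racah_num (Suc j) N = - (racah_num (Suc j) N - racah_num (Suc j) (N / Q))"
      by simp
    also have "\<dots> = E2 * ((1 - I) / N * Y')"
      using racah_num_diff[of "N / Q" j] nz unfolding I_def Y'_def E2_def
      by (simp add: power_divide) (simp add: divide_simps; simp add: algebra_simps)
    finally have 1: "racah_num (Suc j) (N / Q) - racah_num (Suc j) N = E2 * ((1 - I) / N * Y')" .
    have 2: "racah_C N * E2 = Q * (1 - N) * C'"
      using nz by (simp add: racah_C_def C'_def E2_def)
    show ?thesis unfolding 1 mult.assoc[symmetric] 2 by simp
  qed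
  have core: "(g - (1 - I / (Q * N)) * (1 - a * b * N * I) * h) / I
     = A' * (1 - a * b * N * I) / (Q * N) + Q * C' * (1 - I / (Q * N))"
    using racah_core[of N I] nz I unfolding A'_def C'_def g_def h_def by (simp add: mult_ac)
  have "racah_num j N * g / I - (1 - a * b * Q * N) * A' / (Q * N) * Y + Q * (1 - N) * C' / N * Y'
      = racah_num (Suc j) N * h / I"
  \<comment> \<open>For positive j the three products share a factor \<open>Z\<close> with j - 1
    steps, and dividing by it leaves \<open>racah_core\<close>. For j = 0 there is nothing to split
    off.\<close>
  proof (cases j)
    case 0
    then show ?thesis
      using core nz unfolding Y_def Y'_def
      by (simp add: I_def racah_num_def) (simp add: field_simps)
  next
    case (Suc i)
    define Z where "Z = (\<Prod>m<i. 1 - Q ^ Suc m / N) * (\<Prod>m<i. 1 - a * b * Q\<^sup>2 * N * Q ^ m)"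
    have Q: "Q ^ Suc i = I / Q" "a * b * Q\<^sup>2 * N * Q ^ i = a * b * N * I"
      using nz by (simp_all add: I_def Suc power2_eq_square mult_ac)
    have n0: "racah_num j N = (1 - 1 / N) * (1 - a * b * Q * N) * Z"
    proof -
      have "(\<Prod>m<Suc i. 1 - Q ^ m / N) = (1 - 1 / N) * (\<Prod>m<i. 1 - Q ^ Suc m / N)"
        by (subst prod.lessThan_Suc_shift) simp
      moreover have "(\<Prod>m<Suc i. 1 - a * b * Q * N * Q ^ m) = (1 - a * b * Q * N) * (\<Prod>m<i. 1 - a * b * Q\<^sup>2 * N * Q ^ m)"
        by (subst prod.lessThan_Suc_shift) (simp add: power2_eq_square mult_ac)
      ultimately show ?thesis unfolding Suc racah_num_def prod.distrib Z_def by (simp only: mult_ac)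
    qed
    have n1: "racah_num (Suc j) N = racah_num j N * ((1 - I / (Q * N)) * (1 - a * b * N * I))"
      using Q nz unfolding racah_num_Suc Suc by (simp add: power2_eq_square mult_ac)
    have Y: "Y = (1 - 1 / N) * (1 - a * b * N * I) * Z"
    proof -
      have "(\<Prod>m<Suc i. 1 - Q ^ m / N) = (1 - 1 / N) * (\<Prod>m<i. 1 - Q ^ Suc m / N)"
        by (subst prod.lessThan_Suc_shift) simp
      moreover have "(\<Prod>m<Suc i. 1 - a * b * Q\<^sup>2 * N * Q ^ m) = (\<Prod>m<i. 1 - a * b * Q\<^sup>2 * N * Q ^ m) * (1 - a * b * N * I)"
        by (simp add: Q)
      ultimately show ?thesis unfolding Suc Y_def prod.distrib Z_def by (simp only: mult_ac)
    qed
    have Y': "Y' = (1 - I / (Q * N)) * (1 - a * b * Q * N) * Z"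
    proof -
      have "(\<Prod>m<Suc i. 1 - Q ^ m / (N / Q)) = (\<Prod>m<i. 1 - Q ^ Suc m / N) * (1 - I / (Q * N))"
        using Q(1) nz by (simp add: mult_ac)
      moreover have "(\<Prod>m<Suc i. 1 - a * b * Q\<^sup>2 * (N / Q) * Q ^ m) = (1 - a * b * Q * N) * (\<Prod>m<i. 1 - a * b * Q\<^sup>2 * N * Q ^ m)"
        by (subst prod.lessThan_Suc_shift) (use nz in \<open>simp add: power2_eq_square mult_ac\<close>)
      ultimately show ?thesis unfolding Suc Y'_def prod.distrib Z_def by (simp only: mult_ac)
    qed
    define k where "k = (1 - 1 / N) * (1 - a * b * Q * N) * Z"
    have "racah_num j N * g / I - (1 - a * b * Q * N) * A' / (Q * N) * Y + Q * (1 - N) * C' / N * Y' - racah_num (Suc j) N * h / I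
      = k * ((g - (1 - I / (Q * N)) * (1 - a * b * N * I) * h) / I
          - (A' * (1 - a * b * N * I) / (Q * N) + Q * C' * (1 - I / (Q * N))))"
      unfolding n1 n0 Y Y' k_def using nz I by (simp add: divide_simps; simp add: algebra_simps)
    then show ?thesis unfolding core by simp
  qed
  then have main: "(1 - I) * (racah_num j N * g / I) + - (1 - I) * ((1 - a * b * Q * N) * A' / (Q * N) * Y)
      + (1 - I) * (Q * (1 - N) * C' / N * Y') = (1 - I) * (racah_num (Suc j) N * h / I)" (is "_ * ?E + _ * ?F + _ * ?G = _")
  proof -
    assume *: "?E - ?F + ?G = racah_num (Suc j) N * h / I"
    have "x * e + - x * f + x * k = x * (e - f + k)" for x e f k :: 'a
      by (simp add: algebra_simps)
    then show ?thesis by (simp only: *)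
  qed
  have "racah_num j N * ((1 - I) * (1 - a * I) * (1 - b * d * I) * (1 - c * I)) / I = (1 - I) * (racah_num j N * g / I)"
    "racah_num (Suc j) N * (1 - I) * (1 - c * d * Q * I) / I = (1 - I) * (racah_num (Suc j) N * h / I)"
    by (simp_all add: g_def h_def mult_ac)
  with main show ?thesis unfolding A C by (simp only:)
qed

definition racah_den :: "nat \<Rightarrow> 'a" where
  "racah_den i = (\<Prod>m<i. (1 - Q ^ Suc m) * (1 - a * Q ^ Suc m) * (1 - b * d * Q ^ Suc m) * (1 - c * Q ^ Suc m))"

definition racah_basis :: "'a \<Rightarrow> 'a \<Rightarrow> nat \<Rightarrow> 'a" where
  "racah_basis s t i = (\<Prod>m<i. (1 - s * Q ^ m) * (1 - t * Q ^ m))"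

text \<open>The cut-off \<open>M\<close> is kept apart from the degree, so that neighbouring degrees
  are sums over the same range.\<close>

definition racah_sum :: "'a \<Rightarrow> 'a \<Rightarrow> nat \<Rightarrow> 'a \<Rightarrow> 'a" where
  "racah_sum s t M N = (\<Sum>i\<le>M. racah_num i N * racah_basis s t i / racah_den i * Q ^ i)"

text \<open>Multiplication by (1 - s)(1 - t) sends a basis element to a combination of itself and
  the next one, so the defect of a partial sum is a single term. By \<open>racah_coeff\<close> it
  turns into the next defect when M grows.\<close>

lemma racah_partial_sum:
  assumes nz: "N \<noteq> 0" "Q \<noteq> 0" "1 - a * b * N\<^sup>2 \<noteq> 0" "1 - a * b * Q * N\<^sup>2 \<noteq> 0" "1 - a * b * Q\<^sup>2 * N\<^sup>2 \<noteq> 0"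
    and st: "s * t = c * d * Q" and den: "racah_den M \<noteq> 0"
  shows "(1 - s) * (1 - t) * racah_sum s t M N + racah_A N * (racah_sum s t M (Q * N) - racah_sum s t M N)
      + racah_C N * (racah_sum s t M (N / Q) - racah_sum s t M N)
    = racah_num M N * racah_basis s t (Suc M) / racah_den M"
  using den
proof (induction M)
  case 0
  show ?case by (simp add: racah_sum_def racah_num_def racah_basis_def racah_den_def)
next
  case (Suc M)
  define I where "I = Q ^ Suc M"
  define f where "f = (1 - I) * (1 - a * I) * (1 - b * d * I) * (1 - c * I)"
  define \<theta> where "\<theta> = (1 - s) * (1 - t)"
  define \<phi> where "\<phi> = racah_basis s t (Suc M)"
  define D where "D = racah_den M"
  have den: "racah_den (Suc M) = D * f" by (simp add: racah_den_def f_def I_def D_def)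
  with Suc.prems have Df: "D \<noteq> 0" "f \<noteq> 0" by auto
  have I: "I \<noteq> 0" using nz by (simp add: I_def)
  \<comment> \<open>As \<open>s * t\<close> is fixed, the next factor of the basis depends on s and
    t only through \<theta>.\<close>
  have basis: "racah_basis s t (Suc (Suc M)) = \<phi> * ((1 - I) * (1 - c * d * Q * I) + I * \<theta>)"
  proof -
    have "(1 - s * I) * (1 - t * I) = 1 - (s + t) * I + s * t * I * I" by (simp add: algebra_simps)
    also have "\<dots> = (1 - I) * (1 - s * t * I) + I * \<theta>" by (simp add: \<theta>_def algebra_simps)
    finally show ?thesis unfolding \<phi>_def st by (simp add: racah_basis_def I_def)
  qed
  have sum: "racah_sum s t (Suc M) n = racah_sum s t M n + racah_num (Suc M) n * \<phi> / (D * f) * I" for n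
    by (simp add: racah_sum_def den \<phi>_def I_def)
  define n0 n1 n2 n3 where "n0 = racah_num M N" "n1 = racah_num (Suc M) N" "n2 = racah_num (Suc M) (Q * N)"
    "n3 = racah_num (Suc M) (N / Q)"
  have coeff: "n0 * f / I + racah_A N * (n2 - n1) + racah_C N * (n3 - n1) = n1 * (1 - I) * (1 - c * d * Q * I) / I"
    using racah_coeff[OF nz, of M] unfolding n0_n1_n2_n3_def f_def I_def by simp
  have IH: "\<theta> * racah_sum s t M N + racah_A N * (racah_sum s t M (Q * N) - racah_sum s t M N)
      + racah_C N * (racah_sum s t M (N / Q) - racah_sum s t M N) = n0 * \<phi> / D"
    using Suc.IH[OF Df(1)[unfolded D_def]] unfolding D_def \<theta>_def \<phi>_def n0_n1_n2_n3_def .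
  have "\<theta> * racah_sum s t (Suc M) N + racah_A N * (racah_sum s t (Suc M) (Q * N) - racah_sum s t (Suc M) N)
      + racah_C N * (racah_sum s t (Suc M) (N / Q) - racah_sum s t (Suc M) N)
    = n0 * \<phi> / D + (\<theta> * n1 + racah_A N * (n2 - n1) + racah_C N * (n3 - n1)) * (\<phi> / (D * f) * I)"
    unfolding sum unfolding IH[symmetric] unfolding n0_n1_n2_n3_def
    by (simp add: algebra_simps add_divide_distrib diff_divide_distrib)
  also have "n0 * \<phi> / D = n0 * f / I * (\<phi> / (D * f) * I)"
    using Df I by simp
  also have "\<dots> + (\<theta> * n1 + racah_A N * (n2 - n1) + racah_C N * (n3 - n1)) * (\<phi> / (D * f) * I)
      = (n0 * f / I + racah_A N * (n2 - n1) + racah_C N * (n3 - n1) + \<theta> * n1) * (\<phi> / (D * f) * I)"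
    by (simp only: ring_distribs add_ac)
  also have "\<dots> = n1 * \<phi> * ((1 - I) * (1 - c * d * Q * I) + I * \<theta>) / (D * f)"
    unfolding coeff using Df I by (simp add: divide_simps; simp add: algebra_simps)
  finally show ?case
    unfolding \<theta>_def basis den n0_n1_n2_n3_def by (simp add: mult.assoc)
qed

end

context
  fixes q w1 w2 J K x :: "'a :: field"
  assumes nz: "q \<noteq> 0" "w1 \<noteq> 0" "w2 \<noteq> 0" "J \<noteq> 0" "K \<noteq> 0" "x \<noteq> 0"
begin

text \<open>The quotient of the factors in front of R_(k+1) and R_k in the eigenvector, where J =
  q^(p-k), K = q^k, x = q^(2 \<lambda>) and w_i = q^(2 \<omega>_i).\<close>

definition racah_ratio :: 'a where
  "racah_ratio = - (w1 * w2 * (J * K) ^ 3 / q) * ((1 - K\<^sup>2 / x) * (1 - q\<^sup>2 * K\<^sup>2 / (w1 * (J * K)\<^sup>2)) * (1 - K\<^sup>2 / (J * K)\<^sup>2)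
     / ((1 - q\<^sup>2 * K\<^sup>2) * (1 - w2 * K\<^sup>2) * (1 - w1 * w2 * (J * K)\<^sup>2 * K\<^sup>2 / (q\<^sup>2 * x))))"

text \<open>The function \<open>phi p\<close> divided by q to the total weight.\<close>

definition phi_rat :: 'a where
  "phi_rat = (1 - q ^ 4 * x / (w1 * w2 * (J * K) ^ 4)) * (1 - x) / (q\<^sup>2 * x)"

text \<open>The parameters are those of the eigenvector, in base q^2 and with N = q^(2k). The factor
  J^2 - 1 shows that the coefficient vanishes at k = p.\<close>

lemma racah_A_eq: "racah_A (1 / (q\<^sup>2 * x)) (w2 / q\<^sup>2) (1 / (q\<^sup>2 * (J * K)\<^sup>2)) (q\<^sup>2 / (w1 * w2 * (J * K)\<^sup>2)) (q\<^sup>2) (K\<^sup>2)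
   = (q\<^sup>2 * x - w2 * K\<^sup>2) * (x - K\<^sup>2) * (w1 * J\<^sup>2 - q\<^sup>2) * (J\<^sup>2 - 1) / (w1 * J ^ 4 * ((q\<^sup>2 * x - w2 * K ^ 4) * (x - w2 * K ^ 4)))"
  unfolding racah_A_def using nz by (simp add: divide_simps; simp add: algebra_simps eval_nat_numeral)

lemma racah_C_eq: "racah_C (1 / (q\<^sup>2 * x)) (w2 / q\<^sup>2) (1 / (q\<^sup>2 * (J * K)\<^sup>2)) (q\<^sup>2 / (w1 * w2 * (J * K)\<^sup>2)) (q\<^sup>2) (K\<^sup>2)
   = (1 - K\<^sup>2) * (q\<^sup>2 - w2 * K\<^sup>2) * (q\<^sup>2 * x - w2 * (J * K)\<^sup>2 * K\<^sup>2) * (q ^ 4 * x - w1 * w2 * (J * K)\<^sup>2 * K\<^sup>2)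
     / ((J * K) ^ 4 * w1 * w2 * ((q ^ 4 * x - w2 * K ^ 4) * (q\<^sup>2 * x - w2 * K ^ 4)))"
  unfolding racah_C_def using nz by (simp add: divide_simps; simp add: algebra_simps eval_nat_numeral)

lemma ratA_at: "ratA q w1 J (x / q\<^sup>2 / (w2 * K ^ 4)) = J * (w1 * J\<^sup>2 * (w2 * K ^ 4) - x) / (w1 * J ^ 4 * (w2 * K ^ 4) - x)"
  unfolding ratA_def
  by (rule frac_eqI[where c = "inverse (w2 * K ^ 4)"]; use nz in \<open>simp add: field_simps eval_nat_numeral\<close>)

lemma ratB_at: "ratB q w1 J (x / q\<^sup>2 / (w2 * K ^ 4))
    = (1 - J\<^sup>2) * (q\<^sup>2 - w1 * J\<^sup>2) * q\<^sup>2 * x * w2 * K ^ 4 / ((w2 * K ^ 4 - x) * (q ^ 4 * x - w1 * J ^ 4 * (w2 * K ^ 4)))"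
  unfolding ratB_def
  by (rule frac_eqI[where c = "inverse ((w2 * K ^ 4)\<^sup>2)"]; use nz in \<open>simp add: field_simps eval_nat_numeral\<close>)

lemma ratD_at: "ratD q J (x / (w2 * K ^ 4)) = (J\<^sup>2 * (w2 * K ^ 4) - q\<^sup>2 * x) / (J * (w2 * K ^ 4 - q\<^sup>2 * x))"
  unfolding ratD_def
  by (rule frac_eqI[where c = "inverse (w2 * K ^ 4)"]; use nz in \<open>simp add: field_simps eval_nat_numeral\<close>)

lemma phi_rat_eq: "phi_rat = (w1 * w2 * (J * K) ^ 4 - q ^ 4 * x) * (1 - x) / (w1 * w2 * (J * K) ^ 4 * (q\<^sup>2 * x))"
  using nz by (simp add: phi_rat_def divide_simps)

end

text \<open>The coefficients of \<open>\<gamma>\<beta>\<close> factor, so that each of the following four identities compares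
  monomials in the linear factors introduced in its proof.\<close>

context
  fixes q w1 w2 J K x :: "'a :: field"
  assumes nz: "q \<noteq> 0" "w1 \<noteq> 0" "w2 \<noteq> 0" "J \<noteq> 0" "K \<noteq> 0" "x \<noteq> 0"
    and generic: "1 - x \<noteq> 0" "w1 * w2 * (J * K) ^ 4 - q ^ 4 * x \<noteq> 0"
begin

lemma phi_diag_up:
  "phi_rat q w1 w2 J K x * (- (1 / q) * ratA q w2 K x * (ratB q w1 J (x / q\<^sup>2 / (w2 * K ^ 4)) * ratD q K (x / q\<^sup>2)))
    = racah_A (1 / (q\<^sup>2 * x)) (w2 / q\<^sup>2) (1 / (q\<^sup>2 * (J * K)\<^sup>2)) (q\<^sup>2 / (w1 * w2 * (J * K)\<^sup>2)) (q\<^sup>2) (K\<^sup>2) / q"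
proof -
  define e1 e2 e3 e4 where e: "e1 = q\<^sup>2 * x - w2 * K\<^sup>2" "e2 = x - K\<^sup>2" "e3 = w1 * J\<^sup>2 - q\<^sup>2" "e4 = J\<^sup>2 - 1"
  define f1 f2 where f: "f1 = q\<^sup>2 * x - w2 * K ^ 4" "f2 = x - w2 * K ^ 4"
  define g1 g2 where g: "g1 = w1 * w2 * (J * K) ^ 4 - q ^ 4 * x" "g2 = 1 - x"
  have g0: "g1 \<noteq> 0" "g2 \<noteq> 0" using generic by (simp_all add: g)
  have p: "phi_rat q w1 w2 J K x = g1 * g2 / (w1 * w2 * (J * K) ^ 4 * (q\<^sup>2 * x))"
    unfolding phi_rat_eq[OF nz] g ..
  have a: "ratA q w2 K x = K * e1 / f1"
    unfolding ratA_def by (rule frac_eqI[where c = "- 1"]) (simp_all add: e f algebra_simps)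
  have b: "ratB q w1 J (x / q\<^sup>2 / (w2 * K ^ 4)) = e3 * e4 * (q\<^sup>2 * x * w2 * K ^ 4) / (f2 * g1)"
    unfolding ratB_at[OF nz] by (rule frac_eqI[where c = 1]) (simp_all add: e f g algebra_simps power_mult_distrib)
  have d: "ratD q K (x / q\<^sup>2) = - e2 / (K * g2)"
    using nz by (simp add: ratD_def e g)
  have A: "racah_A (1 / (q\<^sup>2 * x)) (w2 / q\<^sup>2) (1 / (q\<^sup>2 * (J * K)\<^sup>2)) (q\<^sup>2 / (w1 * w2 * (J * K)\<^sup>2)) (q\<^sup>2) (K\<^sup>2)
      = e1 * e2 * e3 * e4 / (w1 * J ^ 4 * (f1 * f2))"
    unfolding racah_A_eq[OF nz] e f ..
  show ?thesis unfolding p a b d A using g0 nz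
    by (simp add: divide_simps; simp add: eval_nat_numeral mult_ac)
qed

text \<open>\<open>racah_ratio\<close> refers the entry k + 1 to the prefactor of the entry k. The
  result is the negative of \<open>phi_diag_up\<close>, which produces the difference R_k - R_(k+1).
  The extra assumptions are the denominators of the ratio.\<close>

lemma phi_up:
  assumes "J = q * J'" and "1 - q\<^sup>2 * K\<^sup>2 \<noteq> 0" "1 - w2 * K\<^sup>2 \<noteq> 0" "w1 * w2 * J\<^sup>2 * K ^ 4 - q\<^sup>2 * x \<noteq> 0"
  shows "phi_rat q w1 w2 J K x * (- (1 / q) * ratA q w2 K x * (ratA q w1 J' (x / q\<^sup>2 / (w2 * K ^ 4)) * ratB q w2 (q * K) (x / q\<^sup>2)))
      * racah_ratio q w1 w2 J K x
    = - racah_A (1 / (q\<^sup>2 * x)) (w2 / q\<^sup>2) (1 / (q\<^sup>2 * (J * K)\<^sup>2)) (q\<^sup>2 / (w1 * w2 * (J * K)\<^sup>2)) (q\<^sup>2) (K\<^sup>2) / q"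
proof -
  define e1 e2 e3 e4 where e: "e1 = q\<^sup>2 * x - w2 * K\<^sup>2" "e2 = x - K\<^sup>2" "e3 = w1 * J\<^sup>2 - q\<^sup>2" "e4 = J\<^sup>2 - 1"
  define f1 f2 where f: "f1 = q\<^sup>2 * x - w2 * K ^ 4" "f2 = x - w2 * K ^ 4"
  define g1 g2 where g: "g1 = w1 * w2 * (J * K) ^ 4 - q ^ 4 * x" "g2 = 1 - x"
  define m1 m2 k1 where m: "m1 = 1 - q\<^sup>2 * K\<^sup>2" "m2 = 1 - w2 * K\<^sup>2" "k1 = w1 * w2 * J\<^sup>2 * K ^ 4 - q\<^sup>2 * x"
  have g0: "g1 \<noteq> 0" "g2 \<noteq> 0" "m1 \<noteq> 0" "m2 \<noteq> 0" "k1 \<noteq> 0" using generic assms by (simp_all add: g m)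
  have J': "J' \<noteq> 0" using nz assms by auto
  have p: "phi_rat q w1 w2 J K x = g1 * g2 / (w1 * w2 * (J * K) ^ 4 * (q\<^sup>2 * x))"
    unfolding phi_rat_eq[OF nz] g ..
  have a: "ratA q w2 K x = K * e1 / f1"
    unfolding ratA_def by (rule frac_eqI[where c = "- 1"]) (simp_all add: e f algebra_simps)
  have a': "ratA q w1 J' (x / q\<^sup>2 / (w2 * K ^ 4)) = J * q * k1 / g1"
    unfolding ratA_at[OF nz(1-3) J' nz(5,6)]
    by (rule frac_eqI[where c = "1 / q ^ 4"]; use nz in \<open>simp add: m g assms(1) field_simps eval_nat_numeral\<close>)
  have b: "ratB q w2 (q * K) (x / q\<^sup>2) = m1 * m2 * x / (g2 * f2)"
    unfolding ratB_shift(4)[OF nz(1,3,5)] m g f ..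
  have r: "racah_ratio q w1 w2 J K x = (w1 * w2 * (J * K) ^ 3 / q) * (e2 * e3 * e4 / (x * w1 * J ^ 4) * (q\<^sup>2 * x) / (m1 * m2 * k1))"
  proof -
    have "1 - K\<^sup>2 / x = e2 / x" "1 - q\<^sup>2 * K\<^sup>2 / (w1 * (J * K)\<^sup>2) = e3 / (w1 * J\<^sup>2)" "1 - K\<^sup>2 / (J * K)\<^sup>2 = e4 / J\<^sup>2"
      "1 - w1 * w2 * (J * K)\<^sup>2 * K\<^sup>2 / (q\<^sup>2 * x) = - k1 / (q\<^sup>2 * x)"
      using nz by (simp_all add: e m field_simps eval_nat_numeral)
    then show ?thesis
      unfolding racah_ratio_def[OF nz] m(1,2)[symmetric] using nz g0
      by (simp only:) (simp add: divide_simps; simp add: eval_nat_numeral mult_ac)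
  qed
  have A: "racah_A (1 / (q\<^sup>2 * x)) (w2 / q\<^sup>2) (1 / (q\<^sup>2 * (J * K)\<^sup>2)) (q\<^sup>2 / (w1 * w2 * (J * K)\<^sup>2)) (q\<^sup>2) (K\<^sup>2)
      = e1 * e2 * e3 * e4 / (w1 * J ^ 4 * (f1 * f2))"
    unfolding racah_A_eq[OF nz] e f ..
  show ?thesis unfolding p a a' b r A using g0 nz
    by (simp add: divide_simps; simp add: eval_nat_numeral mult_ac)
qed

lemma phi_diag_low:
  assumes "K = q * L"
  shows "phi_rat q w1 w2 J K x * (- (1 / q) * ratD q J (x / (w2 * K ^ 4)) * (ratA q w1 J (x / q\<^sup>2 / (w2 * L ^ 4)) * ratB q w2 K (x / q\<^sup>2)))
    = racah_C (1 / (q\<^sup>2 * x)) (w2 / q\<^sup>2) (1 / (q\<^sup>2 * (J * K)\<^sup>2)) (q\<^sup>2 / (w1 * w2 * (J * K)\<^sup>2)) (q\<^sup>2) (K\<^sup>2) / q"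
proof -
  define h1 h2 h3 h4 where h: "h1 = 1 - K\<^sup>2" "h2 = q\<^sup>2 - w2 * K\<^sup>2" "h3 = q\<^sup>2 * x - w2 * (J * K)\<^sup>2 * K\<^sup>2"
    "h4 = q ^ 4 * x - w1 * w2 * (J * K)\<^sup>2 * K\<^sup>2"
  define i1 i2 where i: "i1 = q ^ 4 * x - w2 * K ^ 4" "i2 = q\<^sup>2 * x - w2 * K ^ 4"
  define g1 g2 where g: "g1 = w1 * w2 * (J * K) ^ 4 - q ^ 4 * x" "g2 = 1 - x"
  have g0: "g1 \<noteq> 0" "g2 \<noteq> 0" using generic by (simp_all add: g)
  have L: "L \<noteq> 0" using nz assms by auto
  have p: "phi_rat q w1 w2 J K x = g1 * g2 / (w1 * w2 * (J * K) ^ 4 * (q\<^sup>2 * x))"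
    unfolding phi_rat_eq[OF nz] g ..
  have d: "ratD q J (x / (w2 * K ^ 4)) = h3 / (J * i2)"
    unfolding ratD_at[OF nz] by (rule frac_eqI[where c = "- 1"]) (simp_all add: h i eval_nat_numeral algebra_simps)
  have a: "ratA q w1 J (x / q\<^sup>2 / (w2 * L ^ 4)) = - J * h4 / g1"
    unfolding ratA_at[OF nz(1-4) L nz(6)]
    by (rule frac_eqI[where c = "1 / q ^ 4"]; use nz in \<open>simp add: h g assms(1) field_simps eval_nat_numeral\<close>)
  have b: "ratB q w2 K (x / q\<^sup>2) = h1 * h2 * q\<^sup>2 * x / (g2 * i1)"
    unfolding ratB_shift(1)[OF nz(1,3,5)] h g i ..
  have C: "racah_C (1 / (q\<^sup>2 * x)) (w2 / q\<^sup>2) (1 / (q\<^sup>2 * (J * K)\<^sup>2)) (q\<^sup>2 / (w1 * w2 * (J * K)\<^sup>2)) (q\<^sup>2) (K\<^sup>2)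
      = h1 * h2 * h3 * h4 / ((J * K) ^ 4 * w1 * w2 * (i1 * i2))"
    unfolding racah_C_eq[OF nz] h i ..
  show ?thesis unfolding p d a b C using g0 nz
    by (simp add: divide_simps; simp add: eval_nat_numeral mult_ac)
qed

text \<open>Here L = q^(k-1), and the ratio belongs to the step from k - 1 to k. The sign opposite
  to \<open>phi_diag_low\<close> produces R_k - R_(k-1).\<close>

lemma phi_low:
  assumes "K = q * L" and "1 - K\<^sup>2 \<noteq> 0" "q\<^sup>2 - w2 * K\<^sup>2 \<noteq> 0" "q ^ 4 * x - w1 * w2 * (J * K)\<^sup>2 * K\<^sup>2 \<noteq> 0"
  shows "phi_rat q w1 w2 J K x * (- (1 / q) * ratD q J (x / (w2 * K ^ 4)) * (ratB q w1 (q * J) (x / q\<^sup>2 / (w2 * L ^ 4)) * ratD q L (x / q\<^sup>2)))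
    = - racah_C (1 / (q\<^sup>2 * x)) (w2 / q\<^sup>2) (1 / (q\<^sup>2 * (J * K)\<^sup>2)) (q\<^sup>2 / (w1 * w2 * (J * K)\<^sup>2)) (q\<^sup>2) (K\<^sup>2) / q
      * racah_ratio q w1 w2 (q * J) L x"
proof -
  define h1 h2 h3 h4 where h: "h1 = 1 - K\<^sup>2" "h2 = q\<^sup>2 - w2 * K\<^sup>2" "h3 = q\<^sup>2 * x - w2 * (J * K)\<^sup>2 * K\<^sup>2"
    "h4 = q ^ 4 * x - w1 * w2 * (J * K)\<^sup>2 * K\<^sup>2"
  define i1 i2 where i: "i1 = q ^ 4 * x - w2 * K ^ 4" "i2 = q\<^sup>2 * x - w2 * K ^ 4"
  define g1 g2 where g: "g1 = w1 * w2 * (J * K) ^ 4 - q ^ 4 * x" "g2 = 1 - x"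
  define n1 n2 n3 where n: "n1 = 1 - q\<^sup>2 * J\<^sup>2" "n2 = 1 - w1 * J\<^sup>2" "n3 = q\<^sup>2 * x - K\<^sup>2"
  have g0: "g1 \<noteq> 0" "g2 \<noteq> 0" "h1 \<noteq> 0" "h2 \<noteq> 0" "h4 \<noteq> 0" using generic assms by (simp_all add: g h)
  have L: "L \<noteq> 0" and qJ: "q * J \<noteq> 0" using nz assms by auto
  have p: "phi_rat q w1 w2 J K x = g1 * g2 / (w1 * w2 * (J * K) ^ 4 * (q\<^sup>2 * x))"
    unfolding phi_rat_eq[OF nz] g ..
  have d: "ratD q J (x / (w2 * K ^ 4)) = h3 / (J * i2)"
    unfolding ratD_at[OF nz] by (rule frac_eqI[where c = "- 1"]) (simp_all add: h i eval_nat_numeral algebra_simps)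
  have b: "ratB q w1 (q * J) (x / q\<^sup>2 / (w2 * L ^ 4)) = n1 * n2 * x * w2 * K ^ 4 * q ^ 4 / (i1 * g1)"
    unfolding ratB_at[OF nz(1-3) qJ L nz(6)]
    by (rule frac_eqI[where c = "1 / q ^ 4"]; use nz in \<open>simp add: n i g assms(1) field_simps eval_nat_numeral\<close>)
  have d': "ratD q L (x / q\<^sup>2) = - n3 / (q * K * g2)"
    unfolding ratD_shift(1)[OF nz(1,3) L]
    by (rule frac_eqI[where c = "1 / q\<^sup>2"]; use nz in \<open>simp add: n g assms(1) field_simps eval_nat_numeral\<close>)
  have C: "racah_C (1 / (q\<^sup>2 * x)) (w2 / q\<^sup>2) (1 / (q\<^sup>2 * (J * K)\<^sup>2)) (q\<^sup>2 / (w1 * w2 * (J * K)\<^sup>2)) (q\<^sup>2) (K\<^sup>2)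
      = h1 * h2 * h3 * h4 / ((J * K) ^ 4 * w1 * w2 * (i1 * i2))"
    unfolding racah_C_eq[OF nz] h i ..
  have r: "racah_ratio q w1 w2 (q * J) L x = - (w2 * K ^ 3 * q / J) * (n1 * n2 * n3 / (h1 * h2 * h4))"
  proof -
    have "1 - L\<^sup>2 / x = n3 / (q\<^sup>2 * x)" "1 - q\<^sup>2 * L\<^sup>2 / (w1 * (q * J * L)\<^sup>2) = - n2 / (w1 * J\<^sup>2)"
      "1 - L\<^sup>2 / (q * J * L)\<^sup>2 = - n1 / (q\<^sup>2 * J\<^sup>2)" "1 - q\<^sup>2 * L\<^sup>2 = h1" "1 - w2 * L\<^sup>2 = h2 / q\<^sup>2"
      "1 - w1 * w2 * (q * J * L)\<^sup>2 * L\<^sup>2 / (q\<^sup>2 * x) = h4 / (q ^ 4 * x)"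
      "w1 * w2 * (q * J * L) ^ 3 / q = w1 * w2 * (J * K) ^ 3 / q"
      using nz L by (simp_all add: n h assms(1) field_simps eval_nat_numeral)
    then show ?thesis
      unfolding racah_ratio_def[OF nz(1-3) qJ L nz(6)] using nz g0
      by (simp only:) (simp add: divide_simps; simp add: eval_nat_numeral mult_ac)
  qed
  show ?thesis unfolding p d b d' C r using g0 nz
    by (simp add: divide_simps; simp add: eval_nat_numeral mult_ac)
qed

end

section \<open>The eigenvectors in terms of q-Racah polynomials\<close>

lemma qpow_square: "0 < q \<Longrightarrow> qpow (q\<^sup>2) z = qpow q (2 * z)"
  by (simp add: qpow_def ln_realpow mult_ac)

lemma racah_num_eq_0: "Q \<noteq> 0 \<Longrightarrow> k < i \<Longrightarrow> racah_num a b Q i (Q ^ k) = 0"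
  unfolding racah_num_def by (intro prod_zero bexI[of _ k]) auto

text \<open>The terms between k and p vanish through the factor 1 - B^k / B^k in
  \<open>racah_num\<close>, so the sum may be extended to p for every degree.\<close>

lemma qracah_eq_racah_sum:
  assumes "0 < q" "k \<le> p"
  defines "B \<equiv> (complex_of_real q)\<^sup>2"
  shows "qracah k x a b c d (q\<^sup>2) = racah_sum a b c d B (qpow (q\<^sup>2) (- x)) (c * d * qpow (q\<^sup>2) (x + 1)) p (B ^ k)"
proof -
  let ?s = "qpow (q\<^sup>2) (- x)" and ?t = "c * d * qpow (q\<^sup>2) (x + 1)"
  have B: "B \<noteq> 0" using assms by simp
  have k: "qpow (q\<^sup>2) (- of_nat k) = 1 / B ^ k"
    unfolding qpow_minus using assms by (simp add: qpow_of_nat inverse_eq_divide)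
  have "racah_sum a b c d B ?s ?t p (B ^ k)
      = (\<Sum>i\<le>k. racah_num a b B i (B ^ k) * racah_basis B ?s ?t i / racah_den a b c d B i * B ^ i)"
    unfolding racah_sum_def using assms(2) racah_num_eq_0[OF B, of k]
    by (intro sum.mono_neutral_right) auto
  also have "\<dots> = qracah k x a b c d (q\<^sup>2)"
    unfolding qracah_def Let_def k
    by (rule sum.cong[OF HOL.refl])
      (simp add: qpoch_def racah_num_def racah_basis_def racah_den_def prod.distrib B_def mult_ac)
  finally show ?thesis by simp
qed

context tensor_H
begin

context
  fixes p y :: nat
  assumes y: "y \<le> p" and defd: "formula_defined q \<omega>1 \<omega>2 p"
begin

definition pref :: "nat \<Rightarrow> complex \<Rightarrow> complex" where
  "pref k l = (-1) ^ k * qpow q (2 * of_nat k * (\<omega>1 + \<omega>2) + of_nat k * (3 * of_nat p - 1))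
     * (qpoch [qpow q (- 2 * l), qpow q (- 2 * (\<omega>1 + of_nat p - 1)), qpow q (- 2 * of_nat p)]
          (of_real (q\<^sup>2)) k
        / qpoch [of_real (q\<^sup>2), qpow q (2 * \<omega>2), qpow q (2 * (\<omega>1 + \<omega>2 + of_nat p - l - 1))]
          (of_real (q\<^sup>2)) k)"

abbreviation "pa l \<equiv> 1 / (Q\<^sup>2 * X l)"
abbreviation "pb \<equiv> X \<omega>2 / Q\<^sup>2"
abbreviation "pc \<equiv> 1 / (Q\<^sup>2 * (Q ^ p)\<^sup>2)"
abbreviation "pd \<equiv> Q\<^sup>2 / (X \<omega>1 * X \<omega>2 * (Q ^ p)\<^sup>2)"

text \<open>The parameters s and t of the recurrence at x = p - y, in base q^2.\<close>

definition par_s :: complex where "par_s = (Q ^ y)\<^sup>2 / (Q ^ p)\<^sup>2"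
definition par_t :: complex where "par_t = Q\<^sup>2 / (X \<omega>1 * X \<omega>2 * (Q ^ p)\<^sup>2 * (Q ^ y)\<^sup>2)"

text \<open>This makes sense also for k = p + 1, where it is a truncated series only; there it is
  multiplied by A_p = 0.\<close>

definition rac :: "nat \<Rightarrow> complex \<Rightarrow> complex" where
  "rac k l = racah_sum (pa l) pb pc pd (Q\<^sup>2) par_s par_t p ((Q\<^sup>2) ^ k)"

lemma pochhammer_params: "qpow q (- 2 * l) = 1 / X l" "qpow q (- 2 * (\<omega>1 + of_nat p - 1)) = Q\<^sup>2 / (X \<omega>1 * (Q ^ p)\<^sup>2)"
  "qpow q (- 2 * of_nat p) = 1 / (Q ^ p)\<^sup>2" "qpow q (2 * (\<omega>1 + \<omega>2 + of_nat p - l - 1)) = X \<omega>1 * X \<omega>2 * (Q ^ p)\<^sup>2 / (Q\<^sup>2 * X l)"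
  using q_pos by (simp_all add: qpow_simps qpow_of_nat inverse_eq_divide; simp add: field_simps)+

lemma racah_params: "qpow q (- 2 * (l + 1)) = pa l" "qpow q (2 * (\<omega>2 - 1)) = pb" "qpow q (- 2 * (of_nat p + 1)) = pc"
  "qpow q (- 2 * (\<omega>1 + \<omega>2 + of_nat p - 1)) = pd"
  using q_pos by (simp_all add: qpow_simps qpow_of_nat inverse_eq_divide; simp add: field_simps)+

lemma racah_param_s: "qpow (q\<^sup>2) (- (of_nat p - of_nat y)) = par_s"
proof -
  have "qpow (q\<^sup>2) (- (of_nat p - of_nat y)) = qpow q (of_nat y) ^ 2 / qpow q (of_nat p) ^ 2"
    using q_pos by (simp add: qpow_square[OF q_pos] qpow_diff right_diff_distrib qpow_numeral_mult)
  then show ?thesis using q_pos by (simp add: par_s_def qpow_of_nat)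
qed

lemma racah_param_t: "pc * pd * qpow (q\<^sup>2) (of_nat p - of_nat y + 1) = par_t"
proof -
  have "qpow (q\<^sup>2) (of_nat p - of_nat y + 1) = qpow q (of_nat p) ^ 2 / qpow q (of_nat y) ^ 2 * Q ^ 2"
    using q_pos by (simp add: qpow_square[OF q_pos] qpow_diff qpow_add ring_distribs qpow_numeral_mult qpow_numeral)
  then show ?thesis using q_pos by (simp add: par_t_def qpow_of_nat; simp add: field_simps)
qed

lemma par_s_t: "par_s * par_t = pc * pd * Q\<^sup>2"
  using q_pos by (simp add: par_s_def par_t_def field_simps)

lemma has_rep_v_coeff:
  assumes "k \<le> p"
  shows "has_rep (v_coeff q \<omega>1 \<omega>2 p y k) (\<lambda>l. pref k l * rac k l)"
proof -
  have "pref k l * rac k l = pref k l * qracah k (of_nat p - of_nat y) (qpow q (- 2 * (l + 1))) (qpow q (2 * (\<omega>2 - 1)))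
         (qpow q (- 2 * (of_nat p + 1))) (qpow q (- 2 * (\<omega>1 + \<omega>2 + of_nat p - 1))) (q\<^sup>2)" for l
    unfolding qracah_eq_racah_sum[OF q_pos assms] racah_params(1)[of l] racah_params(2-4) racah_param_s racah_param_t rac_def ..
  moreover have "has_rep (v_coeff q \<omega>1 \<omega>2 p y k) (\<lambda>l. pref k l * qracah k (of_nat p - of_nat y) (qpow q (- 2 * (l + 1))) (qpow q (2 * (\<omega>2 - 1)))
         (qpow q (- 2 * (of_nat p + 1))) (qpow q (- 2 * (\<omega>1 + \<omega>2 + of_nat p - 1))) (q\<^sup>2))"
    unfolding v_coeff_def pref_def qracah_def Let_def qpoch_def qpow_def list.map prod_list.Cons prod_list.Nil
    by (intro has_rep_mero_of meromorphic_intros analytic_on_imp_meromorphic_on analytic_intros)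
  ultimately show ?thesis by (simp only:)
qed

lemma qpoch_Suc: "qpoch [u1, u2, u3] B (Suc k)
    = qpoch [u1, u2, u3] B k * ((1 - u1 * B ^ k) * (1 - u2 * B ^ k) * (1 - u3 * B ^ k))"
  by (simp add: qpoch_def mult_ac)

lemma pref_Suc:
  assumes "k < p"
  shows "pref (Suc k) l = pref k l * racah_ratio Q (X \<omega>1) (X \<omega>2) (Q ^ (p - k)) (Q ^ k) (X l)"
proof -
  let ?e = "2 * of_nat k * (\<omega>1 + \<omega>2) + of_nat k * (3 * of_nat p - 1)"
  have P: "Q ^ (p - k) * Q ^ k = Q ^ p" using assms by (simp flip: power_add)
  have "2 * of_nat (Suc k) * (\<omega>1 + \<omega>2) + of_nat (Suc k) * (3 * of_nat p - 1)
      = ?e + (2 * \<omega>1 + 2 * \<omega>2 + (3 * of_nat p - 1))" by (simp add: algebra_simps)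
  then have e: "qpow q (2 * of_nat (Suc k) * (\<omega>1 + \<omega>2) + of_nat (Suc k) * (3 * of_nat p - 1))
      = qpow q ?e * (X \<omega>1 * X \<omega>2 * (Q ^ p) ^ 3 / Q)"
    using q_pos by (simp only: qpow_add[of q ?e]) (simp add: qpow_add qpow_diff qpow_numeral_mult qpow_of_nat qpow_1)
  have B: "(complex_of_real (q\<^sup>2)) ^ k = (Q ^ k)\<^sup>2" by (simp flip: power_mult add: mult.commute)
  have nz: "Q \<noteq> 0" "X \<omega>1 \<noteq> 0" "X \<omega>2 \<noteq> 0" "Q ^ (p - k) \<noteq> 0" "Q ^ k \<noteq> 0" "X l \<noteq> 0" using q_pos by simp_all
  show ?thesis
    unfolding racah_ratio_def[OF nz] P pref_def e qpoch_Suc pochhammer_params(1,4)[of l] pochhammer_params(2,3) B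
    by (simp add: mult_ac)
qed

text \<open>The first two factors occur in \<open>formula_defined\<close>; the last two are nonzero
  because no positive power of q is 1.\<close>

lemma par_nonzero:
  assumes "m < p"
  shows "1 - X \<omega>2 * (Q ^ m)\<^sup>2 \<noteq> 0" "1 - pb * pd * (Q\<^sup>2) ^ Suc m \<noteq> 0" "1 - (Q\<^sup>2) ^ Suc m \<noteq> 0" "1 - pc * (Q\<^sup>2) ^ Suc m \<noteq> 0"
proof -
  have B: "(Q ^ m)\<^sup>2 = (Q\<^sup>2) ^ m" by (simp flip: power_mult add: mult.commute)
  have "(\<Prod>i<p. 1 - X \<omega>2 * (Q\<^sup>2) ^ i) \<noteq> 0" "(\<Prod>i<p. 1 - Q\<^sup>2 / (X \<omega>1 * (Q ^ p)\<^sup>2) * (Q\<^sup>2) ^ i) \<noteq> 0"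
    using defd unfolding formula_defined_def pochhammer_params(2) qpoch_def by simp_all
  then have "1 - X \<omega>2 * (Q\<^sup>2) ^ m \<noteq> 0" and 2: "1 - Q\<^sup>2 / (X \<omega>1 * (Q ^ p)\<^sup>2) * (Q\<^sup>2) ^ m \<noteq> 0"
    using assms by (auto simp: prod_zero_iff)
  then show "1 - X \<omega>2 * (Q ^ m)\<^sup>2 \<noteq> 0" unfolding B by simp
  have "pb * pd * (Q\<^sup>2) ^ Suc m = Q\<^sup>2 / (X \<omega>1 * (Q ^ p)\<^sup>2) * (Q\<^sup>2) ^ m"
    using q_pos by (simp add: field_simps)
  with 2 show "1 - pb * pd * (Q\<^sup>2) ^ Suc m \<noteq> 0" by simp
  have lt: "q ^ i \<noteq> 1" if "i > 0" for i :: nat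
    using power_less_one_iff[of q i] q_pos q_less_1 that by (simp add: less_imp_neq)
  have ltQ: "Q ^ i \<noteq> 1" if "i > 0" for i :: nat
    using lt[OF that] of_real_eq_1_iff[of "q ^ i", where 'a = complex] by simp
  have "Q ^ (2 * Suc m) \<noteq> 1" by (rule ltQ) simp
  then show "1 - (Q\<^sup>2) ^ Suc m \<noteq> 0" by (simp add: power_mult power2_eq_square mult.assoc)
  have "Q ^ (2 * (p - m)) \<noteq> 1" using assms by (intro ltQ) simp
  moreover have "(Q ^ p)\<^sup>2 = Q ^ (2 * (p - m)) * Q ^ (2 * m)"
    using assms by (simp flip: power_add power_mult add: algebra_simps)
  moreover have "pc * (Q\<^sup>2) ^ Suc m = Q ^ (2 * m) / (Q ^ p)\<^sup>2"
    using q_pos by (simp add: power_mult B field_simps)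
  ultimately show "1 - pc * (Q\<^sup>2) ^ Suc m \<noteq> 0"
    using q_pos by (auto simp: field_simps)
qed

abbreviation "rA k l \<equiv> racah_A (pa l) pb pc pd (Q\<^sup>2) ((Q ^ k)\<^sup>2)"
abbreviation "rC k l \<equiv> racah_C (pa l) pb pc pd (Q\<^sup>2) ((Q ^ k)\<^sup>2)"

lemma rac_recurrence:
  assumes "k \<le> p"
  shows "eventually (\<lambda>l. rA k l * (rac k l - rac (Suc k) l)
       + (if k = 0 then 0 else rC k l * (rac k l - rac (k - 1) l))
     = (1 - par_s) * (1 - par_t) * rac k l) (cosparse UNIV)"
proof -
  define w where "w = X \<omega>2 * (Q ^ k) ^ 4"
  have ev: "eventually (\<lambda>l. w - Q ^ 4 * X l \<noteq> 0) (cosparse UNIV)" "eventually (\<lambda>l. w - Q\<^sup>2 * X l \<noteq> 0) (cosparse UNIV)"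
    "eventually (\<lambda>l. w - 1 * X l \<noteq> 0) (cosparse UNIV)"
    by (rule eventually_X_neq, use Q_nonzero in simp)+
  have "eventually (\<lambda>l. Q ^ (2 * m) - 1 * X l \<noteq> 0) (cosparse UNIV)" for m
    by (rule eventually_X_neq) simp
  then have ev': "eventually (\<lambda>l. \<forall>m\<in>{..<p}. Q ^ (2 * m) - 1 * X l \<noteq> 0) (cosparse UNIV)"
    by (intro eventually_ball_finite) auto
  have N: "(Q ^ k)\<^sup>2 = (Q\<^sup>2) ^ k" by (simp flip: power_mult add: mult.commute)
  \<comment> \<open>For k < p the first product contains its zero at index k; for k = p the second
    contains its zero at index p - y. The range up to p inclusive covers y = 0.\<close>
  have tail: "racah_num a b (Q\<^sup>2) p ((Q ^ k)\<^sup>2) * racah_basis (Q\<^sup>2) par_s par_t (Suc p) = 0" for a b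
  proof (cases "k = p")
    case True
    have "1 - par_s * (Q\<^sup>2) ^ (p - y) = 0"
    proof -
      have "(Q ^ p)\<^sup>2 = (Q ^ y)\<^sup>2 * (Q\<^sup>2) ^ (p - y)"
        using y by (simp flip: power_add power_mult add: algebra_simps)
      then show ?thesis using Q_nonzero by (simp add: par_s_def)
    qed
    then have "racah_basis (Q\<^sup>2) par_s par_t (Suc p) = 0"
      unfolding racah_basis_def by (intro prod_zero bexI[of _ "p - y"]) auto
    then show ?thesis by simp
  next
    case False
    with assms have "racah_num a b (Q\<^sup>2) p ((Q\<^sup>2) ^ k) = 0"
      using q_pos by (intro racah_num_eq_0) auto
    then show ?thesis unfolding N by simp
  qed
  from ev ev' show ?thesis
  proof eventually_elim
    case (elim l)
    have ab: "pa l * pb = X \<omega>2 / (Q ^ 4 * X l)" by (simp add: eval_nat_numeral)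
    have nz: "(Q ^ k)\<^sup>2 \<noteq> 0" "Q\<^sup>2 \<noteq> 0" "1 - pa l * pb * ((Q ^ k)\<^sup>2)\<^sup>2 \<noteq> 0" "1 - pa l * pb * Q\<^sup>2 * ((Q ^ k)\<^sup>2)\<^sup>2 \<noteq> 0"
      "1 - pa l * pb * (Q\<^sup>2)\<^sup>2 * ((Q ^ k)\<^sup>2)\<^sup>2 \<noteq> 0"
      using elim(1-3) Q_nonzero unfolding ab w_def
      by (auto simp: field_simps eval_nat_numeral)
    have "1 - pa l * (Q\<^sup>2) ^ Suc m \<noteq> 0" if "m < p" for m
    proof -
      have "pa l * (Q\<^sup>2) ^ Suc m = Q ^ (2 * m) / X l" using Q_nonzero by (simp add: power_mult)
      then show ?thesis using elim(4) that by (auto simp: field_simps)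
    qed
    then have den: "racah_den (pa l) pb pc pd (Q\<^sup>2) p \<noteq> 0"
      unfolding racah_den_def using par_nonzero(2-4) by (auto simp: prod_zero_iff)
    from racah_partial_sum[OF nz par_s_t den] have rec:
      "(1 - par_s) * (1 - par_t) * rac k l + rA k l * (rac (Suc k) l - rac k l)
        + rC k l * (racah_sum (pa l) pb pc pd (Q\<^sup>2) par_s par_t p ((Q ^ k)\<^sup>2 / Q\<^sup>2) - rac k l) = 0"
      unfolding tail by (simp add: rac_def N)
    show ?case
    proof (cases k)
      \<comment> \<open>The argument N / Q would mean degree -1, but C_0 = 0.\<close>
      case 0
      then have "rC k l = 0" by (simp add: racah_C_def)
      with rec 0 show ?thesis by (simp add: algebra_simps)
    next
      case (Suc k')
      have "(Q ^ k)\<^sup>2 / Q\<^sup>2 = (Q\<^sup>2) ^ k'" using Q_nonzero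
        by (simp add: Suc power_mult_distrib) (simp flip: power_mult add: mult.commute)
      with rec Suc show ?thesis by (simp add: rac_def algebra_simps)
    qed
  qed
qed

text \<open>The part of \<gamma>\<beta> that comes from \<gamma> \<otimes> \<alpha> in
  \<Delta>(\<gamma>): \<alpha> \<otimes> \<beta> brings in the entry k + 1 and \<beta> \<otimes>
  \<delta> the entry k. It will become the A_k part of the recurrence.\<close>

definition upper_part :: "nat \<Rightarrow> mero" where
  "upper_part k = (if k < p then
      C0 * H_A q \<omega>2 k * shift (- 1) (rho k (H_A q \<omega>1 (p - Suc k)) * H_B q \<omega>2 (Suc k)) * v_coeff q \<omega>1 \<omega>2 p y (Suc k)
      + C0 * H_A q \<omega>2 k * shift (- 1) (rho k (H_B q \<omega>1 (p - k)) * H_D q k) * v_coeff q \<omega>1 \<omega>2 p y k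
    else 0)"

text \<open>The part from \<delta> \<otimes> \<gamma>, with the entries k and k - 1. It will become
  the C_k part.\<close>

definition lower_part :: "nat \<Rightarrow> mero" where
  "lower_part k = (case k of 0 \<Rightarrow> 0 | Suc k' \<Rightarrow>
      C0 * rho k (H_D q (p - k)) * shift (- 1) (rho k' (H_A q \<omega>1 (p - k)) * H_B q \<omega>2 k) * v_coeff q \<omega>1 \<omega>2 p y k
      + C0 * rho k (H_D q (p - k)) * shift (- 1) (rho k' (H_B q \<omega>1 (Suc (p - k))) * H_D q k') * v_coeff q \<omega>1 \<omega>2 p y k')"

lemma gamma_beta_parts:
  assumes "k \<le> p"
  shows "coord_op (Mul Gam Beta) (coord (level p (v_coeff q \<omega>1 \<omega>2 p y))) (p - k) k = upper_part k + lower_part k"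
proof -
  let ?\<Psi> = "coord (level p (v_coeff q \<omega>1 \<omega>2 p y))"
  have up: "(case p - k of 0 \<Rightarrow> 0 | Suc j \<Rightarrow> C0 * H_A q \<omega>2 k * shift (- 1) (coord_op Beta ?\<Psi> j k)) = upper_part k"
  proof (cases "k < p")
    case True
    then have j: "p - k = Suc (p - Suc k)" by simp
    from True show ?thesis
      unfolding upper_part_def j
      by (simp add: coord_level shift_add shift_mult ring_distribs mult_ac del: lam_shift)
  qed (simp add: upper_part_def)
  have low: "(case k of 0 \<Rightarrow> 0 | Suc k' \<Rightarrow> rho k (H_D q (p - k)) * C0 * shift (- 1) (coord_op Beta ?\<Psi> (p - k) k')) = lower_part k"
  proof (cases k)
    case (Suc k')
    with assms show ?thesis
      unfolding lower_part_def
      by (simp add: coord_level shift_add shift_mult ring_distribs mult_ac del: lam_shift)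
  qed (simp add: lower_part_def)
  show ?thesis
    unfolding up[symmetric] low[symmetric] coord_op.simps(4,9) ..
qed

abbreviation "u \<equiv> qpow q (total_weight p)"

lemma phi_pointwise:
  assumes "J * K = Q ^ p" "J \<noteq> 0" "K \<noteq> 0"
  shows "u * (1 - Q ^ 4 * X l / u\<^sup>2) * (1 - X l) / (Q\<^sup>2 * X l) = u * phi_rat Q (X \<omega>1) (X \<omega>2) J K (X l)"
proof -
  have nz: "Q \<noteq> 0" "X \<omega>1 \<noteq> 0" "X \<omega>2 \<noteq> 0" "J \<noteq> 0" "K \<noteq> 0" "X l \<noteq> 0" using q_pos assms by simp_all
  have "u\<^sup>2 = X \<omega>1 * X \<omega>2 * (Q ^ p) ^ 4"
    using q_pos unfolding total_weight_def
    by (simp add: qpow_add qpow_numeral_mult qpow_of_nat; simp add: eval_nat_numeral mult_ac)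
  then show ?thesis unfolding phi_rat_def[OF nz] assms(1) by simp
qed

lemma upper_part_rep:
  assumes "k \<le> p"
  shows "has_rep (phi p * upper_part k) (\<lambda>l. u / Q * (rA k l * (rac k l - rac (Suc k) l)) * pref k l)"
proof (cases "k < p")
  case False
  with assms have "k = p" by simp
  \<comment> \<open>The factor 1 - c Q N of A_n vanishes, since the parameter c is q^(-2(p+1)) and N
    = q^(2p) in base q^2.\<close>
  then have "rA k l = 0" for l using Q_nonzero by (simp add: racah_A_def)
  with False show ?thesis by (simp add: upper_part_def has_rep_0)
next
  case True
  define J K where JK: "J = Q ^ (p - k)" "K = Q ^ k"
  have P: "J * K = Q ^ p" using True by (simp add: JK flip: power_add)
  have J': "J = Q * Q ^ (p - Suc k)" using True by (simp add: JK Suc_diff_Suc flip: power_Suc)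
  have ev: "eventually (\<lambda>l. 1 - 1 * X l \<noteq> 0) (cosparse UNIV)"
    "eventually (\<lambda>l. X \<omega>1 * X \<omega>2 * (J * K) ^ 4 - Q ^ 4 * X l \<noteq> 0) (cosparse UNIV)"
    "eventually (\<lambda>l. X \<omega>1 * X \<omega>2 * J\<^sup>2 * K ^ 4 - Q\<^sup>2 * X l \<noteq> 0) (cosparse UNIV)"
    by (rule eventually_X_neq, use Q_nonzero in simp)+
  have raw: "has_rep (phi p * upper_part k) (\<lambda>l. u * (1 - Q ^ 4 * X l / u\<^sup>2) * (1 - X l) / (Q\<^sup>2 * X l)
     * (- (1 / Q) * ratA Q (X \<omega>2) (Q ^ k) (X l)
          * (ratA Q (X \<omega>1) (Q ^ (p - Suc k)) (X (l + - 1 + (- \<omega>2 - 2 * of_nat k))) * ratB Q (X \<omega>2) (Q ^ Suc k) (X (l + - 1)))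
          * (pref (Suc k) l * rac (Suc k) l)
        + - (1 / Q) * ratA Q (X \<omega>2) (Q ^ k) (X l)
          * (ratB Q (X \<omega>1) (Q ^ (p - k)) (X (l + - 1 + (- \<omega>2 - 2 * of_nat k))) * ratD Q (Q ^ k) (X (l + - 1)))
          * (pref k l * rac k l)))"
    unfolding upper_part_def if_P[OF True] rho_def
    by (intro has_rep_phi has_rep_mult has_rep_add has_rep_C0 has_rep_H_A has_rep_v_coeff
        has_rep_shift[where F = "\<lambda>l. ratA Q (X \<omega>1) (Q ^ (p - Suc k)) (X (l + (- \<omega>2 - 2 * of_nat k))) * ratB Q (X \<omega>2) (Q ^ Suc k) (X l)"]
        has_rep_shift[where F = "\<lambda>l. ratB Q (X \<omega>1) (Q ^ (p - k)) (X (l + (- \<omega>2 - 2 * of_nat k))) * ratD Q (Q ^ k) (X l)"]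
        has_rep_shift[where F = "\<lambda>l. ratA Q (X \<omega>1) (Q ^ (p - Suc k)) (X l)"]
        has_rep_shift[where F = "\<lambda>l. ratB Q (X \<omega>1) (Q ^ (p - k)) (X l)"]
        has_rep_H_B has_rep_H_D) (use True in simp_all)
  show ?thesis
  proof (rule has_rep_cong[OF raw])
    from ev show "\<forall>\<^sub>\<approx>l. u * (1 - Q ^ 4 * X l / u\<^sup>2) * (1 - X l) / (Q\<^sup>2 * X l)
     * (- (1 / Q) * ratA Q (X \<omega>2) (Q ^ k) (X l)
          * (ratA Q (X \<omega>1) (Q ^ (p - Suc k)) (X (l + - 1 + (- \<omega>2 - 2 * of_nat k))) * ratB Q (X \<omega>2) (Q ^ Suc k) (X (l + - 1)))
          * (pref (Suc k) l * rac (Suc k) l)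
        + - (1 / Q) * ratA Q (X \<omega>2) (Q ^ k) (X l)
          * (ratB Q (X \<omega>1) (Q ^ (p - k)) (X (l + - 1 + (- \<omega>2 - 2 * of_nat k))) * ratD Q (Q ^ k) (X (l + - 1)))
          * (pref k l * rac k l))
      = u / Q * (rA k l * (rac k l - rac (Suc k) l)) * pref k l"
    proof eventually_elim
      case (elim l)
      have nz: "Q \<noteq> 0" "X \<omega>1 \<noteq> 0" "X \<omega>2 \<noteq> 0" "J \<noteq> 0" "K \<noteq> 0" "X l \<noteq> 0" using q_pos by (simp_all add: JK)
      have gen: "1 - X l \<noteq> 0" "X \<omega>1 * X \<omega>2 * (J * K) ^ 4 - Q ^ 4 * X l \<noteq> 0" using elim by simp_all
      have c: "1 - Q\<^sup>2 * K\<^sup>2 \<noteq> 0" "1 - X \<omega>2 * K\<^sup>2 \<noteq> 0"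
        using par_nonzero(1,3)[OF True] by (simp_all add: JK power_mult_distrib flip: power_mult) (simp add: mult.commute)
      define m1 where "m1 = - (1 / Q) * ratA Q (X \<omega>2) K (X l) * (ratA Q (X \<omega>1) (Q ^ (p - Suc k)) (X l / Q\<^sup>2 / (X \<omega>2 * K ^ 4)) * ratB Q (X \<omega>2) (Q * K) (X l / Q\<^sup>2))"
      define m2 where "m2 = - (1 / Q) * ratA Q (X \<omega>2) K (X l) * (ratB Q (X \<omega>1) J (X l / Q\<^sup>2 / (X \<omega>2 * K ^ 4)) * ratD Q K (X l / Q\<^sup>2))"
      define ph where "ph = phi_rat Q (X \<omega>1) (X \<omega>2) J K (X l)"
      have 1: "ph * m1 * racah_ratio Q (X \<omega>1) (X \<omega>2) J K (X l) = - rA k l / Q"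
        using phi_up[OF nz gen J' c elim(3)] unfolding ph_def m1_def P unfolding JK(2) .
      have 2: "ph * m2 = rA k l / Q"
        using phi_diag_up[OF nz gen] unfolding ph_def m2_def P unfolding JK(2) .
      have "u * ph * (m1 * (pref (Suc k) l * rac (Suc k) l) + m2 * (pref k l * rac k l))
          = u * (ph * m1 * racah_ratio Q (X \<omega>1) (X \<omega>2) J K (X l)) * pref k l * rac (Suc k) l + u * (ph * m2) * pref k l * rac k l"
        unfolding pref_Suc[OF True] JK by (simp add: algebra_simps)
      also have "\<dots> = u / Q * (rA k l * (rac k l - rac (Suc k) l)) * pref k l"
        unfolding 1 2 by (simp add: algebra_simps add_divide_distrib diff_divide_distrib)
      finally show ?case
        unfolding phi_pointwise[OF P nz(4,5)] X_shift power_Suc JK[symmetric] ph_def m1_def m2_def .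
    qed
  qed
qed

lemma lower_part_rep:
  assumes "k \<le> p"
  shows "has_rep (phi p * lower_part k)
    (\<lambda>l. u / Q * (if k = 0 then 0 else rC k l * (rac k l - rac (k - 1) l)) * pref k l)"
proof (cases k)
  case 0
  then show ?thesis by (simp add: lower_part_def has_rep_0)
next
  case (Suc k')
  with assms have k': "k' < p" by simp
  define J K where JK: "J = Q ^ (p - k)" "K = Q ^ k"
  have P: "J * K = Q ^ p" using assms by (simp add: JK flip: power_add)
  have K: "K = Q * Q ^ k'" by (simp add: JK Suc)
  have J: "Q ^ (p - k') = Q * J" "Q ^ Suc (p - k) = Q * J" using k' by (simp_all add: JK Suc Suc_diff_Suc flip: power_Suc)
  have ev: "eventually (\<lambda>l. 1 - 1 * X l \<noteq> 0) (cosparse UNIV)"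
    "eventually (\<lambda>l. X \<omega>1 * X \<omega>2 * (J * K) ^ 4 - Q ^ 4 * X l \<noteq> 0) (cosparse UNIV)"
    "eventually (\<lambda>l. X \<omega>1 * X \<omega>2 * (J * K)\<^sup>2 * K\<^sup>2 - Q ^ 4 * X l \<noteq> 0) (cosparse UNIV)"
    by (rule eventually_X_neq, use Q_nonzero in simp)+
  let ?F = "\<lambda>l. u * (1 - Q ^ 4 * X l / u\<^sup>2) * (1 - X l) / (Q\<^sup>2 * X l)
     * (- (1 / Q) * ratD Q (Q ^ (p - k)) (X (l + (- \<omega>2 - 2 * of_nat k)))
          * (ratA Q (X \<omega>1) (Q ^ (p - k)) (X (l + - 1 + (- \<omega>2 - 2 * of_nat k'))) * ratB Q (X \<omega>2) (Q ^ k) (X (l + - 1)))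
          * (pref k l * rac k l)
        + - (1 / Q) * ratD Q (Q ^ (p - k)) (X (l + (- \<omega>2 - 2 * of_nat k)))
          * (ratB Q (X \<omega>1) (Q ^ Suc (p - k)) (X (l + - 1 + (- \<omega>2 - 2 * of_nat k'))) * ratD Q (Q ^ k') (X (l + - 1)))
          * (pref k' l * rac k' l))"
  have raw: "has_rep (phi p * lower_part k) ?F"
    unfolding lower_part_def Suc nat.case rho_def
    by (intro has_rep_phi has_rep_mult has_rep_add has_rep_C0 has_rep_v_coeff
        has_rep_shift[where F = "\<lambda>l. ratA Q (X \<omega>1) (Q ^ (p - Suc k')) (X (l + (- \<omega>2 - 2 * of_nat k'))) * ratB Q (X \<omega>2) (Q ^ Suc k') (X l)"]
        has_rep_shift[where F = "\<lambda>l. ratB Q (X \<omega>1) (Q ^ Suc (p - Suc k')) (X (l + (- \<omega>2 - 2 * of_nat k'))) * ratD Q (Q ^ k') (X l)"]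
        has_rep_shift[where F = "\<lambda>l. ratA Q (X \<omega>1) (Q ^ (p - Suc k')) (X l)"]
        has_rep_shift[where F = "\<lambda>l. ratB Q (X \<omega>1) (Q ^ Suc (p - Suc k')) (X l)"]
        has_rep_shift[where F = "\<lambda>l. ratD Q (Q ^ (p - Suc k')) (X l)"]
        has_rep_H_A has_rep_H_B has_rep_H_D) (use k' in simp_all)
  show ?thesis
  proof (rule has_rep_cong[OF raw])
    from ev show "\<forall>\<^sub>\<approx>l. ?F l = u / Q * (if k = 0 then 0 else rC k l * (rac k l - rac (k - 1) l)) * pref k l"
    proof eventually_elim
      case (elim l)
      have nz: "Q \<noteq> 0" "X \<omega>1 \<noteq> 0" "X \<omega>2 \<noteq> 0" "J \<noteq> 0" "K \<noteq> 0" "X l \<noteq> 0" using q_pos by (simp_all add: JK)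
      have gen: "1 - X l \<noteq> 0" "X \<omega>1 * X \<omega>2 * (J * K) ^ 4 - Q ^ 4 * X l \<noteq> 0" using elim by simp_all
      have c: "1 - K\<^sup>2 \<noteq> 0" "Q\<^sup>2 - X \<omega>2 * K\<^sup>2 \<noteq> 0" "Q ^ 4 * X l - X \<omega>1 * X \<omega>2 * (J * K)\<^sup>2 * K\<^sup>2 \<noteq> 0"
      proof -
        have "K\<^sup>2 = (Q\<^sup>2) ^ Suc k'" unfolding K by (simp add: power_mult_distrib) (simp flip: power_mult add: mult.commute)
        then show "1 - K\<^sup>2 \<noteq> 0" using par_nonzero(3)[OF k'] by simp
        have "Q\<^sup>2 - X \<omega>2 * K\<^sup>2 = Q\<^sup>2 * (1 - X \<omega>2 * (Q ^ k')\<^sup>2)" unfolding K by (simp add: power_mult_distrib algebra_simps)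
        then show "Q\<^sup>2 - X \<omega>2 * K\<^sup>2 \<noteq> 0" using par_nonzero(1)[OF k'] nz by simp
        show "Q ^ 4 * X l - X \<omega>1 * X \<omega>2 * (J * K)\<^sup>2 * K\<^sup>2 \<noteq> 0" using elim(3) unfolding right_minus_eq by (rule not_sym)
      qed
      define m1 where "m1 = - (1 / Q) * ratD Q J (X l / (X \<omega>2 * K ^ 4)) * (ratA Q (X \<omega>1) J (X l / Q\<^sup>2 / (X \<omega>2 * (Q ^ k') ^ 4)) * ratB Q (X \<omega>2) K (X l / Q\<^sup>2))"
      define m2 where "m2 = - (1 / Q) * ratD Q J (X l / (X \<omega>2 * K ^ 4)) * (ratB Q (X \<omega>1) (Q * J) (X l / Q\<^sup>2 / (X \<omega>2 * (Q ^ k') ^ 4)) * ratD Q (Q ^ k') (X l / Q\<^sup>2))"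
      define ph where "ph = phi_rat Q (X \<omega>1) (X \<omega>2) J K (X l)"
      define rr where "rr = racah_ratio Q (X \<omega>1) (X \<omega>2) (Q * J) (Q ^ k') (X l)"
      have 1: "ph * m1 = rC k l / Q"
        using phi_diag_low[OF nz gen K] unfolding ph_def m1_def P unfolding JK(2) .
      have 2: "ph * m2 = - rC k l / Q * rr"
        using phi_low[OF nz gen K c] unfolding ph_def m2_def rr_def P unfolding JK(2) .
      have pr: "pref k l = pref k' l * rr"
        using pref_Suc[OF k', of l] unfolding J(1) rr_def Suc .
      have "u * ph * (m1 * (pref k l * rac k l) + m2 * (pref k' l * rac k' l))
          = u * (ph * m1) * pref k l * rac k l + u * (ph * m2) * pref k' l * rac k' l"
        by (simp add: algebra_simps)
      also have "\<dots> = u / Q * (rC k l * (rac k l - rac k' l)) * pref k l"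
        unfolding 1 2 pr by (simp add: algebra_simps add_divide_distrib diff_divide_distrib)
      finally have "u * ph * (m1 * (pref k l * rac k l) + m2 * (pref k' l * rac k' l))
          = u / Q * (if k = 0 then 0 else rC k l * (rac k l - rac (k - 1) l)) * pref k l"
        by (simp add: Suc)
      then show ?case
        unfolding phi_pointwise[OF P nz(4,5)] X_shift J(2) JK[symmetric] ph_def m1_def m2_def .
    qed
  qed
qed

text \<open>This matches the spectral factor of the recurrence with the eigenvalue gap required by
  \<open>is_eigenvector_level\<close>.\<close>

lemma eigenvalue_difference: "Xi_const p - Xi_const y = u / Q * ((1 - par_s) * (1 - par_t))"
proof -
  have tw: "qpow q (total_weight n) = qpow q (\<omega>1 + \<omega>2) * (Q ^ n)\<^sup>2" for n
    using q_pos unfolding total_weight_def by (simp add: qpow_add qpow_numeral_mult qpow_of_nat)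
  have X12: "X \<omega>1 * X \<omega>2 = (qpow q (\<omega>1 + \<omega>2))\<^sup>2"
    by (simp add: qpow_add qpow_numeral_mult power_mult_distrib)
  show ?thesis
    unfolding Xi_const_def qpow_diff tw par_s_def par_t_def X12
    using q_pos by (simp add: qpow_1 divide_simps; simp add: algebra_simps eval_nat_numeral)
qed

lemma v_coeff_eigen:
  assumes "k \<le> p"
  shows "phi p * coord_op (Mul Gam Beta) (coord (level p (v_coeff q \<omega>1 \<omega>2 p y))) (p - k) k
    = (const_mero (Xi_const p) - const_mero (Xi_const y)) * v_coeff q \<omega>1 \<omega>2 p y k"
proof -
  have "has_rep (phi p * (upper_part k + lower_part k))
      (\<lambda>l. u / Q * (rA k l * (rac k l - rac (Suc k) l)) * pref k l
        + u / Q * (if k = 0 then 0 else rC k l * (rac k l - rac (k - 1) l)) * pref k l)"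
    unfolding ring_distribs(1)[of "phi p" "upper_part k" "lower_part k"]
    by (rule has_rep_add[OF upper_part_rep[OF assms] lower_part_rep[OF assms]])
  moreover have "has_rep ((const_mero (Xi_const p) - const_mero (Xi_const y)) * v_coeff q \<omega>1 \<omega>2 p y k)
      (\<lambda>l. (Xi_const p - Xi_const y) * (pref k l * rac k l))"
    by (rule has_rep_mult[OF has_rep_diff[OF has_rep_const has_rep_const] has_rep_v_coeff[OF assms]])
  moreover have "\<forall>\<^sub>\<approx>l. u / Q * (rA k l * (rac k l - rac (Suc k) l)) * pref k l
        + u / Q * (if k = 0 then 0 else rC k l * (rac k l - rac (k - 1) l)) * pref k l
      = (Xi_const p - Xi_const y) * (pref k l * rac k l)"
    using rac_recurrence[OF assms]
  proof eventually_elim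
    case (elim l)
    have "u / Q * (rA k l * (rac k l - rac (Suc k) l)) * pref k l
        + u / Q * (if k = 0 then 0 else rC k l * (rac k l - rac (k - 1) l)) * pref k l
      = u / Q * (rA k l * (rac k l - rac (Suc k) l) + (if k = 0 then 0 else rC k l * (rac k l - rac (k - 1) l))) * pref k l"
      by (simp only: ring_distribs)
    also have "\<dots> = (Xi_const p - Xi_const y) * (pref k l * rac k l)"
      unfolding elim eigenvalue_difference by (simp only: mult_ac)
    finally show ?case .
  qed
  ultimately show ?thesis
    unfolding gamma_beta_parts[OF assms] by (rule has_rep_eqI)
qed

text \<open>This coordinate witnesses that the vector is not zero.\<close>

lemma v_coeff_0: "v_coeff q \<omega>1 \<omega>2 p y 0 = 1"
proof (rule has_rep_eqI)
  show "has_rep (v_coeff q \<omega>1 \<omega>2 p y 0) (\<lambda>l. pref 0 l * rac 0 l)" by (rule has_rep_v_coeff) simp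
  have "rac 0 l = 1" for l
  proof -
    have "racah_num a b (Q\<^sup>2) i 1 = 0" if "i > 0" for a b i
      using racah_num_eq_0[of "Q\<^sup>2" 0 i a b] that q_pos by simp
    then have "rac 0 l = (\<Sum>i\<in>{0}. racah_num (pa l) pb (Q\<^sup>2) i 1 * racah_basis (Q\<^sup>2) par_s par_t i
        / racah_den (pa l) pb pc pd (Q\<^sup>2) i * (Q\<^sup>2) ^ i)"
      unfolding rac_def racah_sum_def power_0 by (intro sum.mono_neutral_right) auto
    then show ?thesis by (simp add: racah_num_def racah_basis_def racah_den_def)
  qed
  then show "\<forall>\<^sub>\<approx>l. pref 0 l * rac 0 l = 1" by (simp add: pref_def qpoch_def)
qed (rule has_rep_1)

end

text \<open>The sum in \<open>v_vec\<close> is a finite sum in the sense of the algebra library, and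
  the monoid laws allow it to be evaluated.\<close>

lemma abelian_monoid_HH: "abelian_monoid HH"
proof (rule abelian_monoidI)
  fix x y z assume "x \<in> carrier HH" "y \<in> carrier HH" "z \<in> carrier HH"
  then obtain S T R where [simp]: "x = hs S" "y = hs T" "z = hs R" by (auto simp: HH_carrier)
  show "x \<oplus>\<^bsub>HH\<^esub> y \<in> carrier HH" by (simp add: HH_add HH_carrier)
  show "(x \<oplus>\<^bsub>HH\<^esub> y) \<oplus>\<^bsub>HH\<^esub> z = x \<oplus>\<^bsub>HH\<^esub> (y \<oplus>\<^bsub>HH\<^esub> z)" by (simp add: HH_add add.assoc)
  show "\<zero>\<^bsub>HH\<^esub> \<oplus>\<^bsub>HH\<^esub> x = x" by (simp add: HH_zero HH_add)
  show "x \<oplus>\<^bsub>HH\<^esub> y = y \<oplus>\<^bsub>HH\<^esub> x" by (simp add: HH_add add.commute)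
qed (simp add: HH_zero HH_carrier)

lemma finsum_hs: "finite A \<Longrightarrow> (\<Oplus>\<^bsub>HH\<^esub>k\<in>A. hs (S k)) = hs (sum S A)"
proof (induction A rule: finite_induct)
  case empty
  show ?case by (simp add: abelian_monoid.finsum_empty[OF abelian_monoid_HH] HH_zero)
next
  case (insert k A)
  then show ?case
    by (subst abelian_monoid.finsum_insert[OF abelian_monoid_HH]) (auto simp: HH_carrier HH_add)
qed

lemma v_vec_eq: "v_vec q \<omega>1 \<omega>2 p y = hs (level p (v_coeff q \<omega>1 \<omega>2 p y))"
proof -
  have "v_coeff q \<omega>1 \<omega>2 p y k \<odot>\<^bsub>HH\<^esub> pure_tensor V W (basis_vec (p - k)) (basis_vec k)
      = hs {#(basis_vec (p - k), Poly_Mapping.single k (v_coeff q \<omega>1 \<omega>2 p y k))#}" for k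
  proof -
    have "f \<odot>\<^bsub>W\<^esub> basis_vec k = Poly_Mapping.single k f" for f
      by (rule poly_mapping_eqI) (simp add: smult_H_space lookup_map_times basis_vec_def lookup_single when_def)
    then show ?thesis by (simp add: pure_tensor_def HH_smult)
  qed
  then show ?thesis by (simp add: v_vec_def level_def finsum_hs)
qed

lemma v_vec_eigenvector:
  assumes "y \<le> p" "formula_defined q \<omega>1 \<omega>2 p"
  shows "is_eigenvector HH (HH_rep q \<omega>1 \<omega>2 (Xi_elem q)) (Xi_eigenvalue q \<omega>1 \<omega>2 y) (v_vec q \<omega>1 \<omega>2 p y)"
  unfolding v_vec_eq Xi_const_eigenvalue[symmetric]
  by (rule is_eigenvector_level[of 0]) (simp_all add: v_coeff_0[OF assms] v_coeff_eigen[OF assms] del: coord_op.simps)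

end

theorem proposition6p1:
  fixes q :: real and \<omega>1 \<omega>2 :: complex and p :: nat
  assumes "0 < q" and "q < 1"
  shows "(\<forall>y\<in>{0..p}. \<exists>v\<in>weight_space (HH_space \<omega>1 \<omega>2) (\<omega>1 + \<omega>2 + 2 * of_nat p).
            is_eigenvector (HH_space \<omega>1 \<omega>2) (HH_rep q \<omega>1 \<omega>2 (Xi_elem q))
              (Xi_eigenvalue q \<omega>1 \<omega>2 y) v)
       \<and> (formula_defined q \<omega>1 \<omega>2 p \<longrightarrow>
          (\<forall>y\<in>{0..p}. v_vec q \<omega>1 \<omega>2 p y \<in> weight_space (HH_space \<omega>1 \<omega>2) (\<omega>1 + \<omega>2 + 2 * of_nat p)
            \<and> is_eigenvector (HH_space \<omega>1 \<omega>2) (HH_rep q \<omega>1 \<omega>2 (Xi_elem q))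
              (Xi_eigenvalue q \<omega>1 \<omega>2 y) (v_vec q \<omega>1 \<omega>2 p y)))"
proof -
  interpret tensor_H q \<omega>1 \<omega>2
    by standard (fact assms)+
  show ?thesis
    using exists_Xi_eigenvector v_vec_eigenvector level_weight_space unfolding v_vec_eq by auto
qed

end
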